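(* Let $\mu$ be a finite complex Borel measure on $\mathbb{C}$ and let $E=\{z\in\mathbb{C}: C^{\mu}(z)\text{ exists and } C^{\mu}(z)=0\}$. Then $E$ has measure zero with respect to (the variation of) the absolutely continuous component of $\mu$ with respect to two-dimensional Lebesgue measure $m_2$.
   Context: $C^{\mu}(z)=\lim_{\varepsilon\to 0}\int_{|\zeta-z|>\varepsilon}\frac{d\mu(\zeta)}{\zeta-z}$ whenever the limit exists. *)

theory Defs
  imports "HOL-Analysis.Analysis"
begin

text \<open>
  The library has no complex measures. A complex measure on the sigma-algebra of \<open>M\<close> is
  represented by its set function; only its values on \<open>sets M\<close> are ever used. Of the measure
  \<open>M\<close>, only \<open>space M\<close> and \<open>sets M\<close> matter. Such a set function is automatically finite (it takes
  no infinite value and has finite total variation), and vanishes on the empty set (take the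
  constant sequence \<open>{}\<close>).
\<close>

definition complex_measure :: "'a measure \<Rightarrow> ('a set \<Rightarrow> complex) \<Rightarrow> bool" where
  "complex_measure M \<mu> \<longleftrightarrow>
     (\<forall>A :: nat \<Rightarrow> 'a set. range A \<subseteq> sets M \<longrightarrow> disjoint_family A \<longrightarrow>
        (\<lambda>n. \<mu> (A n)) sums \<mu> (\<Union>n. A n))"

text \<open>
  The variation measure: the supremum runs over countable measurable partitions of \<open>A\<close>.
  The set functions in this and the next definition are countably additive on \<open>sets M\<close> whenever
  \<open>\<mu>\<close> is a complex measure (resp. \<open>\<rho>\<close> a finite signed measure), so that \<^const>\<open>measure_of\<close> does not
  fall back to the null measure.
\<close>

definition variation_measure :: "'a measure \<Rightarrow> ('a set \<Rightarrow> complex) \<Rightarrow> 'a measure" where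
  "variation_measure M \<mu> = measure_of (space M) (sets M)
     (\<lambda>A. SUP P \<in> {P :: nat \<Rightarrow> 'a set. range P \<subseteq> sets M \<and> disjoint_family P \<and> (\<Union>n. P n) = A}.
        \<Sum>n. ennreal (norm (\<mu> (P n))))"

text \<open>
  The positive part \<open>\<rho>\<^sup>+\<close> in the Jordan decomposition of a finite signed measure \<open>\<rho>\<close>; the negative
  part is the positive part of \<open>-\<rho>\<close>. Negative values \<open>\<rho> B\<close> are cut off at 0 by \<^const>\<open>ennreal\<close>,
  which is harmless since \<open>B = {}\<close> is admitted.
\<close>

definition jordan_pos :: "'a measure \<Rightarrow> ('a set \<Rightarrow> real) \<Rightarrow> 'a measure" where
  "jordan_pos M \<rho> = measure_of (space M) (sets M)
     (\<lambda>A. SUP B \<in> {B \<in> sets M. B \<subseteq> A}. ennreal (\<rho> B))"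

definition signed_integral :: "'a measure \<Rightarrow> ('a set \<Rightarrow> real) \<Rightarrow> ('a \<Rightarrow> complex) \<Rightarrow> complex" where
  "signed_integral M \<rho> f =
     integral\<^sup>L (jordan_pos M \<rho>) f - integral\<^sup>L (jordan_pos M (\<lambda>A. - \<rho> A)) f"

definition complex_measure_integral ::
    "'a measure \<Rightarrow> ('a set \<Rightarrow> complex) \<Rightarrow> ('a \<Rightarrow> complex) \<Rightarrow> complex" where
  "complex_measure_integral M \<mu> f =
     signed_integral M (\<lambda>A. Re (\<mu> A)) f + \<i> * signed_integral M (\<lambda>A. Im (\<mu> A)) f"

definition truncated_cauchy :: "(complex set \<Rightarrow> complex) \<Rightarrow> real \<Rightarrow> complex \<Rightarrow> complex" where
  "truncated_cauchy \<mu> \<epsilon> z =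
     complex_measure_integral borel \<mu>
       (\<lambda>\<zeta>. indicator {\<zeta>. norm (\<zeta> - z) > \<epsilon>} \<zeta> * (1 / (\<zeta> - z)))"

definition cauchy_pv_exists :: "(complex set \<Rightarrow> complex) \<Rightarrow> complex \<Rightarrow> bool" where
  "cauchy_pv_exists \<mu> z \<longleftrightarrow> (\<exists>L. ((\<lambda>\<epsilon>. truncated_cauchy \<mu> \<epsilon> z) \<longlongrightarrow> L) (at_right 0))"

definition cauchy_pv :: "(complex set \<Rightarrow> complex) \<Rightarrow> complex \<Rightarrow> complex" where
  "cauchy_pv \<mu> z = Lim (at_right 0) (\<lambda>\<epsilon>. truncated_cauchy \<mu> \<epsilon> z)"

definition complex_abs_continuous :: "'a measure \<Rightarrow> ('a set \<Rightarrow> complex) \<Rightarrow> bool" where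
  "complex_abs_continuous N \<nu> \<longleftrightarrow> (\<forall>A \<in> null_sets N. \<nu> A = 0)"

text \<open>\<open>\<nu>\<close> is concentrated on an \<open>N\<close>-null set.\<close>

definition complex_singular :: "'a measure \<Rightarrow> ('a set \<Rightarrow> complex) \<Rightarrow> bool" where
  "complex_singular N \<nu> \<longleftrightarrow>
     (\<exists>S \<in> null_sets N. \<forall>B \<in> sets N. B \<inter> S = {} \<longrightarrow> \<nu> B = 0)"

text \<open>
  \<open>\<mu> = \<mu>\<^sub>a + \<mu>\<^sub>s\<close> is the Lebesgue decomposition of \<open>\<mu>\<close> with respect to \<open>N\<close>. For sigma-finite \<open>N\<close>
  it exists and is unique on \<open>sets N\<close>, so \<open>\<mu>\<^sub>a\<close> is the absolutely continuous component of \<open>\<mu>\<close>.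
\<close>

definition lebesgue_decomposition ::
    "'a measure \<Rightarrow> ('a set \<Rightarrow> complex) \<Rightarrow> ('a set \<Rightarrow> complex) \<Rightarrow> ('a set \<Rightarrow> complex) \<Rightarrow> bool" where
  "lebesgue_decomposition N \<mu> \<mu>\<^sub>a \<mu>\<^sub>s \<longleftrightarrow>
     complex_measure N \<mu>\<^sub>a \<and> complex_measure N \<mu>\<^sub>s \<and>
     complex_abs_continuous N \<mu>\<^sub>a \<and> complex_singular N \<mu>\<^sub>s \<and>
     (\<forall>A \<in> sets N. \<mu> A = \<mu>\<^sub>a A + \<mu>\<^sub>s A)"

end

theory Submission
  imports Defs "HOL-Complex_Analysis.Complex_Analysis"
begin

text \<open>
  Write \<open>\<mu>\<close> as a combination of finite positive measures with total size \<open>\<nu>\<close>, and let \<open>u\<close> be its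
  absolutely convergent Cauchy potential, which is finite Lebesgue-almost everywhere and agrees
  with the principal value there. Suppose that \<open>\<mu>\<^sub>a\<close> has density near \<open>q \<noteq> 0\<close> on a set \<open>A\<close> of
  positive area on which \<open>u = 0\<close>. At almost every point \<open>c \<in> A\<close> both the area and \<open>\<nu>\<close> of
  \<open>B(c, r) - A\<close> are \<open>o(r\<^sup>2)\<close>, so \<open>\<nu> (B(c, r)) = O(r\<^sup>2)\<close>. On \<open>B(c, \<rho>)\<close> the potential of the mass
  outside \<open>B(c, 2\<rho>)\<close> is affine up to \<open>O(\<rho>)\<close>, and the mass inside contributes \<open>O(\<rho>)\<close> on
  average; as \<open>u = 0\<close> on most of the disc, the affine part is \<open>O(\<rho>)\<close> too. Hence the integral of
  \<open>\<bar>u\<bar>\<close> over \<open>B(c, \<rho>)\<close>, which only sees \<open>B(c, \<rho>) - A\<close>, is \<open>o(\<rho>\<^sup>3)\<close>. On the other hand, averaging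
  contour integrals of \<open>u\<close> over the squares centred at \<open>c\<close> gives, by the residue theorem,
  a multiple of the integral of a tent function of height \<open>\<rho>\<close> against \<open>\<mu>\<close>, which is of exact
  order \<open>\<bar>q\<bar> \<rho>\<^sup>3\<close>.
\<close>

section \<open>Jordan decomposition of signed measures\<close>

text \<open>The second-order expansion is forced by the growth rate. When \<nu> has mass
  \<open>O(r\<^sup>2)\<close> on discs, the first derivative of the far potential is only bounded
  through the integral of \<open>1 / |\<zeta> - c|\<^sup>2\<close>, whose dyadic shells all
  contribute equally; a constant approximation would lose a logarithm of \<rho>. One order further
  the shells sum to \<open>O(1 / \<rho>)\<close>. The affine part then has no a priori bound, and
  only the zeros of \<open>u\<close> control it.

  The averaged contour integral is a weak form of dbar u = - \<pi> \<mu>: the tangent field of the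
  squares is - 2 i times dbar of the tent. Squares turn the contours into four segments exchanged by
  quarter turns, so that planar Fubini recovers the average over half-sides.

  The density enters only through sets \<open>A\<close> on which the Jordan parts have bounded
  densities and the combined density stays within \<open>|q| / 4\<close> of a fixed
  \<open>q\<close>. All that remains to be known is that area and \<open>\<nu>\<close> are small
  outside \<open>A\<close> near \<open>c\<close>; singular mass of \<mu> lies outside
  \<open>A\<close> and is covered by the same estimate.\<close>

definition signed_additive :: "'a measure \<Rightarrow> ('a set \<Rightarrow> real) \<Rightarrow> bool" where
  "signed_additive M \<rho> \<longleftrightarrow>
     (\<forall>A :: nat \<Rightarrow> 'a set. range A \<subseteq> sets M \<longrightarrow> disjoint_family A \<longrightarrow>
        (\<lambda>n. \<rho> (A n)) sums \<rho> (\<Union>n. A n))"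

lemma signed_additiveD:
  "signed_additive M \<rho> \<Longrightarrow> range A \<subseteq> sets M \<Longrightarrow> disjoint_family A \<Longrightarrow> (\<lambda>n. \<rho> (A n)) sums \<rho> (\<Union>n. A n)"
  unfolding signed_additive_def by blast

lemma signed_additive_uminus: "signed_additive M \<rho> \<Longrightarrow> signed_additive M (\<lambda>A. - \<rho> A)"
  unfolding signed_additive_def by (auto intro: sums_minus)

lemma signed_additive_empty:
  assumes "signed_additive M \<rho>" shows "\<rho> {} = 0"
proof -
  have "(\<lambda>n::nat. \<rho> {}) sums \<rho> (\<Union>n::nat. {})"
    by (rule signed_additiveD[OF assms]) (auto simp: disjoint_family_on_def)
  then have "(\<lambda>n::nat. \<rho> {}) \<longlonglongrightarrow> 0" using summable_LIMSEQ_zero sums_summable by blast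
  then show ?thesis by (simp add: LIMSEQ_const_iff)
qed

lemma signed_additive_Un:
  assumes "signed_additive M \<rho>" "A \<in> sets M" "B \<in> sets M" "A \<inter> B = {}"
  shows "\<rho> (A \<union> B) = \<rho> A + \<rho> B"
proof -
  have "(\<lambda>n. \<rho> (binaryset A B n)) sums \<rho> (\<Union>n. binaryset A B n)"
  proof (rule signed_additiveD[OF assms(1)])
    show "range (binaryset A B) \<subseteq> sets M" using assms(2,3) by (simp add: range_binaryset_eq)
    show "disjoint_family (binaryset A B)"
      using assms(4) by (simp add: disjoint_family_on_def binaryset_def Int_commute)
  qed
  moreover have "(\<lambda>n. \<rho> (binaryset A B n)) sums (\<rho> A + \<rho> B)"
    by (rule binaryset_sums) (rule signed_additive_empty[OF assms(1)])
  ultimately show ?thesis using sums_unique2 by (simp add: UN_binaryset_eq)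
qed

lemma signed_additive_Diff:
  assumes "signed_additive M \<rho>" "A \<in> sets M" "B \<in> sets M" "B \<subseteq> A"
  shows "\<rho> (A - B) = \<rho> A - \<rho> B"
proof -
  have "B \<union> (A - B) = A" using assms(4) by auto
  then show ?thesis using signed_additive_Un[OF assms(1,3), of "A - B"] assms(2,3) by auto
qed

text \<open>A set with unbounded charges on its subsets splits into a part of the same kind and a
  remainder of charge at least 1 in modulus. Iterating yields infinitely many disjoint remainders,
  whose charges would have to form a convergent series.\<close>

lemma signed_additive_bounded:
  assumes \<rho>: "signed_additive M \<rho>"
  obtains K where "\<And>B. B \<in> sets M \<Longrightarrow> \<bar>\<rho> B\<bar> \<le> K"
proof -
  define bd where "bd A \<longleftrightarrow> (\<exists>K. \<forall>B\<in>sets M. B \<subseteq> A \<longrightarrow> \<bar>\<rho> B\<bar> \<le> K)" for A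
  have split: "\<exists>B\<in>sets M. B \<subseteq> A \<and> \<not> bd B \<and> \<bar>\<rho> (A - B)\<bar> \<ge> 1" if A: "A \<in> sets M" "\<not> bd A" for A
  proof -
    \<comment> \<open>The excess 1 over \<open>\<bar>\<rho> A\<bar>\<close> gives both
      \<open>B\<close> and \<open>A - B\<close> charge at least 1 in modulus, so either of them may
      be the one discarded.\<close>
    obtain B where B: "B \<in> sets M" "B \<subseteq> A" "\<bar>\<rho> B\<bar> > \<bar>\<rho> A\<bar> + 1"
      using A unfolding bd_def by (meson not_le)
    have d: "\<rho> (A - B) = \<rho> A - \<rho> B" using signed_additive_Diff[OF \<rho> A(1) B(1,2)] .
    have "\<not> bd B \<or> \<not> bd (A - B)"
    proof (rule ccontr)
      assume "\<not> ?thesis"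
      then obtain K L where K: "\<forall>C\<in>sets M. C \<subseteq> B \<longrightarrow> \<bar>\<rho> C\<bar> \<le> K"
        and L: "\<forall>C\<in>sets M. C \<subseteq> A - B \<longrightarrow> \<bar>\<rho> C\<bar> \<le> L" unfolding bd_def by blast
      have "\<bar>\<rho> C\<bar> \<le> K + L" if C: "C \<in> sets M" "C \<subseteq> A" for C
      proof -
        have "\<rho> C = \<rho> (C \<inter> B) + \<rho> (C - B)"
          using signed_additive_Un[OF \<rho>, of "C \<inter> B" "C - B"] C B by (simp add: Int_Diff_Un Int_Diff_disjoint sets.Int sets.Diff)
        moreover have "\<bar>\<rho> (C \<inter> B)\<bar> \<le> K" using K[rule_format, of "C \<inter> B"] C B by simp
        moreover have "\<bar>\<rho> (C - B)\<bar> \<le> L" using L[rule_format, of "C - B"] C B by (simp add: Diff_mono)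
        ultimately show ?thesis by linarith
      qed
      then show False using A(2) unfolding bd_def by blast
    qed
    then show ?thesis
    proof
      assume "\<not> bd B" then show ?thesis using B d by (intro bexI[of _ B]) auto
    next
      assume "\<not> bd (A - B)"
      moreover have "A - (A - B) = B" using B by auto
      ultimately show ?thesis using B d A by (intro bexI[of _ "A - B"]) auto
    qed
  qed
  have "bd (space M)"
  proof (rule ccontr)
    assume nb: "\<not> bd (space M)"
    define nx where "nx A = (SOME B. B \<in> sets M \<and> B \<subseteq> A \<and> \<not> bd B \<and> \<bar>\<rho> (A - B)\<bar> \<ge> 1)" for A
    have nx: "nx A \<in> sets M \<and> nx A \<subseteq> A \<and> \<not> bd (nx A) \<and> \<bar>\<rho> (A - nx A)\<bar> \<ge> 1"
      if "A \<in> sets M" "\<not> bd A" for A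
      unfolding nx_def by (rule someI_ex) (use split[OF that] in blast)
    define X where "X n = (nx ^^ n) (space M)" for n
    have X: "X n \<in> sets M \<and> \<not> bd (X n)" for n
      by (induction n) (use nb nx in \<open>auto simp: X_def\<close>)
    have X_Suc: "X (Suc n) = nx (X n)" for n by (simp add: X_def)
    have dec: "decseq X" using nx X by (intro decseq_SucI) (auto simp: X_Suc)
    have disj: "disjoint_family (\<lambda>n. X n - X (Suc n))"
    proof -
      have "(X m - X (Suc m)) \<inter> (X n - X (Suc n)) = {}" if "m < n" for m n
        using decseqD[OF dec, of "Suc m" n] that by auto
      then show ?thesis unfolding disjoint_family_on_def
        by (metis Int_commute linorder_neqE_nat)
    qed
    have "(\<lambda>n. \<rho> (X n - X (Suc n))) sums \<rho> (\<Union>n. X n - X (Suc n))"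
      using X by (intro signed_additiveD[OF \<rho>] disj) auto
    then have "(\<lambda>n. \<rho> (X n - X (Suc n))) \<longlonglongrightarrow> 0" using summable_LIMSEQ_zero sums_summable by blast
    then obtain n where "\<bar>\<rho> (X n - X (Suc n))\<bar> < 1"
      unfolding LIMSEQ_iff by (metis diff_zero le_refl real_norm_def zero_less_one)
    moreover have "\<bar>\<rho> (X n - X (Suc n))\<bar> \<ge> 1" using nx X unfolding X_Suc by auto
    ultimately show False by simp
  qed
  then show ?thesis unfolding bd_def using that sets.sets_into_space by metis
qed

lemma ennreal_sum_le_sum_ennreal: "ennreal (sum f I) \<le> (\<Sum>i\<in>I. ennreal (f i))"
proof (induction I rule: infinite_finite_induct)
  case (insert x F)
  have "ennreal (f x + sum f F) \<le> ennreal (f x) + ennreal (sum f F)"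
  proof (cases "f x \<ge> 0 \<and> sum f F \<ge> 0")
    case False
    then have "ennreal (f x + sum f F) \<le> ennreal (f x) \<or> ennreal (f x + sum f F) \<le> ennreal (sum f F)"
      by (auto intro: ennreal_leI)
    then show ?thesis by (metis add_increasing add_increasing2 zero_le)
  qed simp
  then show ?case using insert by (simp add: add_left_mono order_trans)
qed auto


text \<open>Superadditivity: subsets of two disjoint sets are chosen independently, and their union
  competes for the joint supremum. Subadditivity: a competitor \<open>B\<close> for the union is cut
  along the \<open>A n\<close>, and truncating negative charges at 0 only enlarges the sum.\<close>

lemma countably_additive_jordan_pos:
  assumes \<rho>: "signed_additive M \<rho>"
  shows "countably_additive (sets M) (\<lambda>A. SUP B \<in> {B \<in> sets M. B \<subseteq> A}. ennreal (\<rho> B))"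
    (is "countably_additive _ ?P")
proof (rule countably_additiveI)
  fix A :: "nat \<Rightarrow> 'a set"
  assume A: "range A \<subseteq> sets M" "disjoint_family A" "\<Union>(range A) \<in> sets M"
  have P_upper: "ennreal (\<rho> B) \<le> ?P C" if "B \<in> sets M" "B \<subseteq> C" for B C
    by (rule SUP_upper) (use that in auto)
  have P_mono: "?P C \<le> ?P D" if "C \<subseteq> D" for C D
    by (rule SUP_subset_mono) (use that in auto)
  have super: "?P C + ?P D \<le> ?P (C \<union> D)" if CD: "C \<inter> D = {}" for C D
  proof -
    have 1: "ennreal (\<rho> B) + ennreal (\<rho> B') \<le> ?P (C \<union> D)"
      if B: "B \<in> sets M" "B \<subseteq> C" "B' \<in> sets M" "B' \<subseteq> D" for B B'
    proof (cases "\<rho> B \<ge> 0 \<and> \<rho> B' \<ge> 0")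
      case True
      have "\<rho> (B \<union> B') = \<rho> B + \<rho> B'" using B CD by (intro signed_additive_Un[OF \<rho>]) auto
      then have "ennreal (\<rho> B) + ennreal (\<rho> B') = ennreal (\<rho> (B \<union> B'))" using True by simp
      also have "\<dots> \<le> ?P (C \<union> D)" using B by (intro P_upper) auto
      finally show ?thesis .
    next
      case False
      then have "ennreal (\<rho> B) = 0 \<or> ennreal (\<rho> B') = 0" by (auto simp: ennreal_neg)
      moreover have "ennreal (\<rho> B) \<le> ?P (C \<union> D)" "ennreal (\<rho> B') \<le> ?P (C \<union> D)"
        using B by (auto intro!: P_upper)
      ultimately show ?thesis by auto
    qed
    have ne: "{B \<in> sets M. B \<subseteq> X} \<noteq> {}" for X by blast
    have "?P C + ?P D = (SUP B \<in> {B \<in> sets M. B \<subseteq> C}. ennreal (\<rho> B) + ?P D)"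
      using ennreal_SUP_add_left[OF ne] by simp
    also have "\<dots> = (SUP B \<in> {B \<in> sets M. B \<subseteq> C}. SUP B' \<in> {B \<in> sets M. B \<subseteq> D}. ennreal (\<rho> B) + ennreal (\<rho> B'))"
      using ennreal_SUP_add_right[OF ne] by simp
    also have "\<dots> \<le> ?P (C \<union> D)" using 1 by (intro SUP_least) auto
    finally show ?thesis .
  qed
  show "(\<Sum>i. ?P (A i)) = ?P (\<Union>(range A))"
  proof (rule antisym)
    have "(\<Sum>i<n. ?P (A i)) \<le> ?P (\<Union>i<n. A i)" for n
    proof (induction n)
      case (Suc n)
      have "(\<Sum>i<Suc n. ?P (A i)) \<le> ?P (\<Union>i<n. A i) + ?P (A n)" using Suc by (simp add: add_right_mono)
      also have "\<dots> \<le> ?P ((\<Union>i<n. A i) \<union> A n)"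
      proof (rule super)
        have "A i \<inter> A n = {}" if "i < n" for i
          using A(2) that unfolding disjoint_family_on_def by auto
        then show "(\<Union>i<n. A i) \<inter> A n = {}" by blast
      qed
      finally show ?case by (simp add: lessThan_Suc Un_commute)
    qed simp
    also have "?P (\<Union>i<n. A i) \<le> ?P (\<Union>(range A))" for n by (intro P_mono) auto
    finally show "(\<Sum>i. ?P (A i)) \<le> ?P (\<Union>(range A))"
      by (intro suminf_le_const) auto
  next
    show "?P (\<Union>(range A)) \<le> (\<Sum>i. ?P (A i))"
    proof (rule SUP_least)
      fix B assume "B \<in> {B \<in> sets M. B \<subseteq> \<Union>(range A)}"
      then have B: "B \<in> sets M" "B \<subseteq> \<Union>(range A)" by auto
      have "(\<lambda>n. \<rho> (B \<inter> A n)) sums \<rho> (\<Union>n. B \<inter> A n)"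
        using A B by (intro signed_additiveD[OF \<rho>]) (auto simp: disjoint_family_on_def)
      moreover have "(\<Union>n. B \<inter> A n) = B" using B by auto
      ultimately have "(\<lambda>n. ennreal (\<Sum>i<n. \<rho> (B \<inter> A i))) \<longlonglongrightarrow> ennreal (\<rho> B)"
        unfolding sums_def by (intro tendsto_ennrealI) simp
      then show "ennreal (\<rho> B) \<le> (\<Sum>i. ?P (A i))"
      proof (rule LIMSEQ_le_const2, intro exI allI impI)
        fix n :: nat
        have "ennreal (\<Sum>i<n. \<rho> (B \<inter> A i)) \<le> (\<Sum>i<n. ennreal (\<rho> (B \<inter> A i)))"
          by (rule ennreal_sum_le_sum_ennreal)
        also have "\<dots> \<le> (\<Sum>i<n. ?P (A i))"
          using A B by (intro sum_mono P_upper) auto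
        also have "\<dots> \<le> (\<Sum>i. ?P (A i))" by (intro sum_le_suminf) auto
        finally show "ennreal (\<Sum>i<n. \<rho> (B \<inter> A i)) \<le> (\<Sum>i. ?P (A i))" .
      qed
    qed
  qed
qed

lemma sets_jordan_pos [simp]: "sets (jordan_pos M \<rho>) = sets M"
  unfolding jordan_pos_def by (simp add: sets.space_closed sets.sigma_sets_eq)

lemma space_jordan_pos [simp]: "space (jordan_pos M \<rho>) = space M"
  unfolding jordan_pos_def by (simp add: sets.space_closed space_measure_of)

lemma emeasure_jordan_pos:
  assumes \<rho>: "signed_additive M \<rho>" and A: "A \<in> sets M"
  shows "emeasure (jordan_pos M \<rho>) A = (SUP B \<in> {B \<in> sets M. B \<subseteq> A}. ennreal (\<rho> B))"
proof (rule emeasure_measure_of[OF jordan_pos_def[of M \<rho>]])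
  have "{B \<in> sets M. B \<subseteq> {}} = {{}}" by auto
  then show "positive (sets (jordan_pos M \<rho>)) (\<lambda>A. SUP B \<in> {B \<in> sets M. B \<subseteq> A}. ennreal (\<rho> B))"
    using signed_additive_empty[OF \<rho>] by (simp add: positive_def)
  show "sets M \<subseteq> Pow (space M)" by (rule sets.space_closed)
  show "A \<in> sets (jordan_pos M \<rho>)" using A by simp
  show "countably_additive (sets (jordan_pos M \<rho>)) (\<lambda>A. SUP B \<in> {B \<in> sets M. B \<subseteq> A}. ennreal (\<rho> B))"
    using countably_additive_jordan_pos[OF \<rho>] by simp
qed

lemma finite_measure_jordan_pos:
  assumes \<rho>: "signed_additive M \<rho>"
  shows "finite_measure (jordan_pos M \<rho>)"
proof -
  obtain K where K: "\<And>B. B \<in> sets M \<Longrightarrow> \<bar>\<rho> B\<bar> \<le> K" using signed_additive_bounded[OF \<rho>] by blast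
  have "emeasure (jordan_pos M \<rho>) (space M) \<le> ennreal K"
    using K by (subst emeasure_jordan_pos[OF \<rho>]) (auto intro!: SUP_least ennreal_leI simp: abs_le_iff)
  then show ?thesis by (intro finite_measureI) (auto simp: top_unique)
qed

text \<open>For \<open>B \<subseteq> A\<close>, \<open>\<rho> B = \<rho> A - \<rho> (A - B)\<close>
  is at most \<open>\<rho> A\<close> plus the negative part of \<open>A\<close>; the supremum over
  \<open>B\<close> gives one inequality, the same argument for \<open>- \<rho>\<close> the
  other.\<close>

lemma measure_jordan_pos_diff:
  assumes \<rho>: "signed_additive M \<rho>" and A: "A \<in> sets M"
  shows "measure (jordan_pos M \<rho>) A - measure (jordan_pos M (\<lambda>A. - \<rho> A)) A = \<rho> A"
proof -
  have le: "measure (jordan_pos M \<sigma>) A \<le> \<sigma> A + measure (jordan_pos M (\<lambda>A. - \<sigma> A)) A"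
    if \<sigma>: "signed_additive M \<sigma>" for \<sigma>
  proof -
    let ?N = "jordan_pos M (\<lambda>A. - \<sigma> A)"
    have \<sigma>': "signed_additive M (\<lambda>A. - \<sigma> A)" by (rule signed_additive_uminus[OF \<sigma>])
    interpret P: finite_measure "jordan_pos M \<sigma>" by (rule finite_measure_jordan_pos[OF \<sigma>])
    interpret N: finite_measure ?N by (rule finite_measure_jordan_pos[OF \<sigma>'])
    have le1: "\<sigma> B \<le> \<sigma> A + measure ?N A" if B: "B \<in> sets M" "B \<subseteq> A" for B
    proof -
      have "ennreal (- \<sigma> (A - B)) \<le> emeasure ?N A"
        using A B by (subst emeasure_jordan_pos[OF \<sigma>' A]) (auto intro!: SUP_upper2[of "A - B"])
      then have "- \<sigma> (A - B) \<le> measure ?N A"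
        by (simp add: N.emeasure_eq_measure)
      then show ?thesis using signed_additive_Diff[OF \<sigma> A B] by simp
    qed
    \<comment> \<open>Nonnegativity is needed to return from \<open>ennreal\<close> to the
      reals.\<close>
    have "0 \<le> \<sigma> A + measure ?N A" using le1[of "{}"] signed_additive_empty[OF \<sigma>] by simp
    moreover have "emeasure (jordan_pos M \<sigma>) A \<le> ennreal (\<sigma> A + measure ?N A)"
      by (subst emeasure_jordan_pos[OF \<sigma> A]) (auto intro!: SUP_least ennreal_leI le1)
    ultimately show ?thesis by (simp add: P.emeasure_eq_measure)
  qed
  show ?thesis using le[OF \<rho>] le[OF signed_additive_uminus[OF \<rho>]] by simp
qed

section \<open>Density points\<close>

lemma emeasure_ball_complex: "r \<ge> 0 \<Longrightarrow> emeasure lborel (ball (c::complex) r) = ennreal (pi * r\<^sup>2)"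
  using emeasure_ball[of r c] by (simp add: unit_ball_vol_2)

lemma emeasure_UN_countable_le:
  assumes C: "countable C" and X [measurable]: "\<And>i. i \<in> C \<Longrightarrow> X i \<in> sets M"
  shows "emeasure M (\<Union>i\<in>C. X i) \<le> (\<integral>\<^sup>+i. emeasure M (X i) \<partial>count_space C)"
proof -
  have S: "(\<Union>i\<in>C. X i) \<in> sets M" using C X by (intro sets.countable_UN') auto
  have "emeasure M (\<Union>i\<in>C. X i) = (\<integral>\<^sup>+x. indicator (\<Union>i\<in>C. X i) x \<partial>M)" using S by simp
  also have "\<dots> \<le> (\<integral>\<^sup>+x. \<integral>\<^sup>+i. indicator (X i) x \<partial>count_space C \<partial>M)"
  proof (rule nn_integral_mono)
    fix x
    show "indicator (\<Union>i\<in>C. X i) x \<le> (\<integral>\<^sup>+i. indicator (X i) x \<partial>count_space C)"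
    proof (cases "x \<in> (\<Union>i\<in>C. X i)")
      case True
      then obtain i where "i \<in> C" "x \<in> X i" by auto
      then show ?thesis using nn_integral_ge_point[of i C "\<lambda>i. indicator (X i) x"] True by simp
    qed simp
  qed
  also have "\<dots> = (\<integral>\<^sup>+i. \<integral>\<^sup>+x. indicator (X i) x \<partial>M \<partial>count_space C)"
    using C by (subst nn_integral_count_space_nn_integral) auto
  also have "\<dots> = (\<integral>\<^sup>+i. emeasure M (X i) \<partial>count_space C)"
    using X by (intro nn_integral_cong) simp
  finally show ?thesis .
qed

text \<open>Vitali selects disjoint balls whose fivefold enlargements cover \<open>B\<close>. An
  enlargement has area \<open>25 * pi * r\<^sup>2\<close>, which the density condition bounds by
  \<open>25 * pi / e\<close> times the mass of the original ball, and the disjoint masses fit into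
  \<open>U\<close>.\<close>

lemma Vitali_outer_estimate:
  fixes \<nu> :: "complex measure" and B U :: "complex set"
  assumes fin: "finite_measure \<nu>" and sets [simp]: "sets \<nu> = sets borel"
    and U: "open U" and e: "e > 0"
    and B: "\<And>z. z \<in> B \<Longrightarrow> \<exists>r. 0 < r \<and> r \<le> 1 \<and> ball z r \<subseteq> U \<and> measure \<nu> (ball z r) > e * r\<^sup>2"
  shows "\<exists>V\<in>sets borel. B \<subseteq> V \<and> emeasure lborel V \<le> ennreal (25 * pi / e * measure \<nu> U)"
proof -
  interpret finite_measure \<nu> by fact
  obtain r where r: "\<And>z. z \<in> B \<Longrightarrow> 0 < r z \<and> r z \<le> 1 \<and> ball z (r z) \<subseteq> U \<and> measure \<nu> (ball z (r z)) > e * (r z)\<^sup>2"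
    using B by metis
  obtain C where C: "countable C" "C \<subseteq> B"
    and disj: "pairwise (\<lambda>i j. disjnt (ball i (r i)) (ball j (r j))) C"
    and cov: "B \<subseteq> (\<Union>i\<in>C. ball i (5 * r i))"
    by (rule Vitali_covering_lemma_balls[of B "\<lambda>z. z" r B 1]) (use r in \<open>auto intro!: exI\<close>)
  have disjf: "disjoint_family_on (\<lambda>i. ball i (r i)) C"
    using disj unfolding disjoint_family_on_def pairwise_def disjnt_def by blast
  define V where "V = (\<Union>i\<in>C. ball i (5 * r i))"
  have rC: "0 < r i" "ball i (r i) \<subseteq> U" "e * (r i)\<^sup>2 < measure \<nu> (ball i (r i))" if "i \<in> C" for i
    using r[of i] that C by auto
  have "emeasure lborel V \<le> (\<integral>\<^sup>+i. emeasure lborel (ball i (5 * r i)) \<partial>count_space C)"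
    unfolding V_def using C by (intro emeasure_UN_countable_le) auto
  also have "\<dots> \<le> (\<integral>\<^sup>+i. ennreal (25 * pi / e) * emeasure \<nu> (ball i (r i)) \<partial>count_space C)"
  proof (rule nn_integral_mono)
    fix i assume "i \<in> space (count_space C)"
    then have i: "i \<in> C" by simp
    have "pi * (5 * r i)\<^sup>2 = 25 * pi / e * (e * (r i)\<^sup>2)" using e by (simp add: power2_eq_square)
    also have "\<dots> \<le> 25 * pi / e * measure \<nu> (ball i (r i))"
      using rC[OF i] e by (intro mult_left_mono) auto
    finally show "emeasure lborel (ball i (5 * r i)) \<le> ennreal (25 * pi / e) * emeasure \<nu> (ball i (r i))"
      using rC[OF i] e by (simp add: emeasure_ball_complex emeasure_eq_measure ennreal_mult'[symmetric] ennreal_leI)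
  qed
  also have "\<dots> = ennreal (25 * pi / e) * (\<integral>\<^sup>+i. emeasure \<nu> (ball i (r i)) \<partial>count_space C)"
    by (rule nn_integral_cmult) auto
  also have "(\<integral>\<^sup>+i. emeasure \<nu> (ball i (r i)) \<partial>count_space C) = emeasure \<nu> (\<Union>i\<in>C. ball i (r i))"
    using C disjf by (intro emeasure_UN_countable[symmetric]) auto
  also have "\<dots> \<le> emeasure \<nu> U"
    using rC U by (intro emeasure_mono) auto
  finally have "emeasure lborel V \<le> ennreal (25 * pi / e) * emeasure \<nu> U"
    by (simp add: mult_left_mono)
  then show ?thesis
    using cov e by (intro bexI[of _ V]) (auto simp: V_def emeasure_eq_measure ennreal_mult'[symmetric] intro!: borel_open)
qed

text \<open>Outer regularity encloses the \<open>\<nu>\<close>-null set \<open>A\<close> in open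
  sets of arbitrarily small mass, and the covering estimate inside them makes the exceptional points
  of \<open>A\<close> Lebesgue null. Applied to the restriction of a measure to the complement of
  \<open>A\<close>, this yields density points of \<open>A\<close>.\<close>

lemma AE_small_on_balls:
  fixes \<nu> :: "complex measure"
  assumes fin: "finite_measure \<nu>" and sets [simp]: "sets \<nu> = sets borel"
    and A: "A \<in> sets borel" "emeasure \<nu> A = 0"
  shows "AE z in lborel. z \<in> A \<longrightarrow> (\<forall>e>0. \<exists>d>0. \<forall>r. 0 < r \<longrightarrow> r < d \<longrightarrow> measure \<nu> (ball z r) \<le> e * r\<^sup>2)"
proof -
  interpret finite_measure \<nu> by fact
  \<comment> \<open>\<open>Bd e\<close> is not shown to be measurable; it is only enclosed in a null
    set.\<close>
  define Bd where "Bd e = {z\<in>A. \<forall>d>0. \<exists>r. 0 < r \<and> r < d \<and> measure \<nu> (ball z r) > e * r\<^sup>2}" for e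
  have "\<exists>N\<in>null_sets lborel. Bd e \<subseteq> N" if e: "e > 0" for e
  proof -
    have "\<exists>V\<in>sets borel. Bd e \<subseteq> V \<and> emeasure lborel V \<le> ennreal (25 * pi / e * (1 / Suc n))" for n :: nat
    proof -
      have "emeasure \<nu> A < ennreal (1 / Suc n)" using A(2) by simp
      then have "(INF U \<in> {U. A \<subseteq> U \<and> open U}. emeasure \<nu> U) < ennreal (1 / Suc n)"
        using outer_regular[OF sets _ A(1)] by simp
      then obtain U where U: "A \<subseteq> U" "open U" "emeasure \<nu> U < ennreal (1 / Suc n)"
        unfolding INF_less_iff by auto
      have mU: "measure \<nu> U \<le> 1 / Suc n" using U(3) by (simp add: emeasure_eq_measure ennreal_less_iff)
      have "\<exists>V\<in>sets borel. Bd e \<subseteq> V \<and> emeasure lborel V \<le> ennreal (25 * pi / e * measure \<nu> U)"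
      proof (rule Vitali_outer_estimate[OF fin sets U(2) e])
        fix z assume z: "z \<in> Bd e"
        then have "z \<in> U" using U by (auto simp: Bd_def)
        then obtain d where d: "d > 0" "ball z d \<subseteq> U" using U(2) openE by blast
        have "\<forall>d>0. \<exists>r. 0 < r \<and> r < d \<and> measure \<nu> (ball z r) > e * r\<^sup>2"
          using z by (simp add: Bd_def)
        from this[rule_format, of "min d 1"] d(1)
        obtain r where "0 < r" "r < min d 1" "measure \<nu> (ball z r) > e * r\<^sup>2" by auto
        then show "\<exists>r. 0 < r \<and> r \<le> 1 \<and> ball z r \<subseteq> U \<and> measure \<nu> (ball z r) > e * r\<^sup>2"
          using d subset_ball[of r d z] by (intro exI[of _ r]) auto
      qed
      moreover have "25 * pi / e * measure \<nu> U \<le> 25 * pi / e * (1 / Suc n)"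
        using mU e by (intro mult_left_mono) auto
      ultimately show ?thesis by (meson ennreal_leI order_trans)
    qed
    then obtain V where V: "\<And>n. V n \<in> sets borel" "\<And>n. Bd e \<subseteq> V n"
      "\<And>n::nat. emeasure lborel (V n) \<le> ennreal (25 * pi / e * (1 / Suc n))" by metis
    have le: "emeasure lborel (\<Inter>n. V n) \<le> ennreal (25 * pi / e * (1 / Suc n))" for n
      using V(1) by (intro order_trans[OF emeasure_mono V(3)[of n]]) auto
    have "(\<lambda>n. ennreal (25 * pi / e * (1 / Suc n))) \<longlonglongrightarrow> ennreal (25 * pi / e * 0)"
      using LIMSEQ_Suc[OF lim_1_over_n] by (intro tendsto_ennrealI tendsto_mult tendsto_const) (simp add: lim_inverse_n' LIMSEQ_Suc)
    then have "emeasure lborel (\<Inter>n. V n) \<le> ennreal (25 * pi / e * 0)"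
      by (rule LIMSEQ_le_const) (use le in auto)
    then have "(\<Inter>n. V n) \<in> null_sets lborel" using V(1) by (auto simp: null_sets_def)
    then show ?thesis using V(2) by (intro bexI[of _ "\<Inter>n. V n"]) auto
  qed
  then obtain N where N: "\<And>e. e > 0 \<Longrightarrow> N e \<in> null_sets lborel \<and> Bd e \<subseteq> N e" by metis
  \<comment> \<open>The condition weakens as \<open>e\<close> grows, so countably many thresholds
    suffice.\<close>
  have "AE z in lborel. \<forall>n::nat. z \<notin> N (1 / Suc n)"
    unfolding AE_all_countable using N by (auto intro!: AE_not_in)
  then show ?thesis
  proof eventually_elim
    case (elim z)
    show ?case
    proof (intro impI allI)
      fix e :: real assume z: "z \<in> A" and e: "e > 0"
      obtain n :: nat where n: "1 / Suc n < e" using nat_approx_posE[OF e] .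
      have "z \<notin> Bd (1 / Suc n)" using elim N[of "1 / Suc n"] by auto
      then obtain d where d: "d > 0" "\<And>r. 0 < r \<Longrightarrow> r < d \<Longrightarrow> measure \<nu> (ball z r) \<le> 1 / Suc n * r\<^sup>2"
        using z unfolding Bd_def by (force simp: not_less)
      have "measure \<nu> (ball z r) \<le> e * r\<^sup>2" if "0 < r" "r < d" for r
        using d(2)[OF that] mult_right_mono[of "1 / Suc n" e "r\<^sup>2"] n by auto
      then show "\<exists>d>0. \<forall>r. 0 < r \<longrightarrow> r < d \<longrightarrow> measure \<nu> (ball z r) \<le> e * r\<^sup>2" using d(1) by blast
    qed
  qed
qed

section \<open>Estimates for the Cauchy kernel\<close>

lemma dyadic_shell_inner:
  fixes x s :: real
  assumes "0 < x" "x < s"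
  obtains k :: nat where "s / 2 ^ Suc k \<le> x" "x < s / 2 ^ k"
proof -
  have "\<exists>n. (1/2) ^ n < x / s" using assms by (intro real_arch_pow_inv) auto
  then obtain n where "(1/2) ^ n < x / s" ..
  then have "s / 2 ^ n \<le> x" using assms by (simp add: field_simps power_divide)
  then have ex: "\<exists>n. s / 2 ^ n \<le> x" ..
  define m where "m = (LEAST n. s / 2 ^ n \<le> x)"
  have m: "s / 2 ^ m \<le> x" unfolding m_def using ex by (rule LeastI_ex)
  then have "m \<noteq> 0" using assms by (intro notI) simp
  then obtain k where k: "m = Suc k" by (cases m) auto
  have "\<not> s / 2 ^ k \<le> x" using not_less_Least[of k "\<lambda>n. s / 2 ^ n \<le> x"] k unfolding m_def by simp
  then show ?thesis using that[of k] m k by auto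
qed

lemma dyadic_shell_outer:
  fixes x s :: real
  assumes "0 < s" "s \<le> x"
  obtains k :: nat where "s * 2 ^ k \<le> x" "x < s * 2 ^ Suc k"
proof -
  have "\<exists>n. x / s < 2 ^ n" by (rule real_arch_pow) simp
  then obtain n where "x / s < 2 ^ n" ..
  then have ex: "\<exists>n. x < s * 2 ^ n" using assms by (auto simp: field_simps)
  define m where "m = (LEAST n. x < s * 2 ^ n)"
  have m: "x < s * 2 ^ m" unfolding m_def using ex by (rule LeastI_ex)
  then have "m \<noteq> 0" using assms by (intro notI) simp
  then obtain k where k: "m = Suc k" by (cases m) auto
  have "\<not> x < s * 2 ^ k" using not_less_Least[of k "\<lambda>n. x < s * 2 ^ n"] k unfolding m_def by simp
  then show ?thesis using that[of k] m k by auto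
qed

lemma suminf_ennreal_geometric:
  assumes "c \<ge> 0"
  shows "(\<Sum>k. ennreal (c * (1 / 2) ^ k)) = ennreal (2 * c)"
proof -
  have "(\<lambda>k. c * (1 / 2 :: real) ^ k) sums (c * (1 / (1 - 1 / 2)))"
    by (intro sums_mult geometric_sums) simp
  then show ?thesis using assms by (intro suminf_ennreal_eq) (auto simp: mult.commute)
qed

lemma le_suminf_ennreal: "f k \<le> (\<Sum>k. f k :: ennreal)"
  using sum_le_suminf[of f "{k}"] by simp

text \<open>The exponent in \<open>1 / w ^ 1\<close> lets both expansion coefficients be instances
  of one family of powers.\<close>

lemma Taylor_inverse:
  fixes w d :: complex
  assumes "w \<noteq> 0" "w \<noteq> d"
  shows "1 / (w - d) - (1 / w ^ 1 + 1 / w\<^sup>2 * d) = d\<^sup>2 / (w\<^sup>2 * (w - d))"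
proof -
  have "w - d \<noteq> 0" using assms by simp
  then show ?thesis using assms(1)
    by (simp add: divide_simps) (simp add: algebra_simps power2_eq_square)
qed

lemma ball_borel [measurable]: "ball c r \<in> sets borel"
  by (rule borel_open) simp

text \<open>On the \<open>k\<close>-th dyadic shell the kernel is at most
  \<open>2 ^ Suc k / s\<close> and the area at most \<open>pi * (s / 2 ^ k)\<^sup>2\<close>; the
  products form a geometric series.\<close>

lemma nn_integral_Cauchy_kernel_ball:
  fixes \<zeta> :: complex
  assumes s: "s > 0"
  shows "(\<integral>\<^sup>+z. indicator (ball \<zeta> s) z * ennreal (1 / norm (\<zeta> - z)) \<partial>lborel) \<le> ennreal (4 * pi * s)"
proof -
  have "(\<integral>\<^sup>+z. indicator (ball \<zeta> s) z * ennreal (1 / norm (\<zeta> - z)) \<partial>lborel)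
    \<le> (\<integral>\<^sup>+z. (\<Sum>k. ennreal (2 ^ Suc k / s) * indicator (ball \<zeta> (s / 2 ^ k)) z) \<partial>lborel)"
  proof (rule nn_integral_mono)
    fix z
    show "indicator (ball \<zeta> s) z * ennreal (1 / norm (\<zeta> - z))
      \<le> (\<Sum>k. ennreal (2 ^ Suc k / s) * indicator (ball \<zeta> (s / 2 ^ k)) z)" (is "_ \<le> (\<Sum>k. ?f k)")
    \<comment> \<open>At \<open>z = \<zeta>\<close> the kernel is \<open>1 / 0 = 0\<close>.\<close>
    proof (cases "z \<in> ball \<zeta> s \<and> z \<noteq> \<zeta>")
      case True
      then have "0 < norm (\<zeta> - z)" "norm (\<zeta> - z) < s" by (auto simp: dist_norm)
      from dyadic_shell_inner[OF this] obtain k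
        where k: "s / 2 ^ Suc k \<le> norm (\<zeta> - z)" "norm (\<zeta> - z) < s / 2 ^ k" .
      have "1 / norm (\<zeta> - z) \<le> 1 / (s / 2 ^ Suc k)"
        using k(1) s True by (intro divide_left_mono mult_pos_pos) auto
      then have "indicator (ball \<zeta> s) z * ennreal (1 / norm (\<zeta> - z)) \<le> ?f k"
        using k(2) True by (auto simp: dist_norm intro!: ennreal_leI)
      also have "\<dots> \<le> (\<Sum>k. ?f k)" by (rule le_suminf_ennreal)
      finally show ?thesis .
    qed auto
  qed
  also have "\<dots> = (\<Sum>k. \<integral>\<^sup>+z. ennreal (2 ^ Suc k / s) * indicator (ball \<zeta> (s / 2 ^ k)) z \<partial>lborel)"
    by (rule nn_integral_suminf) auto
  also have "\<dots> = (\<Sum>k. ennreal ((2 * pi * s) * (1 / 2) ^ k))"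
  proof (rule suminf_cong)
    fix k :: nat
    have "2 ^ Suc k / s * (pi * (s / 2 ^ k)\<^sup>2) = 2 * pi * s * (1 / 2) ^ k"
      using s by (simp add: power2_eq_square power_divide field_simps)
    then show "(\<integral>\<^sup>+z. ennreal (2 ^ Suc k / s) * indicator (ball \<zeta> (s / 2 ^ k)) z \<partial>lborel)
      = ennreal ((2 * pi * s) * (1 / 2) ^ k)"
      using s by (subst nn_integral_cmult) (auto simp: emeasure_ball_complex ennreal_mult'[symmetric])
  qed
  also have "\<dots> = ennreal (4 * pi * s)"
    using s by (subst suminf_ennreal_geometric) auto
  finally show ?thesis .
qed

text \<open>\<open>s\<close> separates the singularity from the bulk and is left free: for a set of
  area about \<open>s\<^sup>2\<close> both terms are of order \<open>s\<close>.\<close>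

lemma nn_integral_Cauchy_kernel_le:
  fixes \<zeta> :: complex
  assumes s: "s > 0" and G [measurable]: "G \<in> sets borel"
  shows "(\<integral>\<^sup>+z. indicator G z * ennreal (1 / norm (\<zeta> - z)) \<partial>lborel)
    \<le> ennreal (4 * pi * s) + ennreal (1 / s) * emeasure lborel G"
proof -
  have "(\<integral>\<^sup>+z. indicator G z * ennreal (1 / norm (\<zeta> - z)) \<partial>lborel)
    \<le> (\<integral>\<^sup>+z. indicator (ball \<zeta> s) z * ennreal (1 / norm (\<zeta> - z)) + ennreal (1 / s) * indicator G z \<partial>lborel)"
  proof (rule nn_integral_mono)
    fix z
    have "ennreal (1 / norm (\<zeta> - z)) \<le> ennreal (1 / s)" if "z \<notin> ball \<zeta> s"
      using that s by (intro ennreal_leI divide_left_mono mult_pos_pos) (auto simp: dist_norm)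
    then show "indicator G z * ennreal (1 / norm (\<zeta> - z))
      \<le> indicator (ball \<zeta> s) z * ennreal (1 / norm (\<zeta> - z)) + ennreal (1 / s) * indicator G z"
      by (auto simp: indicator_def)
  qed
  also have "\<dots> = (\<integral>\<^sup>+z. indicator (ball \<zeta> s) z * ennreal (1 / norm (\<zeta> - z)) \<partial>lborel) + ennreal (1 / s) * emeasure lborel G"
    by (subst nn_integral_add) (measurable, simp add: nn_integral_cmult)
  also have "\<dots> \<le> ennreal (4 * pi * s) + ennreal (1 / s) * emeasure lborel G"
    by (intro add_right_mono nn_integral_Cauchy_kernel_ball s)
  finally show ?thesis .
qed

text \<open>The kernel estimate is uniform in \<open>\<zeta>\<close>, so after Tonelli the
  integration over \<open>\<nu>\<close> contributes just the mass of \<open>B\<close>.\<close>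

lemma nn_integral_potential_le:
  fixes \<nu> :: "complex measure"
  assumes fin: "finite_measure \<nu>" and sets [measurable_cong]: "sets \<nu> = sets borel"
    and s: "s > 0" and G [measurable]: "G \<in> sets borel" and B [measurable]: "B \<in> sets borel"
  shows "(\<integral>\<^sup>+z. indicator G z * (\<integral>\<^sup>+\<zeta>. indicator B \<zeta> * ennreal (1 / norm (\<zeta> - z)) \<partial>\<nu>) \<partial>lborel)
    \<le> (ennreal (4 * pi * s) + ennreal (1 / s) * emeasure lborel G) * emeasure \<nu> B"
proof -
  interpret finite_measure \<nu> by fact
  interpret pair_sigma_finite lborel \<nu> ..
  have "(\<integral>\<^sup>+z. indicator G z * (\<integral>\<^sup>+\<zeta>. indicator B \<zeta> * ennreal (1 / norm (\<zeta> - z)) \<partial>\<nu>) \<partial>lborel)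
    = (\<integral>\<^sup>+z. \<integral>\<^sup>+\<zeta>. indicator B \<zeta> * (indicator G z * ennreal (1 / norm (\<zeta> - z))) \<partial>\<nu> \<partial>lborel)"
    by (subst nn_integral_cmult[symmetric]) (auto simp: mult_ac)
  also have "\<dots> = (\<integral>\<^sup>+\<zeta>. \<integral>\<^sup>+z. indicator B \<zeta> * (indicator G z * ennreal (1 / norm (\<zeta> - z))) \<partial>lborel \<partial>\<nu>)"
    by (rule Fubini'[symmetric]) measurable
  also have "\<dots> = (\<integral>\<^sup>+\<zeta>. indicator B \<zeta> * (\<integral>\<^sup>+z. indicator G z * ennreal (1 / norm (\<zeta> - z)) \<partial>lborel) \<partial>\<nu>)"
    by (subst nn_integral_cmult) auto
  also have "\<dots> \<le> (\<integral>\<^sup>+\<zeta>. (ennreal (4 * pi * s) + ennreal (1 / s) * emeasure lborel G) * indicator B \<zeta> \<partial>\<nu>)"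
    using nn_integral_Cauchy_kernel_le[OF s G] by (intro nn_integral_mono) (simp split: split_indicator)
  also have "\<dots> = (ennreal (4 * pi * s) + ennreal (1 / s) * emeasure lborel G) * emeasure \<nu> B"
    by (subst nn_integral_cmult) (auto simp: sets)
  finally show ?thesis .
qed

text \<open>Over every disc the absolute potential has a finite area integral, hence is finite
  almost everywhere there; countably many discs exhaust the plane.\<close>

lemma AE_integrable_Cauchy_kernel:
  fixes \<nu> :: "complex measure"
  assumes fin: "finite_measure \<nu>" and sets [measurable_cong]: "sets \<nu> = sets borel"
  shows "AE z in lborel. integrable \<nu> (\<lambda>\<zeta>. 1 / (\<zeta> - z))"
proof -
  interpret finite_measure \<nu> by fact
  have "AE z in lborel. indicator (ball 0 (real n)) z * (\<integral>\<^sup>+\<zeta>. indicator UNIV \<zeta> * ennreal (1 / norm (\<zeta> - z)) \<partial>\<nu>) \<noteq> \<infinity>" for n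
  proof (rule nn_integral_PInf_AE)
    have "(\<integral>\<^sup>+z. indicator (ball 0 (real n)) z * (\<integral>\<^sup>+\<zeta>. indicator UNIV \<zeta> * ennreal (1 / norm (\<zeta> - z)) \<partial>\<nu>) \<partial>lborel)
      \<le> (ennreal (4 * pi * 1) + ennreal (1 / 1) * emeasure lborel (ball (0::complex) (real n))) * emeasure \<nu> UNIV"
      by (rule nn_integral_potential_le[OF fin sets]) auto
    also have "\<dots> < \<infinity>"
      by (auto simp: emeasure_ball_complex emeasure_eq_measure ennreal_mult_less_top)
    finally show "(\<integral>\<^sup>+z. indicator (ball 0 (real n)) z * (\<integral>\<^sup>+\<zeta>. indicator UNIV \<zeta> * ennreal (1 / norm (\<zeta> - z)) \<partial>\<nu>) \<partial>lborel) \<noteq> \<infinity>"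
      by simp
  next
    have [measurable]: "(\<lambda>z. \<integral>\<^sup>+\<zeta>. indicator UNIV \<zeta> * ennreal (1 / norm (\<zeta> - z)) \<partial>\<nu>) \<in> borel_measurable borel"
      by measurable
    show "(\<lambda>z. indicator (ball 0 (real n)) z * (\<integral>\<^sup>+\<zeta>. indicator UNIV \<zeta> * ennreal (1 / norm (\<zeta> - z)) \<partial>\<nu>)) \<in> borel_measurable lborel"
      by measurable
  qed
  then have "AE z in lborel. \<forall>n. indicator (ball 0 (real n)) z * (\<integral>\<^sup>+\<zeta>. indicator UNIV \<zeta> * ennreal (1 / norm (\<zeta> - z)) \<partial>\<nu>) \<noteq> \<infinity>"
    by (simp add: AE_all_countable)
  then show ?thesis
  proof eventually_elim
    case (elim z)
    obtain n where "norm z < real n" using reals_Archimedean2 by blast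
    then have "(\<integral>\<^sup>+\<zeta>. ennreal (1 / norm (\<zeta> - z)) \<partial>\<nu>) \<noteq> \<infinity>"
      using elim[rule_format, of n] by simp
    then show ?case
      by (intro integrableI_bounded) (auto simp: norm_divide top.not_eq_extremum)
  qed
qed

text \<open>The shell of inner radius \<open>s * 2 ^ k\<close> has mass at most
  \<open>K * (s * 2 ^ Suc k)\<^sup>2\<close> and so contributes at most
  \<open>(4 * K / s) * (1 / 2) ^ k\<close>. With the exponent 2 these shell bounds would all be
  equal.\<close>

lemma nn_integral_inverse_cube_le:
  fixes \<nu> :: "complex measure"
  assumes fin: "finite_measure \<nu>" and sets [measurable_cong]: "sets \<nu> = sets borel"
    and K: "\<And>r. r > 0 \<Longrightarrow> measure \<nu> (ball c r) \<le> K * r\<^sup>2" and s: "s > 0"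
  shows "(\<integral>\<^sup>+\<zeta>. indicator {\<zeta>. norm (\<zeta> - c) \<ge> s} \<zeta> * ennreal (1 / norm (\<zeta> - c) ^ 3) \<partial>\<nu>) \<le> ennreal (8 * K / s)"
proof -
  interpret finite_measure \<nu> by fact
  have K0: "K \<ge> 0" using K[of 1] order_trans[OF measure_nonneg[of \<nu> "ball c 1"]] by simp
  have "(\<integral>\<^sup>+\<zeta>. indicator {\<zeta>. norm (\<zeta> - c) \<ge> s} \<zeta> * ennreal (1 / norm (\<zeta> - c) ^ 3) \<partial>\<nu>)
    \<le> (\<integral>\<^sup>+\<zeta>. (\<Sum>k. ennreal (1 / (s * 2 ^ k) ^ 3) * indicator (ball c (s * 2 ^ Suc k)) \<zeta>) \<partial>\<nu>)"
  proof (rule nn_integral_mono)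
    fix \<zeta>
    show "indicator {\<zeta>. norm (\<zeta> - c) \<ge> s} \<zeta> * ennreal (1 / norm (\<zeta> - c) ^ 3)
      \<le> (\<Sum>k. ennreal (1 / (s * 2 ^ k) ^ 3) * indicator (ball c (s * 2 ^ Suc k)) \<zeta>)" (is "_ \<le> (\<Sum>k. ?f k)")
    proof (cases "norm (\<zeta> - c) \<ge> s")
      case True
      from dyadic_shell_outer[OF s this] obtain k
        where k: "s * 2 ^ k \<le> norm (\<zeta> - c)" "norm (\<zeta> - c) < s * 2 ^ Suc k" .
      have "1 / norm (\<zeta> - c) ^ 3 \<le> 1 / (s * 2 ^ k) ^ 3"
        using k(1) s True by (intro divide_left_mono mult_pos_pos power_mono zero_less_power) auto
      then have "indicator {\<zeta>. norm (\<zeta> - c) \<ge> s} \<zeta> * ennreal (1 / norm (\<zeta> - c) ^ 3) \<le> ?f k"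
        using k(2) True by (auto simp: dist_norm norm_minus_commute intro!: ennreal_leI)
      also have "\<dots> \<le> (\<Sum>k. ?f k)" by (rule le_suminf_ennreal)
      finally show ?thesis .
    qed auto
  qed
  also have "\<dots> = (\<Sum>k. \<integral>\<^sup>+\<zeta>. ennreal (1 / (s * 2 ^ k) ^ 3) * indicator (ball c (s * 2 ^ Suc k)) \<zeta> \<partial>\<nu>)"
    by (rule nn_integral_suminf) auto
  also have "\<dots> \<le> (\<Sum>k. ennreal ((4 * K / s) * (1 / 2) ^ k))"
  proof (rule suminf_le)
    fix k :: nat
    have e: "1 / (s * 2 ^ k) ^ 3 * (K * (s * 2 ^ Suc k)\<^sup>2) = (4 * K / s) * (1 / 2) ^ k"
      using s by (simp add: power2_eq_square power3_eq_cube power_divide field_simps)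
    have "1 / (s * 2 ^ k) ^ 3 * measure \<nu> (ball c (s * 2 ^ Suc k)) \<le> (4 * K / s) * (1 / 2) ^ k"
      unfolding e[symmetric] using s by (intro mult_left_mono K) auto
    then show "(\<integral>\<^sup>+\<zeta>. ennreal (1 / (s * 2 ^ k) ^ 3) * indicator (ball c (s * 2 ^ Suc k)) \<zeta> \<partial>\<nu>)
      \<le> ennreal ((4 * K / s) * (1 / 2) ^ k)"
      using s by (subst nn_integral_cmult) (auto simp: emeasure_eq_measure sets ennreal_mult'[symmetric] intro!: ennreal_leI)
  qed auto
  also have "\<dots> = ennreal (8 * K / s)"
    using s K0 by (subst suminf_ennreal_geometric) auto
  finally show ?thesis .
qed

text \<open>Second-order Taylor expansion of the kernel at \<open>c\<close>; the quadratic growth bound makes the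
  remainder integrable, with an integral linear in \<open>\<rho>\<close>.\<close>

lemma far_potential_almost_affine:
  fixes \<nu> :: "complex measure"
  assumes fin: "finite_measure \<nu>" and sets [measurable_cong]: "sets \<nu> = sets borel"
    and K: "\<And>r. r > 0 \<Longrightarrow> measure \<nu> (ball c r) \<le> K * r\<^sup>2" and \<rho>: "\<rho> > 0"
  shows "\<exists>\<alpha> \<beta>. \<forall>z. norm (z - c) \<le> \<rho> \<longrightarrow>
    norm ((LINT \<zeta>|\<nu>. indicator {\<zeta>. norm (\<zeta> - c) \<ge> 2 * \<rho>} \<zeta> * (1 / (\<zeta> - z))) - (\<alpha> + \<beta> * (z - c))) \<le> 8 * K * \<rho>"
proof -
  interpret finite_measure \<nu> by fact
  have K0: "K \<ge> 0" using K[of 1] order_trans[OF measure_nonneg[of \<nu> "ball c 1"]] by simp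
  define F where "F = {\<zeta>. norm (\<zeta> - c) \<ge> 2 * \<rho>}"
  have F [measurable]: "F \<in> sets borel" unfolding F_def by measurable
  have bd: "norm (indicator F \<zeta> * (1 / (\<zeta> - c) ^ n)) \<le> 1 / (2 * \<rho>) ^ n" for n \<zeta>
  proof (cases "\<zeta> \<in> F")
    case True
    then have "(2 * \<rho>) ^ n \<le> norm (\<zeta> - c) ^ n" using \<rho> by (intro power_mono) (auto simp: F_def)
    moreover have "(2 * \<rho>) ^ n > 0" using \<rho> by simp
    ultimately have "1 / norm (\<zeta> - c) ^ n \<le> 1 / (2 * \<rho>) ^ n"
      by (intro divide_left_mono mult_pos_pos) auto
    then show ?thesis using True by (simp add: norm_divide norm_power)
  qed (use \<rho> in auto)
  have i: "integrable \<nu> (\<lambda>\<zeta>. indicator F \<zeta> * (1 / (\<zeta> - c) ^ n) :: complex)" for n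
    by (rule integrable_const_bound[of _ "1 / (2 * \<rho>) ^ n"]) (use bd in auto)
  define \<alpha> where "\<alpha> = (LINT \<zeta>|\<nu>. indicator F \<zeta> * (1 / (\<zeta> - c) ^ 1))"
  define \<beta> where "\<beta> = (LINT \<zeta>|\<nu>. indicator F \<zeta> * (1 / (\<zeta> - c) ^ 2))"
  have "norm ((LINT \<zeta>|\<nu>. indicator F \<zeta> * (1 / (\<zeta> - z))) - (\<alpha> + \<beta> * (z - c))) \<le> 8 * K * \<rho>"
    if z: "norm (z - c) \<le> \<rho>" for z
  proof -
    define R where "R \<zeta> = indicator F \<zeta> * (1 / (\<zeta> - z)) - (indicator F \<zeta> * (1 / (\<zeta> - c) ^ 1) + indicator F \<zeta> * (1 / (\<zeta> - c) ^ 2) * (z - c))" for \<zeta> :: complex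
    \<comment> \<open>This explains the cut at \<open>2 * \<rho>\<close>: on \<open>F\<close>,
      \<open>norm (z - c)\<close> is at most half of \<open>norm (\<zeta> - c)\<close>.\<close>
    have far: "norm (\<zeta> - z) \<ge> norm (\<zeta> - c) / 2" if "\<zeta> \<in> F" for \<zeta>
    proof -
      have "norm (\<zeta> - c) \<le> norm (\<zeta> - z) + norm (z - c)" using norm_triangle_ineq[of "\<zeta> - z" "z - c"] by simp
      then show ?thesis using that z by (auto simp: F_def)
    qed
    have R: "norm (R \<zeta>) \<le> indicator F \<zeta> * (2 * \<rho>\<^sup>2 * (1 / norm (\<zeta> - c) ^ 3))" for \<zeta>
    proof (cases "\<zeta> \<in> F")
      case True
      then have c: "norm (\<zeta> - c) > 0" using \<rho> by (auto simp: F_def)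
      then have zz: "norm (\<zeta> - z) > 0" using far[OF True] by linarith
      have "R \<zeta> = (z - c)\<^sup>2 / ((\<zeta> - c)\<^sup>2 * (\<zeta> - z))"
        using True c zz Taylor_inverse[of "\<zeta> - c" "z - c"] unfolding R_def by simp
      then have "norm (R \<zeta>) = (norm (z - c))\<^sup>2 / ((norm (\<zeta> - c))\<^sup>2 * norm (\<zeta> - z))"
        by (simp add: norm_divide norm_mult norm_power)
      also have "\<dots> \<le> \<rho>\<^sup>2 / ((norm (\<zeta> - c))\<^sup>2 * (norm (\<zeta> - c) / 2))"
        using z far[OF True] c zz \<rho> by (intro frac_le mult_left_mono power_mono) auto
      also have "\<dots> = 2 * \<rho>\<^sup>2 * (1 / norm (\<zeta> - c) ^ 3)"
        using c by (simp add: power2_eq_square power3_eq_cube)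
      finally show ?thesis using True by simp
    qed (simp add: R_def)
    have iz: "integrable \<nu> (\<lambda>\<zeta>. indicator F \<zeta> * (1 / (\<zeta> - z)) :: complex)"
    proof (rule integrable_const_bound[of _ "1 / \<rho>"])
      have "norm (indicator F \<zeta> * (1 / (\<zeta> - z)) :: complex) \<le> 1 / \<rho>" for \<zeta>
      proof (cases "\<zeta> \<in> F")
        case True
        then have "norm (\<zeta> - z) \<ge> \<rho>" using far[OF True] by (auto simp: F_def)
        then show ?thesis using True \<rho> by (auto simp: norm_divide intro!: divide_left_mono mult_pos_pos)
      qed (use \<rho> in auto)
      then show "AE \<zeta> in \<nu>. norm (indicator F \<zeta> * (1 / (\<zeta> - z)) :: complex) \<le> 1 / \<rho>" by simp
    qed measurable
    have "(LINT \<zeta>|\<nu>. indicator F \<zeta> * (1 / (\<zeta> - z))) - (\<alpha> + \<beta> * (z - c)) = (LINT \<zeta>|\<nu>. R \<zeta>)"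
      unfolding R_def \<alpha>_def \<beta>_def using iz i[of 1] i[of 2]
      by (simp only: Bochner_Integration.integral_diff Bochner_Integration.integral_add integrable_mult_left
          Bochner_Integration.integrable_add integral_mult_left_zero)
    moreover have "ennreal (norm (LINT \<zeta>|\<nu>. R \<zeta>)) \<le> ennreal (8 * K * \<rho>)"
    proof -
      have "integrable \<nu> R" unfolding R_def using iz i[of 1] i[of 2]
        by (intro Bochner_Integration.integrable_diff Bochner_Integration.integrable_add integrable_mult_left)
      then have "ennreal (norm (LINT \<zeta>|\<nu>. R \<zeta>)) \<le> (\<integral>\<^sup>+\<zeta>. norm (R \<zeta>) \<partial>\<nu>)"
        by (rule integral_norm_bound_ennreal)
      also have "\<dots> \<le> (\<integral>\<^sup>+\<zeta>. ennreal (2 * \<rho>\<^sup>2) * (indicator F \<zeta> * ennreal (1 / norm (\<zeta> - c) ^ 3)) \<partial>\<nu>)"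
      proof (rule nn_integral_mono)
        fix \<zeta>
        show "ennreal (norm (R \<zeta>)) \<le> ennreal (2 * \<rho>\<^sup>2) * (indicator F \<zeta> * ennreal (1 / norm (\<zeta> - c) ^ 3))"
          using R[of \<zeta>] by (cases "\<zeta> \<in> F") (auto simp: ennreal_mult'[symmetric] ennreal_leI)
      qed
      also have "\<dots> = ennreal (2 * \<rho>\<^sup>2) * (\<integral>\<^sup>+\<zeta>. indicator F \<zeta> * ennreal (1 / norm (\<zeta> - c) ^ 3) \<partial>\<nu>)"
        by (rule nn_integral_cmult) measurable
      also have "\<dots> \<le> ennreal (2 * \<rho>\<^sup>2) * ennreal (8 * K / (2 * \<rho>))"
        unfolding F_def by (intro mult_left_mono nn_integral_inverse_cube_le[OF fin sets K]) (use \<rho> in auto)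
      also have "\<dots> = ennreal (8 * K * \<rho>)"
        using \<rho> by (simp add: ennreal_mult'[symmetric] power2_eq_square mult_ac)
      finally show ?thesis .
    qed
    ultimately show ?thesis using K0 \<rho> by (simp add: ennreal_le_iff)
  qed
  then show ?thesis unfolding F_def by blast
qed

section \<open>Averages of contour integrals over squares\<close>

text \<open>Needed to slice planar integrals along vertical lines; agreement on boxes determines
  Lebesgue measure.\<close>

lemma distr_Complex_lborel:
  "distr (lborel \<Otimes>\<^sub>M lborel) borel (\<lambda>(x, y). Complex x y) = lborel"
proof (rule lborel_eqI[symmetric])
  fix l u :: complex assume le: "\<And>b. b \<in> Basis \<Longrightarrow> l \<bullet> b \<le> u \<bullet> b"
  have [measurable]: "(\<lambda>(x, y). Complex x y) \<in> borel_measurable (borel \<Otimes>\<^sub>M borel)"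
    unfolding Complex_eq by measurable
  have "(\<lambda>(x, y). Complex x y) -` box l u = {Re l<..<Re u} \<times> {Im l<..<Im u}"
    by (auto simp: in_box_complex_iff)
  then have "emeasure (distr (lborel \<Otimes>\<^sub>M lborel) borel (\<lambda>(x, y). Complex x y)) (box l u)
    = emeasure (lborel \<Otimes>\<^sub>M lborel) ({Re l<..<Re u} \<times> {Im l<..<Im u})"
    by (subst emeasure_distr) (auto simp: space_pair_measure)
  also have "\<dots> = ennreal (Re u - Re l) * ennreal (Im u - Im l)"
    using le[of 1] le[of \<i>] by (subst lborel.emeasure_pair_measure_Times) (auto simp: Basis_complex_def)
  also have "\<dots> = ennreal (\<Prod>b\<in>Basis. (u - l) \<bullet> b)"
    using le[of 1] le[of \<i>] by (auto simp: Basis_complex_def ennreal_mult'[symmetric])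
  finally show "emeasure (distr (lborel \<Otimes>\<^sub>M lborel) borel (\<lambda>(x, y). Complex x y)) (box l u) = ennreal (\<Prod>b\<in>Basis. (u - l) \<bullet> b)" .
qed simp

text \<open>A quarter turn maps boxes to boxes with exchanged sides. It is the symmetry that reduces
  the four quarters of a square to one.\<close>

lemma distr_i_mult_lborel: "distr lborel borel (\<lambda>z. \<i> * z) = (lborel :: complex measure)"
proof (rule lborel_eqI[symmetric])
  fix l u :: complex assume le: "\<And>b. b \<in> Basis \<Longrightarrow> l \<bullet> b \<le> u \<bullet> b"
  have "(\<lambda>z. \<i> * z) -` box l u = box (Complex (Im l) (- Re u)) (Complex (Im u) (- Re l))"
    by (auto simp: in_box_complex_iff)
  then have "emeasure (distr lborel borel (\<lambda>z. \<i> * z)) (box l u)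
    = emeasure lborel (box (Complex (Im l) (- Re u)) (Complex (Im u) (- Re l)))"
    by (subst emeasure_distr) auto
  also have "\<dots> = ennreal (\<Prod>b\<in>Basis. (u - l) \<bullet> b)"
    using le[of 1] le[of \<i>] by (subst emeasure_lborel_box) (auto simp: Basis_complex_def inner_diff_left mult.commute)
  finally show "emeasure (distr lborel borel (\<lambda>z. \<i> * z)) (box l u) = ennreal (\<Prod>b\<in>Basis. (u - l) \<bullet> b)" .
qed simp

lemma distr_i_power_mult_lborel: "distr lborel borel (\<lambda>z. \<i> ^ k * z) = (lborel :: complex measure)"
proof (induction k)
  case 0
  show ?case by (simp add: distr_id2)
next
  case (Suc k)
  have "distr lborel borel (\<lambda>z. \<i> ^ Suc k * z) = distr (distr lborel borel (\<lambda>z. \<i> ^ k * z)) borel (\<lambda>z. \<i> * z)"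
    by (subst distr_distr) (auto simp: o_def mult.assoc[symmetric])
  then show ?case by (simp add: Suc.IH distr_i_mult_lborel)
qed

lemma integral_lincomb:
  fixes f :: "'i \<Rightarrow> 'a \<Rightarrow> complex"
  assumes "\<And>k. k \<in> I \<Longrightarrow> integrable M (f k)"
  shows "(LINT x|M. (\<Sum>k\<in>I. c k * f k x)) = (\<Sum>k\<in>I. c k * integral\<^sup>L M (f k))"
proof -
  have "(LINT x|M. (\<Sum>k\<in>I. c k * f k x)) = (\<Sum>k\<in>I. LINT x|M. c k * f k x)"
    using assms by (intro Bochner_Integration.integral_sum integrable_mult_right)
  then show ?thesis by (simp only: integral_mult_right_zero)
qed

lemma complex_Fubini:
  fixes f :: "complex \<Rightarrow> complex"
  assumes f: "integrable lborel f"
  shows "integrable lborel (\<lambda>x. LBINT y. f (Complex x y))"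
    and "(LBINT x. LBINT y. f (Complex x y)) = integral\<^sup>L lborel f"
proof -
  have m: "(\<lambda>(x, y). Complex x y) \<in> lborel \<Otimes>\<^sub>M lborel \<rightarrow>\<^sub>M borel"
    unfolding Complex_eq by measurable
  have fm: "f \<in> borel_measurable borel" using f by auto
  have i: "integrable (lborel \<Otimes>\<^sub>M lborel) (\<lambda>(x, y). f (Complex x y))"
    using integrable_distr_eq[OF m fm] f unfolding distr_Complex_lborel by (simp add: case_prod_unfold)
  show "integrable lborel (\<lambda>x. LBINT y. f (Complex x y))"
    using lborel_pair.integrable_fst'[OF i] by simp
  show "(LBINT x. LBINT y. f (Complex x y)) = integral\<^sup>L lborel f"
    using lborel_pair.integral_fst'[OF i] integral_distr[OF m fm] unfolding distr_Complex_lborel by (simp add: case_prod_unfold)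
qed

lemma integrable_indicator_Cauchy_kernel:
  fixes \<zeta> :: complex
  assumes [measurable]: "G \<in> sets borel" and fin: "emeasure lborel G < \<infinity>"
  shows "integrable lborel (\<lambda>z. indicator G z * (1 / (z - \<zeta>)))"
proof (rule integrableI_bounded)
  have "(\<integral>\<^sup>+z. norm (indicator G z * (1 / (z - \<zeta>))) \<partial>lborel) = (\<integral>\<^sup>+z. indicator G z * ennreal (1 / norm (\<zeta> - z)) \<partial>lborel)"
    by (intro nn_integral_cong) (auto simp: indicator_def norm_divide norm_minus_commute)
  also have "\<dots> \<le> ennreal (4 * pi * 1) + ennreal (1 / 1) * emeasure lborel G"
    by (rule nn_integral_Cauchy_kernel_le) auto
  also have "\<dots> < \<infinity>" using fin by simp
  finally show "(\<integral>\<^sup>+z. norm (indicator G z * (1 / (z - \<zeta>))) \<partial>lborel) < \<infinity>" .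
qed measurable

text \<open>Midpoint \<open>b\<close> and direction \<open>d\<close> are kept apart so that the four
  edges of a square arise from one edge by powers of \<open>\<i>\<close>. The open interval matches
  the slices of an open triangle.\<close>

lemma contour_integral_linepath_centred:
  fixes f :: "complex \<Rightarrow> complex"
  assumes t: "t > 0" and f: "continuous_on (closed_segment (b - of_real t * d) (b + of_real t * d)) f"
  shows "contour_integral (linepath (b - of_real t * d) (b + of_real t * d)) f
    = d * (LBINT y. indicator {-t<..<t} y * f (b + of_real y * d))"
proof -
  have seg: "b + of_real y * d \<in> closed_segment (b - of_real t * d) (b + of_real t * d)" if "y \<in> {-t..t}" for y :: real
  proof -
    have "b + of_real y * d = (1 - (y + t) / (2 * t)) *\<^sub>R (b - of_real t * d) + ((y + t) / (2 * t)) *\<^sub>R (b + of_real t * d)"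
      using t by (simp add: scaleR_conv_of_real field_simps)
    then show ?thesis using that t unfolding closed_segment_def
      by (auto intro!: exI[of _ "(y + t) / (2 * t)"] simp: divide_simps)
  qed
  have cont: "continuous_on {-t..t} (\<lambda>y. f (b + of_real y * d))"
    by (rule continuous_on_compose2[OF f]) (use seg in \<open>auto intro!: continuous_intros\<close>)
  define g where "g y = f (b + of_real y * d)" for y :: real
  have int: "(g has_integral integral {-t..t} g) (cbox (-t) t)"
    using cont unfolding g_def by (auto intro!: integrable_integral integrable_continuous_interval)
  have img: "(\<lambda>x. 1 / 2 + x / (t * 2)) ` {-t..t} = {0..1}"
    using image_affinity_atLeastAtMost[of "1 / (2 * t)" "1 / 2" "-t" t] t by (simp add: field_simps)
  \<comment> \<open>The substitution \<open>y = 2 * t * x - t\<close> maps the unit interval onto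
    \<open>{-t..t}\<close>; the derivative \<open>2 * t * d\<close> of the path cancels the factor
    \<open>1 / (2 * t)\<close>.\<close>
  from has_integral_affinity[OF int, of "2 * t" "-t"] t
  have "((\<lambda>x. g (2 * t * x - t)) has_integral (1 / (2 * t)) *\<^sub>R integral {-t..t} g) {0..1}"
    by (simp add: algebra_simps img)
  from has_integral_mult_left[OF this, of "2 * of_real t * d"]
  have "((\<lambda>x. f (linepath (b - of_real t * d) (b + of_real t * d) x) * ((b + of_real t * d) - (b - of_real t * d))) has_integral d * integral {-t..t} g) {0..1}"
    using t by (simp add: g_def linepath_def scaleR_conv_of_real algebra_simps)
  then have "contour_integral (linepath (b - of_real t * d) (b + of_real t * d)) f = d * integral {-t..t} g"
    by (intro contour_integral_unique) (simp only: has_contour_integral_linepath)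
  also have "integral {-t..t} g = integral {-t<..<t} g"
    by (rule integral_open_interval_real)
  also have "integral {-t<..<t} g = (LINT y:{-t<..<t}|lborel. g y)"
  proof (rule set_borel_integral_eq_integral(2)[symmetric])
    have "set_integrable lborel {-t..t} g"
      using cont unfolding g_def by (rule borel_integrable_atLeastAtMost')
    then show "set_integrable lborel {-t<..<t} g"
      by (rule set_integrable_subset) auto
  qed
  also have "\<dots> = (LBINT y. indicator {-t<..<t} y * f (b + of_real y * d))"
    unfolding set_lebesgue_integral_def g_def by (intro Bochner_Integration.integral_cong) (auto simp: scaleR_conv_of_real split: split_indicator)
  finally show ?thesis .
qed

definition sup_norm :: "complex \<Rightarrow> real" where "sup_norm z = max \<bar>Re z\<bar> \<bar>Im z\<bar>"

text \<open>The \<open>k\<close>-th edge is the right-hand one turned by \<open>\<i> ^ k\<close> and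
  traversed in direction \<open>\<i> ^ Suc k\<close>. The sum is therefore the contour integral of
  the kernel over the square, known from the winding number; \<open>t = sup_norm \<zeta>\<close>
  would put the pole on the contour.\<close>

lemma square_contour_Cauchy_kernel:
  assumes t: "t > 0" "t \<noteq> sup_norm \<zeta>"
  shows "(\<Sum>k<4. \<i> ^ Suc k * (LBINT y. indicator {-t<..<t} y * (1 / (\<i> ^ k * Complex t y - \<zeta>))))
    = (if sup_norm \<zeta> < t then 2 * pi * \<i> else 0)"
proof -
  define p where "p = rectpath (Complex (-t) (-t)) (Complex t t)"
  let ?f = "\<lambda>w. 1 / (w - \<zeta>)"
  have pi: "path_image p = {z. sup_norm z = t}"
    using t(1) unfolding p_def by (subst path_image_rectpath) (auto simp: sup_norm_def max_def split: if_splits)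
  then have \<zeta>: "\<zeta> \<notin> path_image p" using t by auto
  have wn: "winding_number p \<zeta> = 1 / (2 * pi * \<i>) * contour_integral p ?f"
    using \<zeta> unfolding p_def by (intro winding_number_valid_path) auto
  have "winding_number p \<zeta> = (if sup_norm \<zeta> < t then 1 else 0)"
  proof (cases "sup_norm \<zeta> < t")
    case True
    then show ?thesis unfolding p_def
      by (subst winding_number_rectpath) (auto simp: in_box_complex_iff sup_norm_def)
  next
    case False
    then show ?thesis unfolding p_def using t
      by (subst winding_number_rectpath_outside) (auto simp: in_cbox_complex_iff sup_norm_def)
  qed
  with wn have c: "contour_integral p ?f = (if sup_norm \<zeta> < t then 2 * pi * \<i> else 0)"
    by (auto simp: field_simps split: if_splits)
  have ends:
    "\<i> ^ 0 * t - t * \<i> ^ Suc 0 = Complex t (-t)" "\<i> ^ 0 * t + t * \<i> ^ Suc 0 = Complex t t"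
    "\<i> ^ 1 * t - t * \<i> ^ Suc 1 = Complex t t" "\<i> ^ 1 * t + t * \<i> ^ Suc 1 = Complex (-t) t"
    "\<i> ^ 2 * t - t * \<i> ^ Suc 2 = Complex (-t) t" "\<i> ^ 2 * t + t * \<i> ^ Suc 2 = Complex (-t) (-t)"
    "\<i> ^ 3 * t - t * \<i> ^ Suc 3 = Complex (-t) (-t)" "\<i> ^ 3 * t + t * \<i> ^ Suc 3 = Complex t (-t)"
    by (simp_all add: complex_eq_iff numeral_eq_Suc)
  have e: "closed_segment (\<i> ^ k * t - t * \<i> ^ Suc k) (\<i> ^ k * t + t * \<i> ^ Suc k) \<subseteq> path_image p" if "k < 4" for k
  proof -
    have "k = 0 \<or> k = 1 \<or> k = 2 \<or> k = 3" using that by auto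
    then show ?thesis unfolding p_def rectpath_def Let_def
      by (elim disjE; simp only: ends) (auto simp: path_image_join)
  qed
  define E where "E k = linepath (\<i> ^ k * t - t * \<i> ^ Suc k) (\<i> ^ k * t + t * \<i> ^ Suc k)" for k
  have cont: "continuous_on (closed_segment (\<i> ^ k * t - t * \<i> ^ Suc k) (\<i> ^ k * t + t * \<i> ^ Suc k)) ?f" if "k < 4" for k
    using e[OF that] \<zeta> by (intro continuous_intros) auto
  have Ek: "contour_integral (E k) ?f = \<i> ^ Suc k * (LBINT y. indicator {-t<..<t} y * (1 / (\<i> ^ k * Complex t y - \<zeta>)))"
    if "k < 4" for k
  proof -
    have *: "\<i> ^ k * t + y * \<i> ^ Suc k = \<i> ^ k * Complex t y" for y
      by (simp add: Complex_eq algebra_simps)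
    show ?thesis
      using contour_integral_linepath_centred[OF t(1) cont[OF that]] unfolding E_def * .
  qed
  have int: "?f contour_integrable_on E k" if "k < 4" for k
    unfolding E_def using cont[OF that] by (rule contour_integrable_continuous_linepath)
  \<comment> \<open>\<open>rectpath\<close> starts at the lower left corner with the bottom edge,
    which is \<open>E 3\<close>.\<close>
  have p: "p = E 3 +++ E 0 +++ E 1 +++ E 2"
    unfolding p_def rectpath_def Let_def E_def ends by simp
  have fin: "pathstart (E 0) = pathfinish (E 3)" "pathstart (E 1) = pathfinish (E 0)" "pathstart (E 2) = pathfinish (E 1)"
    unfolding E_def ends pathstart_linepath pathfinish_linepath by simp_all
  have v: "valid_path (E k)" for k by (simp add: E_def)
  have "contour_integral p ?f = contour_integral (E 3) ?f + (contour_integral (E 0) ?f + (contour_integral (E 1) ?f + contour_integral (E 2) ?f))"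
    unfolding p using int v fin by (simp add: contour_integral_join contour_integrable_joinI valid_path_join)
  also have "\<dots> = (\<Sum>k<4. contour_integral (E k) ?f)"
    by (simp add: eval_nat_numeral)
  also have "\<dots> = (\<Sum>k<4. \<i> ^ Suc k * (LBINT y. indicator {-t<..<t} y * (1 / (\<i> ^ k * Complex t y - \<zeta>))))"
    by (intro sum.cong refl Ek) auto
  finally show ?thesis using c by simp
qed

text \<open>The quarter of a square, between its diagonals, that the right-hand edges sweep out as
  the half-side grows from 0 to \<open>R\<close>.\<close>

definition right_triangle :: "real \<Rightarrow> complex set" where
  "right_triangle R = {w. \<bar>Im w\<bar> < Re w \<and> Re w < R}"

text \<open>The direction of the tangent to the positively oriented squares around 0, on the square of
  half-side \<open>R\<close>: integrating against it averages contour integrals over these squares.\<close>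

definition square_tangent :: "real \<Rightarrow> complex \<Rightarrow> complex" where
  "square_tangent R z = (\<Sum>k<4. \<i> ^ Suc k * indicator (right_triangle R) ((-\<i>) ^ k * z))"

lemma right_triangle_borel [measurable]: "right_triangle R \<in> sets borel"
  unfolding right_triangle_def by measurable

lemma square_tangent_borel [measurable]: "square_tangent R \<in> borel_measurable borel"
  unfolding square_tangent_def by measurable

text \<open>The 4 merely counts the triangles.\<close>

lemma norm_square_tangent: "norm (square_tangent R z) \<le> 4"
proof -
  have "norm (square_tangent R z) \<le> (\<Sum>k<4::nat. 1)"
    unfolding square_tangent_def
    by (intro sum_norm_le) (auto simp: norm_mult norm_power indicator_def)
  then show ?thesis by simp
qed

lemma right_triangle_norm_less: "w \<in> right_triangle R \<Longrightarrow> norm w < 2 * R"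
  using cmod_le[of w] by (auto simp: right_triangle_def)

lemma square_tangent_support:
  assumes "square_tangent R z \<noteq> 0" shows "norm z < 2 * R"
proof -
  have "\<exists>k. (-\<i>) ^ k * z \<in> right_triangle R"
  proof (rule ccontr)
    assume "\<nexists>k. (-\<i>) ^ k * z \<in> right_triangle R"
    then have "square_tangent R z = 0" unfolding square_tangent_def by (simp del: power_Suc)
    with assms show False by simp
  qed
  then obtain k where "(-\<i>) ^ k * z \<in> right_triangle R" ..
  from right_triangle_norm_less[OF this] show ?thesis by (simp add: norm_mult norm_power)
qed

text \<open>Turning each quarter onto \<open>right_triangle\<close> and slicing it at real part
  \<open>t\<close> produces the four edges of the square of half-side \<open>t\<close>. Their
  contributions add up to \<open>2 * pi * \<i>\<close> when \<open>sup_norm \<zeta> < t\<close> and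
  to 0 when \<open>t < sup_norm \<zeta>\<close>; the half-sides \<open>t < R\<close> of the first
  kind form an interval of length \<open>max 0 (R - sup_norm \<zeta>)\<close>.\<close>

lemma integral_square_tangent_Cauchy_kernel_0:
  assumes R: "R > 0"
  shows "(LBINT z. square_tangent R z * (1 / (z - \<zeta>))) = 2 * pi * \<i> * max 0 (R - sup_norm \<zeta>)"
proof -
  let ?g = "\<lambda>k z. indicator (right_triangle R) ((-\<i>) ^ k * z) * (1 / (z - \<zeta>))"
  let ?h = "\<lambda>k w. indicator (right_triangle R) w * (1 / (\<i> ^ k * w - \<zeta>))"
  have ii: "(- \<i>) ^ k * (\<i> ^ k * w) = w" for k :: nat and w
    by (simp add: mult.assoc[symmetric] power_mult_distrib[symmetric])
  have ig: "integrable lborel (?g k)" for k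
  proof -
    have "emeasure lborel ((\<lambda>z. (-\<i>) ^ k * z) -` right_triangle R) \<le> emeasure lborel (ball (0::complex) (2 * R))"
      using right_triangle_norm_less[of "(-\<i>) ^ k * z" R for z]
      by (intro emeasure_mono) (auto simp: norm_mult norm_power)
    also have "\<dots> < \<infinity>" using emeasure_lborel_ball_finite by auto
    finally have "emeasure lborel ((\<lambda>z. (-\<i>) ^ k * z) -` right_triangle R) < \<infinity>" .
    moreover have "(\<lambda>z. (-\<i>) ^ k * z) -` right_triangle R \<in> sets borel"
      by (rule measurable_sets_borel[OF _ right_triangle_borel]) measurable
    ultimately have "integrable lborel (\<lambda>z. indicator ((\<lambda>z. (-\<i>) ^ k * z) -` right_triangle R) z * (1 / (z - \<zeta>)))"
      by (intro integrable_indicator_Cauchy_kernel)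
    then show ?thesis by (simp add: indicator_def)
  qed
  have ih: "integrable lborel (?h k)" and gh: "integral\<^sup>L lborel (?g k) = integral\<^sup>L lborel (?h k)" for k
  proof -
    have m: "(\<lambda>z. \<i> ^ k * z) \<in> lborel \<rightarrow>\<^sub>M borel" by measurable
    have fm: "?g k \<in> borel_measurable borel" by measurable
    show "integrable lborel (?h k)"
      using integrable_distr_eq[OF m fm] ig[of k] unfolding distr_i_power_mult_lborel ii by simp
    show "integral\<^sup>L lborel (?g k) = integral\<^sup>L lborel (?h k)"
      using integral_distr[OF m fm] unfolding distr_i_power_mult_lborel ii by simp
  qed
  have slice: "(LBINT y. ?h k (Complex t y))
      = indicator {0<..<R} t * (LBINT y. indicator {-t<..<t} y * (1 / (\<i> ^ k * Complex t y - \<zeta>)))" for k t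
    by (subst integral_mult_right_zero[symmetric], intro Bochner_Integration.integral_cong refl)
       (auto simp: right_triangle_def indicator_def)
  have "(LBINT z. square_tangent R z * (1 / (z - \<zeta>))) = (LBINT z. (\<Sum>k<4. \<i> ^ Suc k * ?g k z))"
    unfolding square_tangent_def by (intro Bochner_Integration.integral_cong) (auto simp: sum_distrib_right sum_divide_distrib mult.assoc)
  also have "\<dots> = (\<Sum>k<4. \<i> ^ Suc k * integral\<^sup>L lborel (?g k))"
    using ig by (intro integral_lincomb)
  also have "\<dots> = (\<Sum>k<4. \<i> ^ Suc k * (LBINT t. LBINT y. ?h k (Complex t y)))"
    unfolding gh using complex_Fubini(2)[OF ih] by simp
  also have "\<dots> = (LBINT t. (\<Sum>k<4. \<i> ^ Suc k * (LBINT y. ?h k (Complex t y))))"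
    using complex_Fubini(1)[OF ih] by (intro integral_lincomb[symmetric])
  also have "\<dots> = (LBINT t. 2 * pi * \<i> * indicator {max 0 (sup_norm \<zeta>)<..<R} t)"
  proof (rule integral_cong_AE)
    \<comment> \<open>Excludes the one square that passes through the pole.\<close>
    have "AE t in lborel. t \<noteq> sup_norm \<zeta>" by (rule AE_lborel_singleton)
    then show "AE t in lborel. (\<Sum>k<4. \<i> ^ Suc k * (LBINT y. ?h k (Complex t y))) = 2 * pi * \<i> * indicator {max 0 (sup_norm \<zeta>)<..<R} t"
    proof eventually_elim
      case (elim t)
      show ?case
      proof (cases "t \<in> {0<..<R}")
        case True
        then show ?thesis unfolding slice using square_contour_Cauchy_kernel[of t \<zeta>] elim
          by (auto simp del: power_Suc)
      next
        case False
        then show ?thesis unfolding slice by auto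
      qed
    qed
  qed (use complex_Fubini(1)[OF ih] in \<open>auto intro!: borel_measurable_sum borel_measurable_times simp del: power_Suc\<close>)
  also have "\<dots> = 2 * pi * \<i> * (LBINT t. indicator {max 0 (sup_norm \<zeta>)<..<R} t)"
    by (rule integral_mult_right_zero)
  also have "(LBINT t. indicator {max 0 (sup_norm \<zeta>)<..<R} t :: complex) = max 0 (R - sup_norm \<zeta>)"
  proof -
    have "(LBINT t. indicator {max 0 (sup_norm \<zeta>)<..<R} t :: complex)
        = (LBINT t. complex_of_real (indicator {max 0 (sup_norm \<zeta>)<..<R} t))"
      by (simp add: of_real_indicator)
    also have "\<dots> = complex_of_real (measure lborel {max 0 (sup_norm \<zeta>)<..<R})"
      by (subst integral_complex_of_real) simp
    also have "\<dots> = max 0 (R - sup_norm \<zeta>)"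
      using R by (auto simp: sup_norm_def max_def)
    finally show ?thesis .
  qed
  finally show ?thesis .
qed

lemma integral_square_tangent_Cauchy_kernel:
  assumes R: "R > 0"
  shows "(LBINT z. square_tangent R (z - c) * (1 / (z - \<zeta>))) = 2 * pi * \<i> * max 0 (R - sup_norm (\<zeta> - c))"
proof -
  have "(LBINT z. square_tangent R (z - c) * (1 / (z - \<zeta>)))
    = (LINT z|distr lborel borel ((+) c). square_tangent R (z - c) * (1 / (z - \<zeta>)))"
    by (simp add: lborel_distr_plus)
  also have "\<dots> = (LBINT w. square_tangent R w * (1 / (w - (\<zeta> - c))))"
    by (subst integral_distr) (auto simp: algebra_simps)
  finally show ?thesis using integral_square_tangent_Cauchy_kernel_0[OF R] by simp
qed

section \<open>Potentials near a density point of their zero set\<close>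

text \<open>\<open>G\<close> is too large to miss either disc of radius \<open>\<rho> / 4\<close>
  about \<open>c + \<rho> / 2\<close> and \<open>c - \<rho> / 2\<close>. Two points of
  \<open>G\<close> at distance at least \<open>\<rho> / 2\<close> give
  \<open>norm \<beta> * \<rho> \<le> 4 * C\<close>; moving from one of them by at most
  \<open>2 * \<rho>\<close> adds at most \<open>8 * C\<close> to \<open>C\<close>.\<close>

lemma affine_bound_from_large_set:
  fixes \<alpha> \<beta> c :: complex
  assumes \<rho>: "\<rho> > 0" and G [measurable]: "G \<in> sets borel" and bd: "\<And>z. z \<in> G \<Longrightarrow> norm (\<alpha> + \<beta> * (z - c)) \<le> C"
    and small: "emeasure lborel (ball c \<rho> - G) < ennreal (pi * (\<rho> / 4)\<^sup>2)"
    and z: "norm (z - c) \<le> \<rho>"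
  shows "norm (\<alpha> + \<beta> * (z - c)) \<le> 9 * C"
proof -
  have ex: "\<exists>x\<in>G. x \<in> ball (c + s) (\<rho> / 4)" if s: "norm s = \<rho> / 2" for s
  proof (rule ccontr)
    assume "\<not> ?thesis"
    moreover have "ball (c + s) (\<rho> / 4) \<subseteq> ball c \<rho>"
    proof
      fix x assume "x \<in> ball (c + s) (\<rho> / 4)"
      moreover have "norm (c - x) \<le> norm (c + s - x) + norm s"
        using norm_triangle_ineq4[of "c + s - x" s] by simp
      ultimately show "x \<in> ball c \<rho>" using s \<rho> by (auto simp: dist_norm)
    qed
    ultimately have "ball (c + s) (\<rho> / 4) \<subseteq> ball c \<rho> - G" by blast
    then have "emeasure lborel (ball (c + s) (\<rho> / 4)) \<le> emeasure lborel (ball c \<rho> - G)"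
      by (intro emeasure_mono) auto
    then show False using small \<rho> by (simp add: emeasure_ball_complex)
  qed
  obtain x y where x: "x \<in> G" "x \<in> ball (c + of_real (\<rho> / 2)) (\<rho> / 4)"
    and y: "y \<in> G" "y \<in> ball (c + of_real (- \<rho> / 2)) (\<rho> / 4)"
    using ex[of "of_real (\<rho> / 2)"] ex[of "of_real (- \<rho> / 2)"] \<rho> by (auto simp del: of_real_divide of_real_minus)
  have "\<rho> = norm ((c + of_real (\<rho> / 2) - x) + (x - y) - (c + of_real (- \<rho> / 2) - y))"
    using \<rho> by (simp add: field_simps)
  also have "\<dots> \<le> norm (c + of_real (\<rho> / 2) - x) + norm (x - y) + norm (c + of_real (- \<rho> / 2) - y)"
    by (intro order_trans[OF norm_triangle_ineq4] add_right_mono norm_triangle_ineq)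
  finally have xy: "\<rho> / 2 \<le> norm (x - y)" using x(2) y(2) by (simp add: dist_norm)
  have "norm (\<beta> * (x - y)) = norm ((\<alpha> + \<beta> * (x - c)) - (\<alpha> + \<beta> * (y - c)))" by (simp add: algebra_simps)
  also have "\<dots> \<le> C + C" using bd[OF x(1)] bd[OF y(1)] by (intro order_trans[OF norm_triangle_ineq4] add_mono)
  finally have "norm \<beta> * norm (x - y) \<le> 2 * C" by (simp add: norm_mult)
  moreover have "norm \<beta> * (\<rho> / 2) \<le> norm \<beta> * norm (x - y)" using xy by (intro mult_left_mono) auto
  ultimately have \<beta>: "norm \<beta> * \<rho> \<le> 4 * C" by simp
  have "norm (x - c) \<le> \<rho>"
  proof -
    have "norm (x - c) \<le> norm (of_real (\<rho> / 2) :: complex) + norm (c + of_real (\<rho> / 2) - x)"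
      using norm_triangle_ineq4[of "of_real (\<rho> / 2)" "c + of_real (\<rho> / 2) - x"] by simp
    then show ?thesis using x(2) \<rho> by (simp add: dist_norm)
  qed
  then have zx: "norm (z - x) \<le> 2 * \<rho>" using z norm_triangle_ineq4[of "z - c" "x - c"] by simp
  have "\<alpha> + \<beta> * (z - c) = (\<alpha> + \<beta> * (x - c)) + \<beta> * (z - x)" by (simp add: algebra_simps)
  then have "norm (\<alpha> + \<beta> * (z - c)) \<le> norm (\<alpha> + \<beta> * (x - c)) + norm \<beta> * norm (z - x)"
    by (metis norm_mult norm_triangle_ineq)
  also have "\<dots> \<le> C + norm \<beta> * (2 * \<rho>)" using bd[OF x(1)] zx by (intro add_mono mult_left_mono) auto
  finally show ?thesis using \<beta> by simp
qed

text \<open>Positive measures carry the size estimates, the coefficients all cancellation. The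
  intended family consists of the four Jordan parts with coefficients
  \<open>\<i> ^ k\<close>.\<close>

locale Cauchy_system =
  fixes I :: "'i set" and a :: "'i \<Rightarrow> complex" and \<nu> :: "'i \<Rightarrow> complex measure"
  assumes finite_I: "finite I" and norm_a: "\<And>i. norm (a i) \<le> 1"
    and fin: "\<And>i. finite_measure (\<nu> i)" and sets_\<nu> [measurable_cong, simp]: "\<And>i. sets (\<nu> i) = sets borel"
begin

definition potential :: "complex \<Rightarrow> complex" where
  "potential z = (\<Sum>i\<in>I. a i * (LINT \<zeta>|\<nu> i. 1 / (\<zeta> - z)))"

lemma potential_borel [measurable]: "potential \<in> borel_measurable borel"
proof -
  have "(\<lambda>z. LINT \<zeta>|\<nu> i. 1 / (\<zeta> - z)) \<in> borel_measurable borel" for i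
  proof -
    interpret finite_measure "\<nu> i" by (rule fin)
    show ?thesis by measurable
  qed
  then show ?thesis unfolding potential_def by measurable
qed

lemma AE_integrable_kernels: "AE z in lborel. \<forall>i\<in>I. integrable (\<nu> i) (\<lambda>\<zeta>. 1 / (\<zeta> - z))"
  by (intro AE_finite_allI finite_I AE_integrable_Cauchy_kernel fin sets_\<nu>)

text \<open>Taking absolute values and dropping the coefficients, of norm at most 1, gives a
  majorant of the contribution of the doubled disc that makes sense even where it is
  infinite.\<close>

definition near :: "complex \<Rightarrow> real \<Rightarrow> complex \<Rightarrow> ennreal" where
  "near c \<rho> z = (\<Sum>i\<in>I. \<integral>\<^sup>+\<zeta>. indicator (ball c (2 * \<rho>)) \<zeta> * ennreal (1 / norm (\<zeta> - z)) \<partial>\<nu> i)"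

definition far :: "complex \<Rightarrow> real \<Rightarrow> complex \<Rightarrow> complex" where
  "far c \<rho> z = (\<Sum>i\<in>I. a i * (LINT \<zeta>|\<nu> i. indicator {\<zeta>. norm (\<zeta> - c) \<ge> 2 * \<rho>} \<zeta> * (1 / (\<zeta> - z))))"

lemma nn_integral_kernel_borel [measurable]:
  "(\<lambda>z. \<integral>\<^sup>+\<zeta>. indicator (ball c r) \<zeta> * ennreal (1 / norm (\<zeta> - z)) \<partial>\<nu> i) \<in> borel_measurable borel"
proof -
  interpret finite_measure "\<nu> i" by (rule fin)
  show ?thesis by measurable
qed

lemma near_borel [measurable]: "near c \<rho> \<in> borel_measurable borel"
  unfolding near_def by measurable

lemma potential_near_far:
  assumes "\<And>i. i \<in> I \<Longrightarrow> integrable (\<nu> i) (\<lambda>\<zeta>. 1 / (\<zeta> - z))"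
  shows "ennreal (norm (potential z - far c \<rho> z)) \<le> near c \<rho> z"
proof -
  let ?B = "ball c (2 * \<rho>)" and ?F = "{\<zeta>. norm (\<zeta> - c) \<ge> 2 * \<rho>}"
  have i1: "integrable (\<nu> i) (\<lambda>\<zeta>. indicator ?B \<zeta> * (1 / (\<zeta> - z)))" if "i \<in> I" for i
    using assms[OF that] by (rule Bochner_Integration.integrable_bound) (auto split: split_indicator)
  have i2: "integrable (\<nu> i) (\<lambda>\<zeta>. indicator ?F \<zeta> * (1 / (\<zeta> - z)))" if "i \<in> I" for i
    using assms[OF that] by (rule Bochner_Integration.integrable_bound) (auto split: split_indicator)
  have split: "(LINT \<zeta>|\<nu> i. 1 / (\<zeta> - z)) - (LINT \<zeta>|\<nu> i. indicator ?F \<zeta> * (1 / (\<zeta> - z)))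
      = (LINT \<zeta>|\<nu> i. indicator ?B \<zeta> * (1 / (\<zeta> - z)))" if "i \<in> I" for i
    unfolding Bochner_Integration.integral_diff[OF assms[OF that] i2[OF that], symmetric]
    by (intro Bochner_Integration.integral_cong) (auto simp: indicator_def dist_norm norm_minus_commute)
  have "potential z - far c \<rho> z = (\<Sum>i\<in>I. a i * (LINT \<zeta>|\<nu> i. indicator ?B \<zeta> * (1 / (\<zeta> - z))))"
    unfolding potential_def far_def sum_subtractf[symmetric]
    by (intro sum.cong refl) (simp only: split[symmetric] right_diff_distrib)
  then have "norm (potential z - far c \<rho> z) \<le> (\<Sum>i\<in>I. norm (LINT \<zeta>|\<nu> i. indicator ?B \<zeta> * (1 / (\<zeta> - z))))"
    using norm_a by (auto simp: norm_mult intro!: sum_norm_le mult_left_le_one_le)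
  then have "ennreal (norm (potential z - far c \<rho> z)) \<le> (\<Sum>i\<in>I. ennreal (norm (LINT \<zeta>|\<nu> i. indicator ?B \<zeta> * (1 / (\<zeta> - z)))))"
    by (subst sum_ennreal) (auto intro: ennreal_leI)
  also have "\<dots> \<le> near c \<rho> z" unfolding near_def
  proof (intro sum_mono)
    fix i assume "i \<in> I"
    then have "ennreal (norm (LINT \<zeta>|\<nu> i. indicator ?B \<zeta> * (1 / (\<zeta> - z)))) \<le> (\<integral>\<^sup>+\<zeta>. norm (indicator ?B \<zeta> * (1 / (\<zeta> - z))) \<partial>\<nu> i)"
      by (intro integral_norm_bound_ennreal i1)
    also have "\<dots> = (\<integral>\<^sup>+\<zeta>. indicator ?B \<zeta> * ennreal (1 / norm (\<zeta> - z)) \<partial>\<nu> i)"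
      by (intro nn_integral_cong) (auto simp: norm_divide split: split_indicator)
    finally show "ennreal (norm (LINT \<zeta>|\<nu> i. indicator ?B \<zeta> * (1 / (\<zeta> - z)))) \<le> \<dots>" .
  qed
  finally show ?thesis .
qed

text \<open>The mass factor is \<open>K * (2 * \<rho>)\<^sup>2\<close> for each measure.
  \<open>s\<close> is meant to be of the order of the square root of the area of
  \<open>G\<close>.\<close>

lemma nn_integral_near_le:
  assumes K: "\<And>i r. i \<in> I \<Longrightarrow> r > 0 \<Longrightarrow> measure (\<nu> i) (ball c r) \<le> K * r\<^sup>2"
    and \<rho>: "\<rho> > 0" and s: "s > 0" and G [measurable]: "G \<in> sets borel"
    and b: "b \<ge> 0" "emeasure lborel G \<le> ennreal b"
  shows "(\<integral>\<^sup>+z. indicator G z * near c \<rho> z \<partial>lborel) \<le> ennreal ((4 * pi * s + b / s) * (4 * (real (card I) * K) * \<rho>\<^sup>2))"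
proof -
  have "(\<integral>\<^sup>+z. indicator G z * near c \<rho> z \<partial>lborel)
      = (\<Sum>i\<in>I. \<integral>\<^sup>+z. indicator G z * (\<integral>\<^sup>+\<zeta>. indicator (ball c (2 * \<rho>)) \<zeta> * ennreal (1 / norm (\<zeta> - z)) \<partial>\<nu> i) \<partial>lborel)"
    unfolding near_def sum_distrib_left by (subst nn_integral_sum) (auto intro!: borel_measurable_times_ennreal)
  also have "\<dots> \<le> (\<Sum>i\<in>I. ennreal ((4 * pi * s + b / s) * (K * (2 * \<rho>)\<^sup>2)))"
  proof (rule sum_mono)
    fix i assume i: "i \<in> I"
    interpret finite_measure "\<nu> i" by (rule fin)
    have "(\<integral>\<^sup>+z. indicator G z * (\<integral>\<^sup>+\<zeta>. indicator (ball c (2 * \<rho>)) \<zeta> * ennreal (1 / norm (\<zeta> - z)) \<partial>\<nu> i) \<partial>lborel)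
      \<le> (ennreal (4 * pi * s) + ennreal (1 / s) * emeasure lborel G) * emeasure (\<nu> i) (ball c (2 * \<rho>))"
      by (rule nn_integral_potential_le[OF fin sets_\<nu> s]) measurable
    also have "\<dots> \<le> (ennreal (4 * pi * s) + ennreal (1 / s) * ennreal b) * ennreal (K * (2 * \<rho>)\<^sup>2)"
      using K[OF i, of "2 * \<rho>"] \<rho> b by (intro mult_mono add_mono) (auto simp: emeasure_eq_measure intro!: ennreal_leI)
    also have "\<dots> = ennreal ((4 * pi * s + b / s) * (K * (2 * \<rho>)\<^sup>2))"
      using s b by (simp add: ennreal_mult'[symmetric] ennreal_plus[symmetric] del: ennreal_plus)
    finally show "(\<integral>\<^sup>+z. indicator G z * (\<integral>\<^sup>+\<zeta>. indicator (ball c (2 * \<rho>)) \<zeta> * ennreal (1 / norm (\<zeta> - z)) \<partial>\<nu> i) \<partial>lborel)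
      \<le> ennreal ((4 * pi * s + b / s) * (K * (2 * \<rho>)\<^sup>2))" .
  qed
  also have "\<dots> = ennreal ((4 * pi * s + b / s) * (4 * (real (card I) * K) * \<rho>\<^sup>2))"
    by (simp add: ennreal_of_nat_eq_real_of_nat ennreal_mult''[symmetric] ennreal_mult'[symmetric] power2_eq_square mult_ac)
  finally show ?thesis .
qed

text \<open>With \<open>n = card I * K\<close>, the first summand comes from the near part over the
  exceptional set. The others bound the far part in units of \<open>\<rho>\<close>:
  \<open>8 * n\<close> is the error of its affine approximation, and the affine part is at most
  \<open>9 * (T + 8 * n)\<close> for the threshold \<open>T = 640 * (n + 1)\<close>.\<close>

definition potential_bound :: "real \<Rightarrow> real" where
  "potential_bound K = 4 * (4 * pi + 1) * (real (card I) * K) + 8 * (real (card I) * K) + 9 * (640 * (real (card I) * K + 1) + 8 * (real (card I) * K))"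

text \<open>Where the potential vanishes its far part equals minus its near part, which is \<open>O(\<rho>)\<close>
  on most of the disc; the far part being almost affine, this bound extends to the whole disc.\<close>

lemma nn_integral_potential_off_zeros_le:
  assumes K: "\<And>i r. i \<in> I \<Longrightarrow> r > 0 \<Longrightarrow> measure (\<nu> i) (ball c r) \<le> K * r\<^sup>2" and K0: "K \<ge> 0"
    and \<rho>: "\<rho> > 0" and \<eta>: "0 < \<eta>" "\<eta> \<le> 1 / 4" and A [measurable]: "A \<in> sets borel"
    and int: "\<And>z i. z \<in> A \<Longrightarrow> i \<in> I \<Longrightarrow> integrable (\<nu> i) (\<lambda>\<zeta>. 1 / (\<zeta> - z))"
    and zero: "\<And>z. z \<in> A \<Longrightarrow> potential z = 0"
    and dens: "emeasure lborel (ball c \<rho> - A) \<le> ennreal ((\<eta> * \<rho>)\<^sup>2)"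
  shows "(\<integral>\<^sup>+z. indicator (ball c \<rho> - A) z * ennreal (norm (potential z)) \<partial>lborel) \<le> ennreal (potential_bound K * \<eta> * \<rho> ^ 3)"
proof -
  define n where "n = real (card I) * K"
  have n0: "n \<ge> 0" using K0 by (simp add: n_def)
  have "\<forall>i\<in>I. \<exists>\<alpha> \<beta>. \<forall>z. norm (z - c) \<le> \<rho> \<longrightarrow>
    norm ((LINT \<zeta>|\<nu> i. indicator {\<zeta>. norm (\<zeta> - c) \<ge> 2 * \<rho>} \<zeta> * (1 / (\<zeta> - z))) - (\<alpha> + \<beta> * (z - c))) \<le> 8 * K * \<rho>"
    by (intro ballI far_potential_almost_affine[OF fin sets_\<nu> K \<rho>])
  from bchoice[OF this] obtain \<alpha>' where "\<forall>i\<in>I. \<exists>\<beta>. \<forall>z. norm (z - c) \<le> \<rho> \<longrightarrow>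
    norm ((LINT \<zeta>|\<nu> i. indicator {\<zeta>. norm (\<zeta> - c) \<ge> 2 * \<rho>} \<zeta> * (1 / (\<zeta> - z))) - (\<alpha>' i + \<beta> * (z - c))) \<le> 8 * K * \<rho>" ..
  from bchoice[OF this] obtain \<beta>' where "\<forall>i\<in>I. \<forall>z. norm (z - c) \<le> \<rho> \<longrightarrow>
    norm ((LINT \<zeta>|\<nu> i. indicator {\<zeta>. norm (\<zeta> - c) \<ge> 2 * \<rho>} \<zeta> * (1 / (\<zeta> - z))) - (\<alpha>' i + \<beta>' i * (z - c))) \<le> 8 * K * \<rho>" ..
  then have ab: "\<And>i z. i \<in> I \<Longrightarrow> norm (z - c) \<le> \<rho> \<Longrightarrow>
    norm ((LINT \<zeta>|\<nu> i. indicator {\<zeta>. norm (\<zeta> - c) \<ge> 2 * \<rho>} \<zeta> * (1 / (\<zeta> - z))) - (\<alpha>' i + \<beta>' i * (z - c))) \<le> 8 * K * \<rho>"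
    by simp
  define \<alpha> \<beta> where "\<alpha> = (\<Sum>i\<in>I. a i * \<alpha>' i)" and "\<beta> = (\<Sum>i\<in>I. a i * \<beta>' i)"
  have far: "norm (far c \<rho> z - (\<alpha> + \<beta> * (z - c))) \<le> 8 * n * \<rho>" if z: "norm (z - c) \<le> \<rho>" for z
  proof -
    have "far c \<rho> z - (\<alpha> + \<beta> * (z - c)) = (\<Sum>i\<in>I. a i * ((LINT \<zeta>|\<nu> i. indicator {\<zeta>. norm (\<zeta> - c) \<ge> 2 * \<rho>} \<zeta> * (1 / (\<zeta> - z))) - (\<alpha>' i + \<beta>' i * (z - c))))"
      unfolding far_def \<alpha>_def \<beta>_def by (simp only: sum_distrib_right sum_subtractf sum.distrib right_diff_distrib distrib_left mult.assoc)
    also have "norm \<dots> \<le> (\<Sum>i\<in>I. 1 * (8 * K * \<rho>))"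
      unfolding norm_mult using norm_a ab z by (intro sum_norm_le) (simp only: norm_mult, intro mult_mono, auto)
    finally show ?thesis by (simp add: n_def mult_ac)
  qed
  \<comment> \<open>Chebyshev: the near part has integral at most
    \<open>20 * pi * n * \<rho> ^ 3\<close> over the disc, so it reaches \<open>T * \<rho>\<close>
    on area at most \<open>pi / 32 * \<rho>\<^sup>2\<close>. The added 1 keeps \<open>T\<close>
    positive for \<open>n = 0\<close>.\<close>
  define T where "T = 640 * (n + 1)"
  define G where "G = {z \<in> A \<inter> ball c \<rho>. near c \<rho> z \<le> ennreal (T * \<rho>)}"
  have G [measurable]: "G \<in> sets borel" unfolding G_def by measurable
  have onG: "norm (\<alpha> + \<beta> * (z - c)) \<le> (T + 8 * n) * \<rho>" if "z \<in> G" for z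
  proof -
    have z: "z \<in> A" "norm (z - c) \<le> \<rho>" "near c \<rho> z \<le> ennreal (T * \<rho>)"
      using that by (auto simp: G_def dist_norm norm_minus_commute)
    have "ennreal (norm (potential z - far c \<rho> z)) \<le> ennreal (T * \<rho>)"
      using potential_near_far[OF int[OF z(1)]] z(3) by (rule order_trans)
    then have "norm (far c \<rho> z) \<le> T * \<rho>" using zero[OF z(1)] n0 \<rho> by (simp add: T_def)
    moreover have "norm (\<alpha> + \<beta> * (z - c)) \<le> norm (far c \<rho> z) + norm (far c \<rho> z - (\<alpha> + \<beta> * (z - c)))"
      using norm_triangle_ineq4[of "far c \<rho> z" "far c \<rho> z - (\<alpha> + \<beta> * (z - c))"] by simp
    ultimately show ?thesis using far[OF z(2)] by (simp add: algebra_simps)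
  qed
  have near1: "(\<integral>\<^sup>+z. indicator (ball c \<rho>) z * near c \<rho> z \<partial>lborel) \<le> ennreal ((4 * pi * \<rho> + pi * \<rho>\<^sup>2 / \<rho>) * (4 * n * \<rho>\<^sup>2))"
    unfolding n_def using \<rho> by (intro nn_integral_near_le K) (auto simp: emeasure_ball_complex)
  \<comment> \<open>On the exceptional set, of area at most
    \<open>(\<eta> * \<rho>)\<^sup>2\<close>, the separation radius shrinks from
    \<open>\<rho>\<close> to \<open>\<eta> * \<rho>\<close>; this gains the factor
    \<open>\<eta>\<close>.\<close>
  have near2: "(\<integral>\<^sup>+z. indicator (ball c \<rho> - A) z * near c \<rho> z \<partial>lborel)
      \<le> ennreal ((4 * pi * (\<eta> * \<rho>) + (\<eta> * \<rho>)\<^sup>2 / (\<eta> * \<rho>)) * (4 * n * \<rho>\<^sup>2))"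
    unfolding n_def using \<rho> \<eta> dens by (intro nn_integral_near_le K) auto
  have smallG: "emeasure lborel (ball c \<rho> - G) < ennreal (pi * (\<rho> / 4)\<^sup>2)"
  proof -
    let ?H = "{z \<in> ball c \<rho>. near c \<rho> z \<ge> ennreal (T * \<rho>)}"
    have H [measurable]: "?H \<in> sets borel" by measurable
    have T: "T * \<rho> > 0" using n0 \<rho> by (simp add: T_def)
    have "ennreal (T * \<rho>) * emeasure lborel ?H \<le> (\<integral>\<^sup>+z. indicator (ball c \<rho>) z * near c \<rho> z \<partial>lborel)"
      by (subst nn_integral_cmult_indicator[symmetric]) (auto intro!: nn_integral_mono split: split_indicator)
    also have "\<dots> \<le> ennreal ((4 * pi * \<rho> + pi * \<rho>\<^sup>2 / \<rho>) * (4 * n * \<rho>\<^sup>2))" by (rule near1)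
    also have "\<dots> \<le> ennreal (T * \<rho> * (pi / 32 * \<rho>\<^sup>2))"
      using \<rho> n0 by (intro ennreal_leI) (simp add: T_def power2_eq_square algebra_simps)
    also have "\<dots> = ennreal (T * \<rho>) * ennreal (pi / 32 * \<rho>\<^sup>2)" using T by (intro ennreal_mult) auto
    finally have Hle: "emeasure lborel ?H \<le> ennreal (pi / 32 * \<rho>\<^sup>2)"
      using T by (subst (asm) ennreal_mult_le_mult_iff) auto
    have "emeasure lborel (ball c \<rho> - G) \<le> emeasure lborel ((ball c \<rho> - A) \<union> ?H)"
      by (intro emeasure_mono) (auto simp: G_def)
    also have "\<dots> \<le> emeasure lborel (ball c \<rho> - A) + emeasure lborel ?H"
      by (intro emeasure_subadditive) auto
    also have "\<dots> \<le> ennreal ((\<eta> * \<rho>)\<^sup>2) + ennreal (pi / 32 * \<rho>\<^sup>2)" by (intro add_mono dens Hle)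
    also have "\<dots> = ennreal ((\<eta> * \<rho>)\<^sup>2 + pi / 32 * \<rho>\<^sup>2)" by simp
    also have "\<dots> < ennreal (pi * (\<rho> / 4)\<^sup>2)"
    proof -
      \<comment> \<open>With \<open>\<eta> \<le> 1 / 4\<close> the total is at most
        \<open>\<rho>\<^sup>2 / 16 + pi * \<rho>\<^sup>2 / 32\<close>, which is below
        \<open>pi * \<rho>\<^sup>2 / 16\<close> as \<open>pi > 2\<close>.\<close>
      have "(\<eta> * \<rho>)\<^sup>2 \<le> (1 / 4 * \<rho>)\<^sup>2" using \<eta> \<rho> by (intro power_mono mult_right_mono) auto
      moreover have "\<rho>\<^sup>2 * 2 < \<rho>\<^sup>2 * pi" using pi_gt3 \<rho> by (intro mult_strict_left_mono) auto
      ultimately have "(\<eta> * \<rho>)\<^sup>2 + pi / 32 * \<rho>\<^sup>2 < pi * (\<rho> / 4)\<^sup>2"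
        by (simp add: power2_eq_square field_simps)
      then show ?thesis by (intro ennreal_lessI) (use \<rho> in auto)
    qed
    finally show ?thesis .
  qed
  have aff: "norm (\<alpha> + \<beta> * (z - c)) \<le> 9 * ((T + 8 * n) * \<rho>)" if "norm (z - c) \<le> \<rho>" for z
    using affine_bound_from_large_set[OF \<rho> G onG smallG that] .
  define D where "D = (8 * n + 9 * (T + 8 * n)) * \<rho>"
  have D0: "D \<ge> 0" using n0 \<rho> by (simp add: D_def T_def)
  have "(\<integral>\<^sup>+z. indicator (ball c \<rho> - A) z * ennreal (norm (potential z)) \<partial>lborel)
    \<le> (\<integral>\<^sup>+z. indicator (ball c \<rho> - A) z * near c \<rho> z + ennreal D * indicator (ball c \<rho> - A) z \<partial>lborel)"
  proof (rule nn_integral_mono_AE)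
    show "AE z in lborel. indicator (ball c \<rho> - A) z * ennreal (norm (potential z))
        \<le> indicator (ball c \<rho> - A) z * near c \<rho> z + ennreal D * indicator (ball c \<rho> - A) z"
      using AE_integrable_kernels
    proof eventually_elim
      case (elim z)
      show ?case
      proof (cases "z \<in> ball c \<rho> - A")
        case True
        then have z: "norm (z - c) \<le> \<rho>" by (auto simp: dist_norm norm_minus_commute)
        have "norm (far c \<rho> z) \<le> norm (far c \<rho> z - (\<alpha> + \<beta> * (z - c))) + norm (\<alpha> + \<beta> * (z - c))"
          using norm_triangle_sub[of "far c \<rho> z" "\<alpha> + \<beta> * (z - c)"] by linarith
        then have "norm (far c \<rho> z) \<le> D" using far[OF z] aff[OF z] by (simp add: D_def algebra_simps)
        then have "norm (potential z) \<le> norm (potential z - far c \<rho> z) + D"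
          using norm_triangle_sub[of "potential z" "far c \<rho> z"] by simp
        then have "ennreal (norm (potential z)) \<le> ennreal (norm (potential z - far c \<rho> z)) + ennreal D"
          using D0 by (simp add: ennreal_plus[symmetric] ennreal_leI del: ennreal_plus)
        also have "\<dots> \<le> near c \<rho> z + ennreal D"
          using elim by (intro add_right_mono potential_near_far) auto
        finally show ?thesis using True by simp
      qed simp
    qed
  qed
  also have "\<dots> = (\<integral>\<^sup>+z. indicator (ball c \<rho> - A) z * near c \<rho> z \<partial>lborel) + ennreal D * emeasure lborel (ball c \<rho> - A)"
    by (subst nn_integral_add) (measurable, simp add: nn_integral_cmult)
  also have "\<dots> \<le> ennreal ((4 * pi * (\<eta> * \<rho>) + (\<eta> * \<rho>)\<^sup>2 / (\<eta> * \<rho>)) * (4 * n * \<rho>\<^sup>2)) + ennreal D * ennreal ((\<eta> * \<rho>)\<^sup>2)"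
    by (intro add_mono near2 mult_left_mono dens) auto
  also have "\<dots> = ennreal ((4 * pi * (\<eta> * \<rho>) + (\<eta> * \<rho>)\<^sup>2 / (\<eta> * \<rho>)) * (4 * n * \<rho>\<^sup>2) + D * (\<eta> * \<rho>)\<^sup>2)"
    using D0 n0 \<eta> \<rho> by (simp add: ennreal_mult'[symmetric] ennreal_plus[symmetric] del: ennreal_plus)
  also have "\<dots> \<le> ennreal (potential_bound K * \<eta> * \<rho> ^ 3)"
  proof (rule ennreal_leI)
    \<comment> \<open>The far part gains \<open>\<eta>\<^sup>2\<close>, the near part only
      \<open>\<eta>\<close>; the weaker gain is kept for both.\<close>
    have "\<eta>\<^sup>2 \<le> \<eta>" using \<eta> by (simp add: power2_eq_square mult_left_le_one_le)
    then have "D * \<rho>\<^sup>2 * \<eta>\<^sup>2 \<le> D * \<rho>\<^sup>2 * \<eta>" using D0 by (intro mult_left_mono) auto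
    moreover have "(4 * pi * (\<eta> * \<rho>) + (\<eta> * \<rho>)\<^sup>2 / (\<eta> * \<rho>)) * (4 * n * \<rho>\<^sup>2) + D * \<rho>\<^sup>2 * \<eta> = potential_bound K * \<eta> * \<rho> ^ 3"
      using \<eta> \<rho> unfolding potential_bound_def n_def[symmetric] D_def T_def
      by (simp add: power2_eq_square power3_eq_cube) (simp add: algebra_simps)
    ultimately show "(4 * pi * (\<eta> * \<rho>) + (\<eta> * \<rho>)\<^sup>2 / (\<eta> * \<rho>)) * (4 * n * \<rho>\<^sup>2) + D * (\<eta> * \<rho>)\<^sup>2 \<le> potential_bound K * \<eta> * \<rho> ^ 3"
      by (simp add: power_mult_distrib mult_ac)
  qed
  finally show ?thesis .
qed

end

section \<open>Testing against a tent function\<close>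

definition tent :: "real \<Rightarrow> complex \<Rightarrow> real" where "tent R w = max 0 (R - sup_norm w)"

lemma tent_borel [measurable]: "tent R \<in> borel_measurable borel"
  unfolding tent_def sup_norm_def by measurable

lemma tent_nonneg: "0 \<le> tent R w" by (simp add: tent_def)

lemma tent_le: "R \<ge> 0 \<Longrightarrow> tent R w \<le> R" by (simp add: tent_def sup_norm_def)

lemma tent_support: "tent R w \<noteq> 0 \<Longrightarrow> norm w < 2 * R"
  using cmod_le[of w] by (auto simp: tent_def sup_norm_def max_def split: if_splits)

lemma tent_ge: "norm w \<le> R / 2 \<Longrightarrow> R / 2 \<le> tent R w"
  using abs_Re_le_cmod[of w] abs_Im_le_cmod[of w] by (auto simp: tent_def sup_norm_def max_def)

lemma tent_le_indicator: "R \<ge> 0 \<Longrightarrow> tent R (z - c) \<le> R * indicator (ball c (2 * R)) z"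
  using tent_support[of R "z - c"] tent_le[of R "z - c"]
  by (cases "tent R (z - c) = 0") (auto simp: indicator_def dist_norm norm_minus_commute)

lemma integrable_tent:
  assumes R: "R \<ge> 0" and s [measurable_cong]: "sets M = sets borel" and f: "emeasure M (ball c (2 * R)) < \<infinity>"
  shows "integrable M (\<lambda>z. tent R (z - c))"
proof (rule Bochner_Integration.integrable_bound)
  show "integrable M (\<lambda>z. R * indicator (ball c (2 * R)) z)" using f s by simp
  show "AE z in M. norm (tent R (z - c)) \<le> norm (R * indicator (ball c (2 * R)) z)"
    using tent_le_indicator[OF R] tent_nonneg R by auto
qed measurable

text \<open>Half the height on a disc of half the radius already gives the order
  \<open>R ^ 3\<close>.\<close>

lemma integral_tent_ge:
  assumes R: "R > 0"
  shows "pi * R ^ 3 / 8 \<le> (LBINT z. tent R (z - c))"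
proof -
  have "(LBINT z. R / 2 * indicator (ball c (R / 2)) z) \<le> (LBINT z. tent R (z - c))"
  proof (rule integral_mono)
    show "integrable lborel (\<lambda>z. R / 2 * indicator (ball c (R / 2)) z)"
      using emeasure_lborel_ball_finite by (intro integrable_mult_right integrable_real_indicator) auto
    show "integrable lborel (\<lambda>z. tent R (z - c))"
      using R emeasure_lborel_ball_finite by (intro integrable_tent) auto
    show "R / 2 * indicator (ball c (R / 2)) z \<le> tent R (z - c)" for z
      using tent_ge[of "z - c" R] tent_nonneg[of R "z - c"] by (auto simp: indicator_def dist_norm norm_minus_commute)
  qed
  moreover have "measure lborel (ball c (R / 2)) = pi * (R / 2)\<^sup>2"
    using R by (simp add: measure_def emeasure_ball_complex)
  ultimately show ?thesis by (simp add: power2_eq_square power3_eq_cube mult_ac)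
qed

context Cauchy_system begin

text \<open>Justifies the use of Fubini below: the tangent is bounded and supported in a disc, over
  which the absolute potential has a finite area integral.\<close>

lemma integrable_tangent_kernel:
  "integrable (lborel \<Otimes>\<^sub>M \<nu> i) (\<lambda>(z, \<zeta>). square_tangent R (z - c) * (1 / (\<zeta> - z)))"
proof (rule integrableI_bounded)
  interpret finite_measure "\<nu> i" by (rule fin)
  have sf: "sigma_finite_measure (\<nu> i)" ..
  interpret pair_sigma_finite lborel "\<nu> i" ..
  show "(\<lambda>(z, \<zeta>). square_tangent R (z - c) * (1 / (\<zeta> - z))) \<in> borel_measurable (lborel \<Otimes>\<^sub>M \<nu> i)"
    by measurable
  let ?N = "\<lambda>z. indicator (ball c (2 * R)) z * (\<integral>\<^sup>+\<zeta>. indicator UNIV \<zeta> * ennreal (1 / norm (\<zeta> - z)) \<partial>\<nu> i)"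
  have [measurable]: "(\<lambda>z. \<integral>\<^sup>+\<zeta>. indicator UNIV \<zeta> * ennreal (1 / norm (\<zeta> - z)) \<partial>\<nu> i) \<in> borel_measurable borel"
    by measurable
  have "(\<integral>\<^sup>+x. norm (case x of (z, \<zeta>) \<Rightarrow> square_tangent R (z - c) * (1 / (\<zeta> - z))) \<partial>(lborel \<Otimes>\<^sub>M \<nu> i))
    = (\<integral>\<^sup>+z. \<integral>\<^sup>+\<zeta>. norm (square_tangent R (z - c) * (1 / (\<zeta> - z))) \<partial>\<nu> i \<partial>lborel)"
    by (subst sigma_finite_measure.nn_integral_fst[OF sf, symmetric]) auto
  also have "\<dots> \<le> (\<integral>\<^sup>+z. 4 * ?N z \<partial>lborel)"
  proof (rule nn_integral_mono)
    fix z
    have "(\<integral>\<^sup>+\<zeta>. norm (square_tangent R (z - c) * (1 / (\<zeta> - z))) \<partial>\<nu> i)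
      \<le> (\<integral>\<^sup>+\<zeta>. (4 * indicator (ball c (2 * R)) z) * (indicator UNIV \<zeta> * ennreal (1 / norm (\<zeta> - z))) \<partial>\<nu> i)"
    proof (rule nn_integral_mono)
      fix \<zeta>
      have n: "norm (square_tangent R (z - c)) \<le> 4 * indicator (ball c (2 * R)) z"
        using norm_square_tangent[of R "z - c"] square_tangent_support[of R "z - c"]
        by (cases "square_tangent R (z - c) = 0") (auto simp: indicator_def dist_norm norm_minus_commute)
      have "norm (square_tangent R (z - c) * (1 / (\<zeta> - z))) \<le> (4 * indicator (ball c (2 * R)) z) * (1 / norm (\<zeta> - z))"
        using mult_right_mono[OF n, of "1 / norm (\<zeta> - z)"] by (simp add: norm_mult norm_divide)
      then have "ennreal (norm (square_tangent R (z - c) * (1 / (\<zeta> - z))))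
          \<le> ennreal ((4 * indicator (ball c (2 * R)) z) * (1 / norm (\<zeta> - z)))" by (rule ennreal_leI)
      also have "\<dots> = (4 * indicator (ball c (2 * R)) z) * (indicator UNIV \<zeta> * ennreal (1 / norm (\<zeta> - z)))"
        using ennreal_mult'[of 4 "1 / norm (\<zeta> - z)"] by (auto split: split_indicator)
      finally show "ennreal (norm (square_tangent R (z - c) * (1 / (\<zeta> - z))))
         \<le> (4 * indicator (ball c (2 * R)) z) * (indicator UNIV \<zeta> * ennreal (1 / norm (\<zeta> - z)))" .
    qed
    also have "\<dots> = 4 * ?N z" by (subst nn_integral_cmult) (auto simp: mult.assoc)
    finally show "(\<integral>\<^sup>+\<zeta>. norm (square_tangent R (z - c) * (1 / (\<zeta> - z))) \<partial>\<nu> i) \<le> 4 * ?N z" .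
  qed
  also have "\<dots> = 4 * (\<integral>\<^sup>+z. ?N z \<partial>lborel)" by (rule nn_integral_cmult) measurable
  also have "\<dots> \<le> 4 * ((ennreal (4 * pi * 1) + ennreal (1 / 1) * emeasure lborel (ball c (2 * R))) * emeasure (\<nu> i) UNIV)"
    by (intro mult_left_mono nn_integral_potential_le fin sets_\<nu>) auto
  also have "\<dots> < \<infinity>"
    using emeasure_lborel_ball_finite[of c "2 * R"]
    by (simp add: emeasure_eq_measure ennreal_mult_less_top top.not_eq_extremum)
  finally show "(\<integral>\<^sup>+x. norm (case x of (z, \<zeta>) \<Rightarrow> square_tangent R (z - c) * (1 / (\<zeta> - z))) \<partial>(lborel \<Otimes>\<^sub>M \<nu> i)) < \<infinity>" .
qed

text \<open>Fubini lets the tangent act on the kernel for each fixed \<open>\<zeta>\<close>. The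
  sign appears because the potential uses \<open>1 / (\<zeta> - z)\<close> and the contour integral
  \<open>1 / (z - \<zeta>)\<close>.\<close>

lemma integral_square_tangent_potential:
  assumes R: "R > 0"
  shows "(LBINT z. square_tangent R (z - c) * potential z)
    = - (2 * pi * \<i>) * (\<Sum>i\<in>I. a i * (LINT \<zeta>|\<nu> i. tent R (\<zeta> - c)))"
proof -
  let ?f = "\<lambda>z \<zeta>. square_tangent R (z - c) * (1 / (\<zeta> - z))"
  have int: "integrable lborel (\<lambda>z. LINT \<zeta>|\<nu> i. ?f z \<zeta>)"
    and swap: "(LBINT z. LINT \<zeta>|\<nu> i. ?f z \<zeta>) = - (2 * pi * \<i>) * (LINT \<zeta>|\<nu> i. tent R (\<zeta> - c))" for i
  proof -
    interpret finite_measure "\<nu> i" by (rule fin)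
    interpret pair_sigma_finite lborel "\<nu> i" ..
    show "integrable lborel (\<lambda>z. LINT \<zeta>|\<nu> i. ?f z \<zeta>)"
      using integrable_fst'[OF integrable_tangent_kernel] by simp
    have "(LBINT z. LINT \<zeta>|\<nu> i. ?f z \<zeta>) = (LINT \<zeta>|\<nu> i. (LBINT z. ?f z \<zeta>))"
      by (rule Fubini_integral[symmetric]) (rule integrable_tangent_kernel)
    also have "\<dots> = (LINT \<zeta>|\<nu> i. - (2 * pi * \<i>) * complex_of_real (tent R (\<zeta> - c)))"
    proof (rule Bochner_Integration.integral_cong[OF refl])
      fix \<zeta>
      have "(LBINT z. ?f z \<zeta>) = (LBINT z. - (square_tangent R (z - c) * (1 / (z - \<zeta>))))"
      proof (rule Bochner_Integration.integral_cong[OF refl])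
        fix z
        have "1 / (\<zeta> - z) = - (1 / (z - \<zeta>))" by (metis minus_diff_eq minus_divide_right)
        then show "?f z \<zeta> = - (square_tangent R (z - c) * (1 / (z - \<zeta>)))" by simp
      qed
      also have "\<dots> = - (LBINT z. square_tangent R (z - c) * (1 / (z - \<zeta>)))"
        by (rule Bochner_Integration.integral_minus)
      also have "\<dots> = - (2 * pi * \<i>) * complex_of_real (tent R (\<zeta> - c))"
        using integral_square_tangent_Cauchy_kernel[OF R] by (simp add: tent_def)
      finally show "(LBINT z. ?f z \<zeta>) = \<dots>" .
    qed
    also have "\<dots> = - (2 * pi * \<i>) * (LINT \<zeta>|\<nu> i. complex_of_real (tent R (\<zeta> - c)))"
      by (rule integral_mult_right_zero)
    also have "(LINT \<zeta>|\<nu> i. complex_of_real (tent R (\<zeta> - c))) = complex_of_real (LINT \<zeta>|\<nu> i. tent R (\<zeta> - c))"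
      by (rule integral_complex_of_real)
    finally show "(LBINT z. LINT \<zeta>|\<nu> i. ?f z \<zeta>) = - (2 * pi * \<i>) * (LINT \<zeta>|\<nu> i. tent R (\<zeta> - c))" .
  qed
  have "(LBINT z. square_tangent R (z - c) * potential z) = (LBINT z. \<Sum>i\<in>I. a i * (LINT \<zeta>|\<nu> i. ?f z \<zeta>))"
    unfolding potential_def by (intro Bochner_Integration.integral_cong refl)
      (simp only: sum_distrib_left integral_mult_right_zero mult.left_commute)
  also have "\<dots> = (\<Sum>i\<in>I. a i * (LBINT z. LINT \<zeta>|\<nu> i. ?f z \<zeta>))"
    by (intro integral_lincomb int)
  finally show ?thesis unfolding swap by (simp add: sum_distrib_left mult_ac)
qed

text \<open>The tangent lives in \<open>ball c (2 * R)\<close> and the potential vanishes on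
  \<open>A\<close>, so only \<open>ball c (2 * R) - A\<close> counts. The constant 32 is 4 from the
  tangent times 8 from the doubled radius cubed; the factor \<open>2 * pi\<close> on the left is
  weakened to 1.\<close>

lemma norm_tent_pairing_le:
  assumes K: "\<And>i r. i \<in> I \<Longrightarrow> r > 0 \<Longrightarrow> measure (\<nu> i) (ball c r) \<le> K * r\<^sup>2" and K0: "K \<ge> 0"
    and R: "R > 0" and \<eta>: "0 < \<eta>" "\<eta> \<le> 1 / 4" and A [measurable]: "A \<in> sets borel"
    and int: "\<And>z i. z \<in> A \<Longrightarrow> i \<in> I \<Longrightarrow> integrable (\<nu> i) (\<lambda>\<zeta>. 1 / (\<zeta> - z))"
    and zero: "\<And>z. z \<in> A \<Longrightarrow> potential z = 0"
    and dens: "emeasure lborel (ball c (2 * R) - A) \<le> ennreal ((\<eta> * (2 * R))\<^sup>2)"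
  shows "norm (\<Sum>i\<in>I. a i * (LINT \<zeta>|\<nu> i. tent R (\<zeta> - c))) \<le> 32 * potential_bound K * \<eta> * R ^ 3"
proof -
  have pb: "potential_bound K \<ge> 0" using K0 by (simp add: potential_bound_def)
  have "ennreal (norm (LBINT z. square_tangent R (z - c) * potential z))
      \<le> (\<integral>\<^sup>+z. norm (square_tangent R (z - c) * potential z) \<partial>lborel)"
  \<comment> \<open>If the product were not integrable, its integral would be 0 by
    convention.\<close>
  proof (cases "integrable lborel (\<lambda>z. square_tangent R (z - c) * potential z)")
    case False
    then show ?thesis by (simp add: not_integrable_integral_eq)
  qed (rule integral_norm_bound_ennreal)
  also have "\<dots> \<le> (\<integral>\<^sup>+z. 4 * (indicator (ball c (2 * R) - A) z * ennreal (norm (potential z))) \<partial>lborel)"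
  proof (rule nn_integral_mono)
    fix z
    have "norm (square_tangent R (z - c) * potential z) \<le> 4 * (indicator (ball c (2 * R) - A) z * norm (potential z))"
      using norm_square_tangent[of R "z - c"] square_tangent_support[of R "z - c"] zero[of z]
      by (cases "square_tangent R (z - c) = 0")
        (auto simp: norm_mult indicator_def dist_norm norm_minus_commute intro!: mult_right_mono)
    then have "ennreal (norm (square_tangent R (z - c) * potential z)) \<le> ennreal (4 * (indicator (ball c (2 * R) - A) z * norm (potential z)))"
      by (rule ennreal_leI)
    then show "ennreal (norm (square_tangent R (z - c) * potential z)) \<le> 4 * (indicator (ball c (2 * R) - A) z * ennreal (norm (potential z)))"
      by (auto simp: ennreal_mult split: split_indicator_asm split_indicator)
  qed
  also have "\<dots> = 4 * (\<integral>\<^sup>+z. indicator (ball c (2 * R) - A) z * ennreal (norm (potential z)) \<partial>lborel)"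
    by (rule nn_integral_cmult) measurable
  also have "\<dots> \<le> 4 * ennreal (potential_bound K * \<eta> * (2 * R) ^ 3)"
    using R by (intro mult_left_mono nn_integral_potential_off_zeros_le[OF K K0 _ \<eta> A int zero dens]) auto
  also have "\<dots> = ennreal (32 * potential_bound K * \<eta> * R ^ 3)"
    using pb \<eta> R by (simp add: ennreal_mult''[symmetric] ennreal_numeral[symmetric] power_mult_distrib mult_ac del: ennreal_numeral)
  finally have "norm (LBINT z. square_tangent R (z - c) * potential z) \<le> 32 * potential_bound K * \<eta> * R ^ 3"
    using pb \<eta> R by (simp add: ennreal_le_iff)
  then have "2 * pi * norm (\<Sum>i\<in>I. a i * (LINT \<zeta>|\<nu> i. tent R (\<zeta> - c))) \<le> 32 * potential_bound K * \<eta> * R ^ 3"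
    unfolding integral_square_tangent_potential[OF R] by (simp add: norm_mult)
  moreover have "1 * norm (\<Sum>i\<in>I. a i * (LINT \<zeta>|\<nu> i. tent R (\<zeta> - c))) \<le> 2 * pi * norm (\<Sum>i\<in>I. a i * (LINT \<zeta>|\<nu> i. tent R (\<zeta> - c)))"
    using pi_gt3 by (intro mult_right_mono) auto
  ultimately show ?thesis by linarith
qed

text \<open>On \<open>A\<close> the combined density is too close to \<open>q\<close> for
  cancellation: the pairing there is at least \<open>3 / 4 * norm q\<close> times the integral of
  the tent over \<open>A\<close>. Off \<open>A\<close>, the mass seen by the tent and the missing
  part of its area integral are each at most \<open>R * (\<eta> * (2 * R))\<^sup>2\<close>.\<close>

lemma tent_pairing_near_constant:
  assumes R: "R > 0" and \<eta>: "0 < \<eta>" and A [measurable]: "A \<in> sets borel"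
    and p [measurable]: "\<And>i. i \<in> I \<Longrightarrow> p i \<in> borel_measurable borel"
    and p0: "\<And>i z. i \<in> I \<Longrightarrow> z \<in> A \<Longrightarrow> 0 \<le> p i z \<and> p i z \<le> N"
    and dens: "\<And>i. i \<in> I \<Longrightarrow> density (\<nu> i) (indicator A) = density lborel (\<lambda>z. ennreal (indicator A z * p i z))"
    and q: "\<And>z. z \<in> A \<Longrightarrow> norm ((\<Sum>i\<in>I. a i * p i z) - q) \<le> norm q / 4"
    and small\<nu>: "\<And>i. i \<in> I \<Longrightarrow> measure (\<nu> i) (ball c (2 * R) - A) \<le> (\<eta> * (2 * R))\<^sup>2"
    and small: "emeasure lborel (ball c (2 * R) - A) \<le> ennreal ((\<eta> * (2 * R))\<^sup>2)"
  shows "norm (\<Sum>i\<in>I. a i * (LINT \<zeta>|\<nu> i. tent R (\<zeta> - c))) \<ge>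
    3 / 4 * norm q * (pi * R ^ 3 / 8) - (card I + norm q) * (R * (\<eta> * (2 * R))\<^sup>2)"
proof -
  let ?B = "ball c (2 * R)"
  let ?t = "\<lambda>z. tent R (z - c)"
  have tl: "integrable lborel ?t"
    using R emeasure_lborel_ball_finite by (intro integrable_tent) auto
  have tA: "integrable lborel (\<lambda>z. indicator A z * ?t z)"
    using tl by (rule Bochner_Integration.integrable_bound) (auto split: split_indicator)
  \<comment> \<open>The tent has height at most \<open>R\<close> and vanishes outside
    \<open>ball c (2 * R)\<close>. Both the \<open>\<nu> i\<close> and \<open>lborel\<close> are
    instances of \<open>M\<close>.\<close>
  have off: "(LINT z|M. indicator (- A) z * ?t z) \<le> R * d"
    if s [measurable_cong]: "sets M = sets borel" and e: "emeasure M (?B - A) \<le> ennreal d" "d \<ge> 0" for M d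
  proof -
    have f: "emeasure M (?B - A) < \<infinity>" using e(1) by (rule le_less_trans) simp
    have "(LINT z|M. indicator (- A) z * ?t z) \<le> (LINT z|M. R * indicator (?B - A) z)"
    proof (rule integral_mono')
      show "integrable M (\<lambda>z. R * indicator (?B - A) z)" using f s by simp
      show "indicator (- A) z * ?t z \<le> R * indicator (?B - A) z" for z
        using tent_le_indicator[of R z c] R by (auto split: split_indicator)
    qed (use R in auto)
    also have "\<dots> = R * measure M (?B - A)" using s f by simp
    also have "\<dots> \<le> R * d"
      using e f R by (intro mult_left_mono) (auto simp: measure_def enn2real_leI)
    finally show ?thesis .
  qed
  have decomp: "(LINT \<zeta>|\<nu> i. ?t \<zeta>) = (LBINT z. indicator A z * p i z * ?t z) + (LINT z|\<nu> i. indicator (- A) z * ?t z)"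
    and ip: "integrable lborel (\<lambda>z. indicator A z * p i z * ?t z)" if i: "i \<in> I" for i
  proof -
    interpret finite_measure "\<nu> i" by (rule fin)
    have t: "integrable (\<nu> i) ?t" using R by (intro integrable_tent) (auto simp: emeasure_eq_measure)
    have t1: "integrable (\<nu> i) (\<lambda>z. indicator A z * ?t z)"
      using t by (rule Bochner_Integration.integrable_bound) (auto split: split_indicator)
    have t2: "integrable (\<nu> i) (\<lambda>z. indicator (- A) z * ?t z)"
      using t by (rule Bochner_Integration.integrable_bound) (auto split: split_indicator)
    have "(LINT \<zeta>|\<nu> i. ?t \<zeta>) = (LINT z|\<nu> i. indicator A z * ?t z + indicator (- A) z * ?t z)"
      by (intro Bochner_Integration.integral_cong) (auto split: split_indicator)
    also have "\<dots> = (LINT z|\<nu> i. indicator A z * ?t z) + (LINT z|\<nu> i. indicator (- A) z * ?t z)"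
      by (rule Bochner_Integration.integral_add[OF t1 t2])
    also have "(LINT z|\<nu> i. indicator A z * ?t z) = (LINT z|density (\<nu> i) (\<lambda>z. ennreal (indicator A z)). ?t z)"
      by (subst integral_density) auto
    also have "density (\<nu> i) (\<lambda>z. ennreal (indicator A z)) = density lborel (\<lambda>z. ennreal (indicator A z * p i z))"
      using dens[OF i] by (simp add: ennreal_indicator)
    also have "(LINT z|density lborel (\<lambda>z. ennreal (indicator A z * p i z)). ?t z) = (LBINT z. indicator A z * p i z * ?t z)"
      using p0[OF i] p[OF i] by (subst integral_density) (auto split: split_indicator)
    finally show "(LINT \<zeta>|\<nu> i. ?t \<zeta>) = (LBINT z. indicator A z * p i z * ?t z) + (LINT z|\<nu> i. indicator (- A) z * ?t z)" .
    show "integrable lborel (\<lambda>z. indicator A z * p i z * ?t z)"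
    proof (rule Bochner_Integration.integrable_bound)
      show "integrable lborel (\<lambda>z. N * ?t z)" using tl by simp
      show "(\<lambda>z. indicator A z * p i z * ?t z) \<in> borel_measurable lborel" using p[OF i] by measurable
      have "norm (indicator A z * p i z * ?t z) \<le> norm (N * ?t z)" for z
        using p0[OF i, of z] tent_nonneg[of R "z - c"]
        by (auto simp: abs_mult split: split_indicator intro!: mult_right_mono)
      then show "AE z in lborel. norm (indicator A z * p i z * ?t z) \<le> norm (N * ?t z)" by simp
    qed
  qed
  \<comment> \<open>\<open>P\<close> is the pairing on \<open>A\<close>, where densities exist;
    \<open>Q\<close> collects the mass off \<open>A\<close>, singular or not.\<close>
  define P where "P = (\<Sum>i\<in>I. a i * complex_of_real (LBINT z. indicator A z * p i z * ?t z))"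
  define Q where "Q = (\<Sum>i\<in>I. a i * complex_of_real (LINT z|\<nu> i. indicator (- A) z * ?t z))"
  define L where "L = (LBINT z. indicator A z * ?t z)"
  have L0: "L \<ge> 0" unfolding L_def by (rule integral_nonneg_AE) (simp add: tent_nonneg)
  have "(\<Sum>i\<in>I. a i * (LINT \<zeta>|\<nu> i. ?t \<zeta>)) = P + Q"
    unfolding P_def Q_def by (simp add: decomp sum.distrib distrib_left)
  moreover have "norm Q \<le> card I * (R * (\<eta> * (2 * R))\<^sup>2)"
  proof -
    have "norm Q \<le> (\<Sum>i\<in>I. R * (\<eta> * (2 * R))\<^sup>2)" unfolding Q_def
    proof (rule sum_norm_le)
      fix i assume i: "i \<in> I"
      interpret finite_measure "\<nu> i" by (rule fin)
      have "(LINT z|\<nu> i. indicator (- A) z * ?t z) \<le> R * (\<eta> * (2 * R))\<^sup>2"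
        using small\<nu>[OF i] by (intro off) (auto simp: emeasure_eq_measure ennreal_leI)
      moreover have "0 \<le> (LINT z|\<nu> i. indicator (- A) z * ?t z)"
        by (rule integral_nonneg_AE) (simp add: tent_nonneg)
      ultimately have "1 * \<bar>LINT z|\<nu> i. indicator (- A) z * ?t z\<bar> \<le> R * (\<eta> * (2 * R))\<^sup>2" by simp
      moreover have "norm (a i) * \<bar>LINT z|\<nu> i. indicator (- A) z * ?t z\<bar> \<le> 1 * \<bar>LINT z|\<nu> i. indicator (- A) z * ?t z\<bar>"
        by (intro mult_right_mono norm_a) auto
      ultimately show "norm (a i * complex_of_real (LINT z|\<nu> i. indicator (- A) z * ?t z)) \<le> R * (\<eta> * (2 * R))\<^sup>2"
        by (simp only: norm_mult norm_of_real)
    qed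
    then show ?thesis by simp
  qed
  moreover have "norm (P - q * L) \<le> norm q / 4 * L"
  proof -
    have "P = (\<Sum>i\<in>I. a i * (LBINT z. complex_of_real (indicator A z * p i z * ?t z)))"
      unfolding P_def by (simp only: integral_complex_of_real)
    also have "\<dots> = (LBINT z. \<Sum>i\<in>I. a i * complex_of_real (indicator A z * p i z * ?t z))"
      using ip by (intro integral_lincomb[symmetric]) (auto simp only: complex_of_real_integrable_eq)
    finally have P: "P = (LBINT z. \<Sum>i\<in>I. a i * complex_of_real (indicator A z * p i z * ?t z))" .
    have "q * L = q * (LBINT z. complex_of_real (indicator A z * ?t z))"
      unfolding L_def by (simp only: integral_complex_of_real)
    also have "\<dots> = (LBINT z. q * complex_of_real (indicator A z * ?t z))"
      by (rule integral_mult_right_zero[symmetric])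
    finally have qL: "q * L = (LBINT z. q * complex_of_real (indicator A z * ?t z))" .
    have i1: "integrable lborel (\<lambda>z. \<Sum>i\<in>I. a i * complex_of_real (indicator A z * p i z * ?t z))"
      using ip by (intro Bochner_Integration.integrable_sum integrable_mult_right) (auto simp only: complex_of_real_integrable_eq)
    have i2: "integrable lborel (\<lambda>z. q * complex_of_real (indicator A z * ?t z))"
      using tA by (intro integrable_mult_right) (auto simp only: complex_of_real_integrable_eq)
    have "norm (P - q * L) = norm (LBINT z. (\<Sum>i\<in>I. a i * complex_of_real (indicator A z * p i z * ?t z)) - q * complex_of_real (indicator A z * ?t z))"
      unfolding P qL by (simp only: Bochner_Integration.integral_diff[OF i1 i2])
    also have "\<dots> \<le> (LBINT z. norm q / 4 * (indicator A z * ?t z))"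
    proof (rule Bochner_Integration.integral_norm_bound_integral)
      show "integrable lborel (\<lambda>z. (\<Sum>i\<in>I. a i * complex_of_real (indicator A z * p i z * ?t z)) - q * complex_of_real (indicator A z * ?t z))"
        by (rule Bochner_Integration.integrable_diff[OF i1 i2])
      show "integrable lborel (\<lambda>z. norm q / 4 * (indicator A z * ?t z))" by (rule integrable_mult_right[OF tA])
      fix z
      have "(\<Sum>i\<in>I. a i * complex_of_real (indicator A z * p i z * ?t z)) - q * complex_of_real (indicator A z * ?t z)
         = ((\<Sum>i\<in>I. a i * p i z) - q) * complex_of_real (indicator A z * ?t z)"
        by (subst left_diff_distrib, subst sum_distrib_right) (simp add: mult_ac)
      then have "norm ((\<Sum>i\<in>I. a i * complex_of_real (indicator A z * p i z * ?t z)) - q * complex_of_real (indicator A z * ?t z))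
         = norm ((\<Sum>i\<in>I. a i * p i z) - q) * (indicator A z * ?t z)"
        by (simp only: norm_mult norm_of_real) (simp add: tent_nonneg)
      also have "\<dots> \<le> norm q / 4 * (indicator A z * ?t z)"
      proof (cases "z \<in> A")
        case True
        then show ?thesis using q[of z] tent_nonneg[of R "z - c"] by (intro mult_right_mono) auto
      qed simp
      finally show "norm ((\<Sum>i\<in>I. a i * complex_of_real (indicator A z * p i z * ?t z)) - q * complex_of_real (indicator A z * ?t z))
         \<le> norm q / 4 * (indicator A z * ?t z)" .
    qed
    also have "\<dots> = norm q / 4 * L" unfolding L_def by (rule integral_mult_right_zero)
    finally show ?thesis .
  qed
  moreover have "L \<ge> pi * R ^ 3 / 8 - R * (\<eta> * (2 * R))\<^sup>2"
  proof -
    have tA': "integrable lborel (\<lambda>z. indicator (- A) z * ?t z)"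
      using tl by (rule Bochner_Integration.integrable_bound) (auto split: split_indicator)
    have "(LBINT z. ?t z) = (LBINT z. indicator A z * ?t z + indicator (- A) z * ?t z)"
      by (intro Bochner_Integration.integral_cong) (auto split: split_indicator)
    also have "\<dots> = L + (LBINT z. indicator (- A) z * ?t z)"
      unfolding L_def by (rule Bochner_Integration.integral_add[OF tA tA'])
    also have "\<dots> \<le> L + R * (\<eta> * (2 * R))\<^sup>2" using small by (intro add_left_mono off) auto
    finally show ?thesis using integral_tent_ge[OF R, of c] by simp
  qed
  moreover have "norm (q * L) = norm q * L" using L0 by (simp add: norm_mult)
  moreover have "norm (q * L) \<le> norm (P + Q) + norm (P - q * L) + norm Q"
  proof -
    have "q * L = (P + Q) - (P - q * L) - Q" by simp
    then show ?thesis by (metis norm_triangle_ineq4 order_trans add_right_mono)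
  qed
  ultimately have *: "norm (\<Sum>i\<in>I. a i * (LINT \<zeta>|\<nu> i. ?t \<zeta>)) \<ge> 3 / 4 * norm q * L - card I * (R * (\<eta> * (2 * R))\<^sup>2)"
    and L: "L \<ge> pi * R ^ 3 / 8 - R * (\<eta> * (2 * R))\<^sup>2" by auto
  have "3 / 4 * norm q * (pi * R ^ 3 / 8 - R * (\<eta> * (2 * R))\<^sup>2) \<le> 3 / 4 * norm q * L"
    using L by (intro mult_left_mono) auto
  moreover have "3 / 4 * norm q * (R * (\<eta> * (2 * R))\<^sup>2) \<le> norm q * (R * (\<eta> * (2 * R))\<^sup>2)"
    using R by (intro mult_right_mono) auto
  ultimately show ?thesis using * by (simp add: algebra_simps)
qed

end

section \<open>Contradiction between the two tent bounds at a density point\<close>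

context Cauchy_system begin

text \<open>At a density point \<open>c\<close> the two bounds for the tent pairing, divided by
  \<open>R ^ 3\<close>, leave \<open>3 / 32 * pi * norm q \<le> C * \<eta>\<close>. \<open>C\<close>
  depends on \<open>c\<close> through \<open>K\<close> but not on \<open>\<eta>\<close>, which may
  be arbitrarily small.\<close>

theorem null_set_of_zeros:
  assumes A [measurable]: "A \<in> sets borel" and AM: "A \<subseteq> ball 0 M"
    and int: "\<And>z i. z \<in> A \<Longrightarrow> i \<in> I \<Longrightarrow> integrable (\<nu> i) (\<lambda>\<zeta>. 1 / (\<zeta> - z))"
    and zero: "\<And>z. z \<in> A \<Longrightarrow> potential z = 0"
    and p [measurable]: "\<And>i. i \<in> I \<Longrightarrow> p i \<in> borel_measurable borel"
    and p0: "\<And>i z. i \<in> I \<Longrightarrow> z \<in> A \<Longrightarrow> 0 \<le> p i z \<and> p i z \<le> N"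
    and dens: "\<And>i. i \<in> I \<Longrightarrow> density (\<nu> i) (indicator A) = density lborel (\<lambda>z. ennreal (indicator A z * p i z))"
    and q: "\<And>z. z \<in> A \<Longrightarrow> norm ((\<Sum>i\<in>I. a i * p i z) - q) \<le> norm q / 4" and q0: "q \<noteq> 0"
  shows "emeasure lborel A = 0"
proof (rule ccontr)
  assume pos: "emeasure lborel A \<noteq> 0"
  \<comment> \<open>Restriction to the complement of \<open>A\<close> makes \<open>A\<close> a null
    set, as \<open>AE_small_on_balls\<close> requires; \<open>m\<close> is cut off to a disc in
    order to be finite.\<close>
  define \<kappa> where "\<kappa> i = density (\<nu> i) (indicator (- A))" for i
  define m where "m = density lborel (indicator (ball (0::complex) M - A))"
  have em_\<kappa>: "emeasure (\<kappa> i) X = emeasure (\<nu> i) (X - A)" if [measurable]: "X \<in> sets borel" for i X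
    unfolding \<kappa>_def by (subst emeasure_density) (auto simp: nn_integral_indicator[symmetric] simp del: nn_integral_indicator intro!: nn_integral_cong split: split_indicator)
  have em_m: "emeasure m X = emeasure lborel (X \<inter> (ball 0 M - A))" if [measurable]: "X \<in> sets borel" for X
    unfolding m_def by (subst emeasure_density) (auto simp: nn_integral_indicator[symmetric] simp del: nn_integral_indicator intro!: nn_integral_cong split: split_indicator)
  have fin_\<kappa>: "finite_measure (\<kappa> i)" for i
  proof -
    interpret finite_measure "\<nu> i" by (rule fin)
    have "space (\<nu> i) = UNIV" using sets_eq_imp_space_eq[OF sets_\<nu>[of i]] by simp
    then show ?thesis using em_\<kappa>[of UNIV i] by (intro finite_measureI) (simp add: \<kappa>_def emeasure_eq_measure)
  qed
  have fin_m: "finite_measure m"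
  proof (rule finite_measureI)
    have "emeasure lborel (ball 0 M - A) \<le> emeasure lborel (ball (0::complex) M)" by (intro emeasure_mono) auto
    also have "\<dots> < \<infinity>" using emeasure_lborel_ball_finite by auto
    finally show "emeasure m (space m) \<noteq> \<infinity>" using em_m[of UNIV] by (simp add: m_def)
  qed
  let ?small = "\<lambda>\<tau> z. \<forall>e>0. \<exists>d>0. \<forall>r. 0 < r \<longrightarrow> r < d \<longrightarrow> measure \<tau> (ball z r) \<le> e * r\<^sup>2"
  have "AE z in lborel. \<forall>i\<in>I. z \<in> A \<longrightarrow> ?small (\<kappa> i) z"
    by (intro AE_finite_allI finite_I AE_small_on_balls fin_\<kappa>) (auto simp: em_\<kappa> \<kappa>_def[THEN arg_cong[where f=sets]])
  moreover have "AE z in lborel. z \<in> A \<longrightarrow> ?small m z"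
    by (intro AE_small_on_balls fin_m) (auto simp: em_m m_def[THEN arg_cong[where f=sets]])
  ultimately have ae: "AE z in lborel. z \<in> A \<longrightarrow> (\<forall>i\<in>I. ?small (\<kappa> i) z) \<and> ?small m z"
    by eventually_elim blast
  have "\<exists>c\<in>A. (\<forall>i\<in>I. ?small (\<kappa> i) c) \<and> ?small m c"
  proof (rule ccontr)
    assume no: "\<not> ?thesis"
    from ae have "AE z in lborel. z \<notin> A" by (rule eventually_mono) (use no in blast)
    then have "A \<in> null_sets lborel" using AE_iff_null_sets[of A lborel] by simp
    then show False using pos by auto
  qed
  then obtain c where c: "c \<in> A" "\<And>i. i \<in> I \<Longrightarrow> ?small (\<kappa> i) c" "?small m c" by blast
  \<comment> \<open>Balls about \<open>c\<close> of radius below \<open>\<epsilon>0\<close> do not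
    see the cut-off of \<open>m\<close>.\<close>
  obtain \<epsilon>0 where \<epsilon>0: "\<epsilon>0 > 0" "ball c \<epsilon>0 \<subseteq> ball 0 M"
    using c(1) AM openE[OF open_ball, of c 0 M] by blast
  have small: "\<exists>d>0. \<forall>r. 0 < r \<longrightarrow> r < d \<longrightarrow> (\<forall>i\<in>I. measure (\<nu> i) (ball c r - A) \<le> e * r\<^sup>2) \<and> emeasure lborel (ball c r - A) \<le> ennreal (e * r\<^sup>2)"
    if e: "e > 0" for e
  proof -
    have "\<forall>i\<in>I. \<exists>d>0. \<forall>r. 0 < r \<longrightarrow> r < d \<longrightarrow> measure (\<kappa> i) (ball c r) \<le> e * r\<^sup>2" using c(2) e by blast
    from bchoice[OF this] obtain d where d: "\<And>i. i \<in> I \<Longrightarrow> d i > 0"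
      "\<And>i r. i \<in> I \<Longrightarrow> 0 < r \<Longrightarrow> r < d i \<Longrightarrow> measure (\<kappa> i) (ball c r) \<le> e * r\<^sup>2" by auto
    obtain d' where d': "d' > 0" "\<And>r. 0 < r \<Longrightarrow> r < d' \<Longrightarrow> measure m (ball c r) \<le> e * r\<^sup>2" using c(3) e by blast
    define D where "D = Min (insert \<epsilon>0 (insert d' (d ` I)))"
    have D: "D > 0" unfolding D_def using finite_I d(1) d'(1) \<epsilon>0(1) by (subst Min_gr_iff) auto
    have Dle: "D \<le> \<epsilon>0" "D \<le> d'" "\<And>i. i \<in> I \<Longrightarrow> D \<le> d i" unfolding D_def by (intro Min_le; use finite_I in simp)+
    have "(\<forall>i\<in>I. measure (\<nu> i) (ball c r - A) \<le> e * r\<^sup>2) \<and> emeasure lborel (ball c r - A) \<le> ennreal (e * r\<^sup>2)"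
      if r: "0 < r" "r < D" for r
    proof
      show "\<forall>i\<in>I. measure (\<nu> i) (ball c r - A) \<le> e * r\<^sup>2"
      proof
        fix i assume i: "i \<in> I"
        have "measure (\<nu> i) (ball c r - A) = measure (\<kappa> i) (ball c r)" by (simp add: measure_def em_\<kappa>)
        also have "\<dots> \<le> e * r\<^sup>2" using d(2)[OF i r(1)] Dle(3)[OF i] r by simp
        finally show "measure (\<nu> i) (ball c r - A) \<le> e * r\<^sup>2" .
      qed
      interpret m: finite_measure m by (rule fin_m)
      have "ball c r \<subseteq> ball c \<epsilon>0" using r Dle by (intro subset_ball) auto
      then have "ball c r - A = ball c r \<inter> (ball 0 M - A)" using \<epsilon>0(2) by blast
      then have "emeasure lborel (ball c r - A) = emeasure m (ball c r)" by (simp add: em_m)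
      also have "\<dots> \<le> ennreal (e * r\<^sup>2)" using d'(2)[OF r(1)] Dle r by (simp add: m.emeasure_eq_measure ennreal_leI)
      finally show "emeasure lborel (ball c r - A) \<le> ennreal (e * r\<^sup>2)" .
    qed
    then show ?thesis using D by blast
  qed
  have "\<exists>K\<ge>0. \<forall>i\<in>I. \<forall>r>0. measure (\<nu> i) (ball c r) \<le> K * r\<^sup>2"
  proof -
    obtain d where d: "d > 0" "\<And>r i. 0 < r \<Longrightarrow> r < d \<Longrightarrow> i \<in> I \<Longrightarrow> measure (\<nu> i) (ball c r - A) \<le> 1 * r\<^sup>2"
      using small[of 1] by auto
    define S where "S = (\<Sum>i\<in>I. measure (\<nu> i) UNIV)"
    define N' where "N' = max 0 N"
    \<comment> \<open>For \<open>r < d\<close> the density on \<open>A\<close> is at most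
      \<open>N'\<close> and the mass off \<open>A\<close> at most \<open>r\<^sup>2\<close>; for
      \<open>r \<ge> d\<close> the total mass is at most
      \<open>S / d\<^sup>2 * r\<^sup>2\<close>.\<close>
    define K where "K = N' * pi + 1 + S / d\<^sup>2"
    have S0: "S \<ge> 0" by (simp add: S_def sum_nonneg)
    have K0: "K \<ge> 0" using S0 by (simp add: K_def N'_def)
    have "measure (\<nu> i) (ball c r) \<le> K * r\<^sup>2" if i: "i \<in> I" and r: "r > 0" for i r
    proof -
      interpret finite_measure "\<nu> i" by (rule fin)
      show ?thesis
      proof (cases "r < d")
        case True
        have "emeasure (\<nu> i) (ball c r \<inter> A) = emeasure (density (\<nu> i) (indicator A)) (ball c r)"
          by (subst emeasure_density) (auto simp: nn_integral_indicator[symmetric] simp del: nn_integral_indicator intro!: nn_integral_cong split: split_indicator)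
        also have "\<dots> = (\<integral>\<^sup>+z. ennreal (indicator A z * p i z) * indicator (ball c r) z \<partial>lborel)"
          using p[OF i] unfolding dens[OF i] by (subst emeasure_density) auto
        also have "\<dots> \<le> (\<integral>\<^sup>+z. ennreal N' * indicator (ball c r) z \<partial>lborel)"
          using p0[OF i] by (intro nn_integral_mono) (auto simp: N'_def le_max_iff_disj intro!: ennreal_leI split: split_indicator)
        also have "\<dots> = ennreal (N' * (pi * r\<^sup>2))"
          using r by (subst nn_integral_cmult_indicator) (auto simp: emeasure_ball_complex ennreal_mult' N'_def)
        finally have "measure (\<nu> i) (ball c r \<inter> A) \<le> N' * (pi * r\<^sup>2)"
          by (simp add: emeasure_eq_measure N'_def)
        moreover have "measure (\<nu> i) (ball c r) = measure (\<nu> i) (ball c r \<inter> A) + measure (\<nu> i) (ball c r - A)"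
          by (subst finite_measure_Union[symmetric]) (auto simp: Int_Diff_Un)
        moreover have "0 \<le> S / d\<^sup>2 * r\<^sup>2" using S0 by simp
        ultimately show ?thesis using d(2)[OF r True i] by (simp add: K_def distrib_right)
      next
        case False
        have "measure (\<nu> i) (ball c r) \<le> measure (\<nu> i) UNIV" by (intro finite_measure_mono) auto
        also have "\<dots> \<le> S" unfolding S_def using i finite_I by (intro member_le_sum) auto
        also have "\<dots> = S / d\<^sup>2 * d\<^sup>2" using d(1) by simp
        also have "\<dots> \<le> S / d\<^sup>2 * r\<^sup>2" using False d(1) S0 by (intro mult_left_mono power_mono) auto
        also have "\<dots> \<le> K * r\<^sup>2" by (intro mult_right_mono) (auto simp: K_def N'_def)
        finally show ?thesis .
      qed
    qed
    then show ?thesis using K0 by blast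
  qed
  then obtain K where K: "K \<ge> 0" "\<And>i r. i \<in> I \<Longrightarrow> r > 0 \<Longrightarrow> measure (\<nu> i) (ball c r) \<le> K * r\<^sup>2" by blast
  define C where "C = 32 * potential_bound K + 4 * (card I + norm q)"
  have pb: "potential_bound K \<ge> 0" using K(1) by (simp add: potential_bound_def)
  have le: "3 / 32 * pi * norm q \<le> C * \<eta>" if \<eta>: "0 < \<eta>" "\<eta> \<le> 1 / 4" for \<eta>
  proof -
    obtain d where d: "d > 0" and dd: "\<And>r. 0 < r \<Longrightarrow> r < d \<Longrightarrow>
        (\<forall>i\<in>I. measure (\<nu> i) (ball c r - A) \<le> \<eta>\<^sup>2 * r\<^sup>2) \<and> emeasure lborel (ball c r - A) \<le> ennreal (\<eta>\<^sup>2 * r\<^sup>2)"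
      using small[of "\<eta>\<^sup>2"] \<eta> by auto
    define R where "R = d / 4"
    have R: "R > 0" using d by (simp add: R_def)
    have R2: "2 * R < d" using d by (simp add: R_def)
    have sm: "\<And>i. i \<in> I \<Longrightarrow> measure (\<nu> i) (ball c (2 * R) - A) \<le> (\<eta> * (2 * R))\<^sup>2"
      "emeasure lborel (ball c (2 * R) - A) \<le> ennreal ((\<eta> * (2 * R))\<^sup>2)"
      using dd[of "2 * R"] R R2 by (auto simp: power_mult_distrib)
    have "3 / 4 * norm q * (pi * R ^ 3 / 8) - (card I + norm q) * (R * (\<eta> * (2 * R))\<^sup>2) \<le> 32 * potential_bound K * \<eta> * R ^ 3"
      using tent_pairing_near_constant[OF R \<eta>(1) A p p0 dens q sm]
        norm_tent_pairing_le[OF K(2,1) R \<eta> A int zero sm(2)] by linarith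
    moreover have "(card I + norm q) * (R * (\<eta> * (2 * R))\<^sup>2) \<le> 4 * (card I + norm q) * \<eta> * R ^ 3"
    proof -
      have "\<eta> * \<eta> \<le> \<eta>" using \<eta> by (simp add: mult_left_le_one_le)
      then have "(4 * (card I + norm q) * R ^ 3) * (\<eta> * \<eta>) \<le> (4 * (card I + norm q) * R ^ 3) * \<eta>"
        using R by (intro mult_left_mono) auto
      then show ?thesis by (simp add: power2_eq_square power3_eq_cube mult_ac)
    qed
    ultimately have "(3 / 32 * pi * norm q) * R ^ 3 \<le> (C * \<eta>) * R ^ 3"
      unfolding C_def by (simp add: algebra_simps)
    then show ?thesis using R by (subst (asm) mult_le_cancel_right_pos) auto
  qed
  have C0: "C > 0" using pb q0 by (simp add: C_def add_nonneg_pos)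
  \<comment> \<open>The second entry makes \<open>C * \<eta>\<close> at most half of
    \<open>3 / 32 * pi * norm q\<close>.\<close>
  define \<eta> where "\<eta> = min (1 / 4) (3 / 32 * pi * norm q / (2 * C))"
  have "C * \<eta> \<le> C * (3 / 32 * pi * norm q / (2 * C))" using C0 by (intro mult_left_mono) (auto simp: \<eta>_def)
  also have "\<dots> = 3 / 32 * pi * norm q / 2" using C0 by simp
  also have "\<dots> < 3 / 32 * pi * norm q" using q0 by simp
  finally have "C * \<eta> < 3 / 32 * pi * norm q" .
  moreover have "0 < \<eta>" using C0 q0 by (simp add: \<eta>_def)
  moreover have "\<eta> \<le> 1 / 4" unfolding \<eta>_def by (rule min.cobounded1)
  ultimately show False using le[of \<eta>] by linarith
qed

end

section \<open>Principal values\<close>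

text \<open>The positive and negative parts of the real and imaginary parts, ordered such that
  \<open>\<mu>\<close> is the sum of \<open>\<i> ^ k\<close> times the \<open>k\<close>-th measure over \<open>k < 4\<close>.\<close>

definition jordan_rotated :: "(complex set \<Rightarrow> complex) \<Rightarrow> nat \<Rightarrow> complex measure" where
  "jordan_rotated \<mu> k = jordan_pos borel (\<lambda>A. Re ((-\<i>) ^ k * \<mu> A))"

lemma signed_additive_Re_mult:
  assumes "complex_measure M \<mu>" shows "signed_additive M (\<lambda>A. Re (w * \<mu> A))"
  unfolding signed_additive_def
proof (intro allI impI)
  fix A :: "nat \<Rightarrow> 'a set" assume "range A \<subseteq> sets M" "disjoint_family A"
  then have "(\<lambda>n. \<mu> (A n)) sums \<mu> (\<Union>n. A n)" using assms unfolding complex_measure_def by blast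
  then have "(\<lambda>n. w * \<mu> (A n)) sums (w * \<mu> (\<Union>n. A n))" by (rule sums_mult)
  then show "(\<lambda>n. Re (w * \<mu> (A n))) sums Re (w * \<mu> (\<Union>n. A n))" by (rule sums_Re)
qed

lemma sets_jordan_rotated [simp, measurable_cong]: "sets (jordan_rotated \<mu> k) = sets borel"
  by (simp add: jordan_rotated_def)

lemma finite_jordan_rotated: "complex_measure borel \<mu> \<Longrightarrow> finite_measure (jordan_rotated \<mu> k)"
  unfolding jordan_rotated_def by (intro finite_measure_jordan_pos signed_additive_Re_mult)

lemma complex_measure_integral_eq_sum:
  "complex_measure_integral borel \<mu> f = (\<Sum>k<4. \<i> ^ k * integral\<^sup>L (jordan_rotated \<mu> k) f)"
  by (simp add: complex_measure_integral_def signed_integral_def jordan_rotated_def eval_nat_numeral algebra_simps)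

lemma complex_measure_eq_sum:
  assumes \<mu>: "complex_measure borel \<mu>" and A: "A \<in> sets borel"
  shows "\<mu> A = (\<Sum>k<4. \<i> ^ k * measure (jordan_rotated \<mu> k) A)"
proof -
  \<comment> \<open>\<open>Re (- \<i> * w)\<close> is \<open>Im w\<close>, so the indices 0 and 2
    belong to the real part, 1 and 3 to the imaginary part. The products are left as they stand to
    match \<open>signed_additive_Re_mult\<close>.\<close>
  have j: "jordan_rotated \<mu> 0 = jordan_pos borel (\<lambda>A. Re (1 * \<mu> A))"
    "jordan_rotated \<mu> 1 = jordan_pos borel (\<lambda>A. Re (- \<i> * \<mu> A))"
    "jordan_rotated \<mu> 2 = jordan_pos borel (\<lambda>A. - Re (1 * \<mu> A))"
    "jordan_rotated \<mu> 3 = jordan_pos borel (\<lambda>A. - Re (- \<i> * \<mu> A))"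
    by (simp_all add: jordan_rotated_def power3_eq_cube)
  have 1: "measure (jordan_rotated \<mu> 0) A - measure (jordan_rotated \<mu> 2) A = Re (\<mu> A)"
    using measure_jordan_pos_diff[OF signed_additive_Re_mult[OF \<mu>, where w=1] A] unfolding j by (simp only: mult_1)
  have "measure (jordan_rotated \<mu> 1) A - measure (jordan_rotated \<mu> 3) A = Re (- \<i> * \<mu> A)"
    unfolding j by (rule measure_jordan_pos_diff[OF signed_additive_Re_mult[OF \<mu>] A])
  then have 2: "measure (jordan_rotated \<mu> 1) A - measure (jordan_rotated \<mu> 3) A = Im (\<mu> A)"
    by simp
  have "(\<Sum>k<4. \<i> ^ k * complex_of_real (m k)) = Complex (m 0 - m 2) (m 1 - m 3)" for m :: "nat \<Rightarrow> real"
    by (simp add: complex_eq_iff eval_nat_numeral)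
  from this[of "\<lambda>k. measure (jordan_rotated \<mu> k) A"] show ?thesis using 1 2 by simp
qed

lemma complex_measure_Un:
  assumes \<mu>: "complex_measure M \<mu>" and "A \<in> sets M" "B \<in> sets M" "A \<inter> B = {}"
  shows "\<mu> (A \<union> B) = \<mu> A + \<mu> B"
  using signed_additive_Un[OF signed_additive_Re_mult[OF \<mu>, of 1] assms(2-)]
    signed_additive_Un[OF signed_additive_Re_mult[OF \<mu>, of "-\<i>"] assms(2-)]
  by (simp add: complex_eq_iff)

context
  fixes \<mu> :: "complex set \<Rightarrow> complex"
  assumes \<mu>: "complex_measure borel \<mu>"
begin

interpretation Cauchy_system "{..<4::nat}" "\<lambda>k. \<i> ^ k" "jordan_rotated \<mu>"
  by (rule Cauchy_system.intro) (simp_all add: norm_power finite_jordan_rotated[OF \<mu>])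

lemma truncated_cauchy_eq_sum:
  "truncated_cauchy \<mu> e z = (\<Sum>k<4. \<i> ^ k * (LINT \<zeta>|jordan_rotated \<mu> k. indicator {\<zeta>. norm (\<zeta> - z) > e} \<zeta> * (1 / (\<zeta> - z))))"
  unfolding truncated_cauchy_def by (rule complex_measure_integral_eq_sum)

lemma truncated_cauchy_borel [measurable]: "truncated_cauchy \<mu> e \<in> borel_measurable borel"
proof -
  have "(\<lambda>z. LINT \<zeta>|jordan_rotated \<mu> k. indicator {\<zeta>. norm (\<zeta> - z) > e} \<zeta> * (1 / (\<zeta> - z))) \<in> borel_measurable borel" for k
  proof -
    interpret finite_measure "jordan_rotated \<mu> k" by (rule finite_jordan_rotated[OF \<mu>])
    have [measurable]: "Measurable.pred (borel \<Otimes>\<^sub>M borel) (\<lambda>(z, \<zeta> :: complex). e < norm (\<zeta> - z))"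
      by measurable
    show ?thesis unfolding indicator_def mem_Collect_eq of_bool_def by measurable
  qed
  then show ?thesis unfolding truncated_cauchy_eq_sum by measurable
qed

text \<open>The strict inequality in the truncation is what makes right limits work: as the radii
  decrease to \<open>e\<close>, their truncation sets exhaust that of \<open>e\<close>, and
  \<open>1 / e\<close> dominates.\<close>

lemma truncated_cauchy_right_limit:
  assumes e: "e > 0" and r: "\<And>n. e < r n" "r \<longlonglongrightarrow> e"
  shows "(\<lambda>n. truncated_cauchy \<mu> (r n) z) \<longlonglongrightarrow> truncated_cauchy \<mu> e z"
  unfolding truncated_cauchy_eq_sum
proof (intro tendsto_sum tendsto_mult tendsto_const)
  fix k
  interpret finite_measure "jordan_rotated \<mu> k" by (rule finite_jordan_rotated[OF \<mu>])
  show "(\<lambda>n. LINT \<zeta>|jordan_rotated \<mu> k. indicator {\<zeta>. norm (\<zeta> - z) > r n} \<zeta> * (1 / (\<zeta> - z)))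
    \<longlonglongrightarrow> (LINT \<zeta>|jordan_rotated \<mu> k. indicator {\<zeta>. norm (\<zeta> - z) > e} \<zeta> * (1 / (\<zeta> - z)))"
  proof (rule integral_dominated_convergence[where w="\<lambda>_. 1 / e"])
    show "AE \<zeta> in jordan_rotated \<mu> k. (\<lambda>n. indicator {\<zeta>. norm (\<zeta> - z) > r n} \<zeta> * (1 / (\<zeta> - z)))
        \<longlonglongrightarrow> indicator {\<zeta>. norm (\<zeta> - z) > e} \<zeta> * (1 / (\<zeta> - z))"
    proof (rule AE_I2)
      fix \<zeta>
      have "eventually (\<lambda>n. indicator {\<zeta>. norm (\<zeta> - z) > r n} \<zeta> = (indicator {\<zeta>. norm (\<zeta> - z) > e} \<zeta> :: complex)) sequentially"
      proof (cases "norm (\<zeta> - z) > e")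
        case True
        then have "eventually (\<lambda>n. r n < norm (\<zeta> - z)) sequentially" using r(2) by (rule order_tendstoD(2)[rotated])
        then show ?thesis by eventually_elim (use True in simp)
      next
        case False
        then have "\<not> r n < norm (\<zeta> - z)" for n using r(1)[of n] by auto
        then show ?thesis using False by simp
      qed
      then have "eventually (\<lambda>n. indicator {\<zeta>. norm (\<zeta> - z) > r n} \<zeta> * (1 / (\<zeta> - z)) = indicator {\<zeta>. norm (\<zeta> - z) > e} \<zeta> * (1 / (\<zeta> - z))) sequentially"
        by eventually_elim simp
      then show "(\<lambda>n. indicator {\<zeta>. norm (\<zeta> - z) > r n} \<zeta> * (1 / (\<zeta> - z)))
        \<longlonglongrightarrow> indicator {\<zeta>. norm (\<zeta> - z) > e} \<zeta> * (1 / (\<zeta> - z))" by (rule tendsto_eventually)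
    qed
    show "AE \<zeta> in jordan_rotated \<mu> k. norm (indicator {\<zeta>. norm (\<zeta> - z) > r n} \<zeta> * (1 / (\<zeta> - z))) \<le> 1 / e" for n
    proof (rule AE_I2)
      fix \<zeta>
      show "norm (indicator {\<zeta>. norm (\<zeta> - z) > r n} \<zeta> * (1 / (\<zeta> - z))) \<le> 1 / e"
      proof (cases "norm (\<zeta> - z) > r n")
        case True
        then have "norm (\<zeta> - z) > e" using r(1)[of n] by linarith
        then show ?thesis using True e by (auto simp: norm_divide intro!: divide_left_mono mult_pos_pos)
      qed (use e in simp)
    qed
  qed auto
qed

text \<open>An integrable kernel dominates its own truncations.\<close>

lemma truncated_cauchy_tendsto_potential:
  assumes "\<And>k. k < 4 \<Longrightarrow> integrable (jordan_rotated \<mu> k) (\<lambda>\<zeta>. 1 / (\<zeta> - z))"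
  shows "(\<lambda>n. truncated_cauchy \<mu> (1 / Suc n) z) \<longlonglongrightarrow> potential z"
  unfolding truncated_cauchy_eq_sum potential_def
proof (intro tendsto_sum tendsto_mult tendsto_const)
  fix k :: nat assume "k \<in> {..<4}"
  then have i: "integrable (jordan_rotated \<mu> k) (\<lambda>\<zeta>. 1 / (\<zeta> - z))" using assms by simp
  show "(\<lambda>n. LINT \<zeta>|jordan_rotated \<mu> k. indicator {\<zeta>. norm (\<zeta> - z) > 1 / Suc n} \<zeta> * (1 / (\<zeta> - z)))
    \<longlonglongrightarrow> (LINT \<zeta>|jordan_rotated \<mu> k. 1 / (\<zeta> - z))"
  proof (rule integral_dominated_convergence[where w="\<lambda>\<zeta>. norm (1 / (\<zeta> - z))"])
    show "integrable (jordan_rotated \<mu> k) (\<lambda>\<zeta>. norm (1 / (\<zeta> - z)))" using i by (rule integrable_norm)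
    show "AE \<zeta> in jordan_rotated \<mu> k. (\<lambda>n. indicator {\<zeta>. norm (\<zeta> - z) > 1 / Suc n} \<zeta> * (1 / (\<zeta> - z))) \<longlonglongrightarrow> 1 / (\<zeta> - z)"
    proof (rule AE_I2)
      fix \<zeta>
      show "(\<lambda>n. indicator {\<zeta>. norm (\<zeta> - z) > 1 / Suc n} \<zeta> * (1 / (\<zeta> - z))) \<longlonglongrightarrow> 1 / (\<zeta> - z)"
      \<comment> \<open>At \<open>\<zeta> = z\<close> both sides are 0 because
        \<open>1 / 0 = 0\<close>: a point mass at \<open>z\<close> is invisible to the potential and
        to the truncations alike.\<close>
      proof (cases "\<zeta> = z")
        case False
        then have "eventually (\<lambda>n. 1 / real (Suc n) < norm (\<zeta> - z)) sequentially"
          by (intro order_tendstoD(2)[OF LIMSEQ_Suc[OF lim_1_over_n]]) auto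
        then have "eventually (\<lambda>n. indicator {\<zeta>. norm (\<zeta> - z) > 1 / Suc n} \<zeta> * (1 / (\<zeta> - z)) = 1 / (\<zeta> - z)) sequentially"
          by eventually_elim simp
        then show ?thesis by (rule tendsto_eventually)
      qed simp
    qed
    show "AE \<zeta> in jordan_rotated \<mu> k. norm (indicator {\<zeta>. norm (\<zeta> - z) > 1 / Suc n} \<zeta> * (1 / (\<zeta> - z))) \<le> norm (1 / (\<zeta> - z))" for n
      by (rule AE_I2) (auto split: split_indicator)
  qed auto
qed

lemma cauchy_pv_zero_iff:
  "cauchy_pv_exists \<mu> z \<and> cauchy_pv \<mu> z = 0 \<longleftrightarrow> ((\<lambda>e. truncated_cauchy \<mu> e z) \<longlongrightarrow> 0) (at_right 0)"
  unfolding cauchy_pv_exists_def cauchy_pv_def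
  using tendsto_Lim[OF trivial_limit_at_right_real, of "\<lambda>e. truncated_cauchy \<mu> e z"] by metis

text \<open>By right-continuity in the truncation radius, rational radii suffice.\<close>

lemma cauchy_pv_zero_iff_rational:
  "cauchy_pv_exists \<mu> z \<and> cauchy_pv \<mu> z = 0 \<longleftrightarrow>
    (\<forall>m. \<exists>n. \<forall>x::rat. 0 < real_of_rat x \<and> real_of_rat x < 1 / Suc n \<longrightarrow> norm (truncated_cauchy \<mu> (real_of_rat x) z) \<le> 1 / Suc m)"
  unfolding cauchy_pv_zero_iff
proof safe
  fix m :: nat
  assume "((\<lambda>e. truncated_cauchy \<mu> e z) \<longlongrightarrow> 0) (at_right 0)"
  then have "eventually (\<lambda>e. dist (truncated_cauchy \<mu> e z) 0 < 1 / Suc m) (at_right 0)"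
    by (rule tendstoD) simp
  then obtain b where b: "b > 0" "\<And>e. 0 < e \<Longrightarrow> e < b \<Longrightarrow> norm (truncated_cauchy \<mu> e z) < 1 / Suc m"
    unfolding eventually_at_right_field by auto
  obtain n :: nat where "1 / Suc n < b" using nat_approx_posE[OF b(1)] .
  then show "\<exists>n. \<forall>x::rat. 0 < real_of_rat x \<and> real_of_rat x < 1 / Suc n \<longrightarrow> norm (truncated_cauchy \<mu> (real_of_rat x) z) \<le> 1 / Suc m"
    by (intro exI[of _ n] allI impI less_imp_le b(2)) auto
next
  assume H: "\<forall>m. \<exists>n. \<forall>x::rat. 0 < real_of_rat x \<and> real_of_rat x < 1 / Suc n \<longrightarrow> norm (truncated_cauchy \<mu> (real_of_rat x) z) \<le> 1 / Suc m"
  show "((\<lambda>e. truncated_cauchy \<mu> e z) \<longlongrightarrow> 0) (at_right 0)"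
  proof (rule tendstoI)
    fix d :: real assume "d > 0"
    then obtain m :: nat where m: "1 / Suc m < d" by (rule nat_approx_posE)
    obtain n where n: "\<And>x::rat. 0 < real_of_rat x \<Longrightarrow> real_of_rat x < 1 / Suc n \<Longrightarrow> norm (truncated_cauchy \<mu> (real_of_rat x) z) \<le> 1 / Suc m"
      using H by blast
    have "norm (truncated_cauchy \<mu> e z) \<le> 1 / Suc m" if e: "0 < e" "e < 1 / Suc n" for e
    proof -
      \<comment> \<open>\<open>u\<close> descends from \<open>1 / Suc n\<close> to \<open>e\<close>.
        Rationals squeezed between \<open>e\<close> and \<open>u j\<close> stay below
        \<open>1 / Suc n\<close> and approach \<open>e\<close> from the right, and the non-strict
        bound passes to the limit.\<close>
      define u where "u j = e + (1 / Suc n - e) / Suc j" for j :: nat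
      have "\<exists>x. e < real_of_rat x \<and> real_of_rat x < u j" for j
        using of_rat_dense[of e "u j"] e by (simp add: u_def)
      then obtain x where x: "\<And>j. e < real_of_rat (x j)" "\<And>j. real_of_rat (x j) < u j" by metis
      have "(\<lambda>j. (1 / Suc n - e) * (1 / real (Suc j))) \<longlonglongrightarrow> (1 / Suc n - e) * 0"
        by (intro tendsto_mult tendsto_const LIMSEQ_Suc[OF lim_1_over_n])
      then have "u \<longlonglongrightarrow> e + (1 / Suc n - e) * 0"
        unfolding u_def by (intro tendsto_add tendsto_const) simp
      then have u: "u \<longlonglongrightarrow> e" by simp
      have "(\<lambda>j. real_of_rat (x j)) \<longlonglongrightarrow> e"
      proof (rule tendsto_sandwich[OF _ _ tendsto_const u])
        show "eventually (\<lambda>j. e \<le> real_of_rat (x j)) sequentially"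
          using x(1) by (intro always_eventually allI less_imp_le)
        show "eventually (\<lambda>j. real_of_rat (x j) \<le> u j) sequentially"
          using x(2) by (intro always_eventually allI less_imp_le)
      qed
      then have "(\<lambda>j. norm (truncated_cauchy \<mu> (real_of_rat (x j)) z)) \<longlonglongrightarrow> norm (truncated_cauchy \<mu> e z)"
        using x e by (intro tendsto_norm truncated_cauchy_right_limit) auto
      moreover have "norm (truncated_cauchy \<mu> (real_of_rat (x j)) z) \<le> 1 / Suc m" for j
      proof (rule n)
        show "0 < real_of_rat (x j)" using x(1)[of j] e by linarith
        have "(1 / Suc n - e) / Suc j \<le> 1 / Suc n - e" using e divide_left_mono[of 1 "real (Suc j)" "1 / Suc n - e"] by simp
        then have "u j \<le> 1 / Suc n" by (simp add: u_def)
        then show "real_of_rat (x j) < 1 / Suc n" using x(2)[of j] by linarith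
      qed
      ultimately show ?thesis by (intro LIMSEQ_le_const2) auto
    qed
    then have "\<forall>e>0. e < 1 / Suc n \<longrightarrow> dist (truncated_cauchy \<mu> e z) 0 < d" using m by fastforce
    then show "eventually (\<lambda>e. dist (truncated_cauchy \<mu> e z) 0 < d) (at_right 0)"
      unfolding eventually_at_right_field by (intro exI[of _ "1 / Suc n"]) auto
  qed
qed

text \<open>Only countable quantifiers over Borel conditions are left after the reduction to
  rational radii.\<close>

lemma cauchy_pv_zero_borel: "{z. cauchy_pv_exists \<mu> z \<and> cauchy_pv \<mu> z = 0} \<in> sets borel"
  unfolding cauchy_pv_zero_iff_rational by measurable

lemma cauchy_pv_zero_imp_potential_zero:
  assumes "cauchy_pv_exists \<mu> z" "cauchy_pv \<mu> z = 0"
    and "\<And>k. k < 4 \<Longrightarrow> integrable (jordan_rotated \<mu> k) (\<lambda>\<zeta>. 1 / (\<zeta> - z))"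
  shows "potential z = 0"
proof -
  have "((\<lambda>e. truncated_cauchy \<mu> e z) \<longlongrightarrow> 0) (at_right 0)" using assms cauchy_pv_zero_iff by blast
  moreover have "filterlim (\<lambda>n. 1 / real (Suc n)) (at_right 0) sequentially"
    unfolding filterlim_at by (intro conjI LIMSEQ_Suc[OF lim_1_over_n]) simp
  ultimately have "(\<lambda>n. truncated_cauchy \<mu> (1 / Suc n) z) \<longlonglongrightarrow> 0" by (rule filterlim_compose)
  then show ?thesis using truncated_cauchy_tendsto_potential[OF assms(3)] LIMSEQ_unique by blast
qed

end

section \<open>The absolutely continuous part\<close>

text \<open>A Jordan part is a supremum of charges of subsets, so it vanishes on null sets off
  \<open>S\<close> together with these charges; Radon-Nikodym then applies to each part.
  \<open>S\<close> is to carry the singular component.\<close>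

lemma jordan_rotated_density:
  assumes \<mu>: "complex_measure borel \<mu>" and S: "S \<in> null_sets lborel"
    and ac: "\<And>B. B \<in> null_sets lborel \<Longrightarrow> B \<inter> S = {} \<Longrightarrow> \<mu> B = 0"
  shows "\<exists>f\<in>borel_measurable borel. density (jordan_rotated \<mu> k) (indicator (- S)) = density lborel f"
proof -
  let ?M = "density (jordan_rotated \<mu> k) (indicator (- S))"
  have Sb [measurable]: "S \<in> sets borel" using S by auto
  have "absolutely_continuous lborel ?M"
    unfolding absolutely_continuous_def
  proof
    fix B :: "complex set" assume B: "B \<in> null_sets lborel"
    then have Bb [measurable]: "B \<in> sets borel" by auto
    have "\<mu> C = 0" if "C \<in> sets borel" "C \<subseteq> B - S" for C
      using that B by (intro ac null_sets_subset[of B lborel C]) auto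
    then have "emeasure (jordan_rotated \<mu> k) (B - S) = 0"
      unfolding jordan_rotated_def
      by (subst emeasure_jordan_pos[OF signed_additive_Re_mult[OF \<mu>]]) (auto intro!: antisym SUP_least)
    then have "B - S \<in> null_sets (jordan_rotated \<mu> k)" by (auto simp: null_sets_def)
    then have "AE z in jordan_rotated \<mu> k. z \<notin> B - S" by (rule AE_not_in)
    then show "B \<in> null_sets ?M"
      by (subst null_sets_density_iff) (auto elim!: eventually_mono split: split_indicator)
  qed
  then obtain f where "f \<in> borel_measurable lborel" "density lborel f = ?M"
    using sigma_finite_measure.Radon_Nikodym[OF sigma_finite_lborel, of ?M] by auto
  then show ?thesis by (intro bexI[of _ f]) auto
qed

text \<open>Off \<open>S\<close>, \<open>\<mu>\<close> and \<open>\<mu>\<^sub>a\<close> agree and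
  have the density \<open>g\<close>. Almost every point of \<open>B\<close> with
  \<open>g \<noteq> 0\<close> lies in one of countably many sets where \<open>g\<close> is close to
  a fixed nonzero \<open>q\<close>, and these are null by \<open>null_set_of_zeros\<close>.
  Arbitrary Borel subsets \<open>B\<close> of the zero set are treated because the variation runs
  over partitions.\<close>

theorem ac_part_zero_on_zeros:
  fixes \<mu> \<mu>\<^sub>a \<mu>\<^sub>s :: "complex set \<Rightarrow> complex"
  assumes \<mu>: "complex_measure borel \<mu>" and dec: "lebesgue_decomposition lborel \<mu> \<mu>\<^sub>a \<mu>\<^sub>s"
    and B: "B \<in> sets borel" "B \<subseteq> {z. cauchy_pv_exists \<mu> z \<and> cauchy_pv \<mu> z = 0}"
  shows "\<mu>\<^sub>a B = 0"
proof -
  let ?\<nu> = "jordan_rotated \<mu>" and ?a = "\<lambda>k::nat. \<i> ^ k"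
  interpret Cauchy_system "{..<4::nat}" ?a ?\<nu>
    by (rule Cauchy_system.intro) (simp_all add: norm_power finite_jordan_rotated[OF \<mu>])
  have \<mu>a: "complex_measure borel \<mu>\<^sub>a" and ac: "\<And>A. A \<in> null_sets lborel \<Longrightarrow> \<mu>\<^sub>a A = 0"
    and sum: "\<And>A. A \<in> sets borel \<Longrightarrow> \<mu> A = \<mu>\<^sub>a A + \<mu>\<^sub>s A"
    using dec unfolding lebesgue_decomposition_def complex_abs_continuous_def complex_measure_def by auto
  obtain S where S: "S \<in> null_sets lborel" and sing: "\<And>A. A \<in> sets borel \<Longrightarrow> A \<inter> S = {} \<Longrightarrow> \<mu>\<^sub>s A = 0"
    using dec unfolding lebesgue_decomposition_def complex_singular_def by auto
  have Sb [measurable]: "S \<in> sets borel" using S by auto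
  have \<mu>_off: "\<mu> A = \<mu>\<^sub>a A" if "A \<in> sets borel" "A \<inter> S = {}" for A
    using sum[OF that(1)] sing[OF that] by simp
  have "\<forall>k. \<exists>f\<in>borel_measurable borel. density (?\<nu> k) (indicator (- S)) = density lborel f"
  proof (intro allI jordan_rotated_density[OF \<mu> S])
    fix A :: "complex set" assume A: "A \<in> null_sets lborel" "A \<inter> S = {}"
    then have "A \<in> sets borel" by auto
    then show "\<mu> A = 0" using \<mu>_off A ac by simp
  qed
  then obtain f where f [measurable]: "\<And>k. f k \<in> borel_measurable borel"
    and f_dens: "\<And>k. density (?\<nu> k) (indicator (- S)) = density lborel (f k)" by metis
  have f_int: "(\<integral>\<^sup>+z. f k z * indicator X z \<partial>lborel) = emeasure (?\<nu> k) (X - S)" if [measurable]: "X \<in> sets borel" for k X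
  proof -
    have "(\<integral>\<^sup>+z. f k z * indicator X z \<partial>lborel) = emeasure (density (?\<nu> k) (indicator (- S))) X"
      unfolding f_dens by (subst emeasure_density) auto
    also have "\<dots> = emeasure (?\<nu> k) (X - S)"
      by (subst emeasure_density) (auto simp: nn_integral_indicator[symmetric] simp del: nn_integral_indicator intro!: nn_integral_cong split: split_indicator)
    finally show ?thesis .
  qed
  define p where "p k z = enn2real (f k z)" for k z
  have p [measurable]: "p k \<in> borel_measurable borel" for k unfolding p_def by measurable
  define g where "g z = (\<Sum>k<4. ?a k * complex_of_real (p k z))" for z
  have g [measurable]: "g \<in> borel_measurable borel" unfolding g_def by measurable
  obtain N where N: "N \<in> null_sets lborel" and N_int: "\<And>z k. z \<notin> N \<Longrightarrow> k < 4 \<Longrightarrow> integrable (?\<nu> k) (\<lambda>\<zeta>. 1 / (\<zeta> - z))"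
  proof -
    obtain N where "{z \<in> space lborel. \<not> (\<forall>i\<in>{..<4}. integrable (?\<nu> i) (\<lambda>\<zeta>. 1 / (\<zeta> - z)))} \<subseteq> N"
      "emeasure lborel N = 0" "N \<in> sets lborel" using AE_integrable_kernels by (rule AE_E)
    then show ?thesis by (intro that[of N]) auto
  qed
  have Nb [measurable]: "N \<in> sets borel" using N by auto
  note [measurable] = B(1)
  \<comment> \<open>Tailored to \<open>null_set_of_zeros\<close>: off \<open>S\<close> the Jordan
    parts have densities, off \<open>N\<close> the kernels are integrable, and \<open>n\<close>
    bounds both the set and the densities.\<close>
  define A where "A q n = {z \<in> B - S - N. norm z < real n \<and> (\<forall>k\<in>{..<4}. f k z \<le> ennreal (real n)) \<and> norm (g z - q) \<le> norm q / 4}" for q and n :: nat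
  have A [measurable]: "A q n \<in> sets borel" for q n unfolding A_def by measurable
  have A_null: "A q n \<in> null_sets lborel" if q: "q \<noteq> 0" for q n
  proof -
    have fp: "f k z = ennreal (p k z)" "p k z \<le> real n" if "z \<in> A q n" "k < 4" for z k
    proof -
      have "f k z \<le> ennreal (real n)" using that by (auto simp: A_def)
      then show "f k z = ennreal (p k z)" "p k z \<le> real n"
        unfolding p_def by (auto intro!: enn2real_leI simp: ennreal_enn2real_if top_unique)
    qed
    have "emeasure lborel (A q n) = 0"
    proof (rule null_set_of_zeros[OF A, of q n _ p "real n" q])
      show "A q n \<subseteq> ball 0 (real n)" by (auto simp: A_def)
      show "integrable (?\<nu> k) (\<lambda>\<zeta>. 1 / (\<zeta> - z))" if "z \<in> A q n" "k \<in> {..<4}" for z k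
        using that by (intro N_int) (auto simp: A_def)
      show "potential z = 0" if "z \<in> A q n" for z
        using that B(2) N_int by (intro cauchy_pv_zero_imp_potential_zero[OF \<mu>]) (auto simp: A_def)
      show "0 \<le> p k z \<and> p k z \<le> real n" if "k \<in> {..<4}" "z \<in> A q n" for k z
        using fp(2)[OF that(2)] that(1) by (auto simp: p_def)
      show "norm ((\<Sum>k\<in>{..<4}. ?a k * complex_of_real (p k z)) - q) \<le> norm q / 4" if "z \<in> A q n" for z
        using that by (auto simp: A_def g_def)
      show "density (?\<nu> k) (indicator (A q n)) = density lborel (\<lambda>z. ennreal (indicator (A q n) z * p k z))" if k: "k \<in> {..<4}" for k
      proof -
        \<comment> \<open>\<open>A q n\<close> avoids \<open>S\<close>, so restricting to
          \<open>- S\<close> first changes nothing and brings in the density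
          \<open>f k\<close>.\<close>
        have "density (?\<nu> k) (indicator (A q n)) = density (?\<nu> k) (\<lambda>z. indicator (- S) z * indicator (A q n) z)"
          by (intro arg_cong[where f="density (?\<nu> k)"]) (auto simp: fun_eq_iff A_def split: split_indicator)
        also have "\<dots> = density (density (?\<nu> k) (indicator (- S))) (indicator (A q n))"
          by (subst density_density_eq) auto
        also have "\<dots> = density lborel (\<lambda>z. f k z * indicator (A q n) z)"
          unfolding f_dens by (subst density_density_eq) auto
        also have "\<dots> = density lborel (\<lambda>z. ennreal (indicator (A q n) z * p k z))"
          using fp(1) k by (intro arg_cong[where f="density lborel"]) (auto simp: fun_eq_iff split: split_indicator)
        finally show ?thesis .
      qed
    qed (use q p in auto)
    then show ?thesis using A by (auto simp: null_sets_def)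
  qed
  obtain D :: "complex set" where D: "countable D" "\<And>X. open X \<Longrightarrow> X \<noteq> {} \<Longrightarrow> \<exists>d\<in>D. d \<in> X"
    using countable_dense_exists by blast
  have "AE z in lborel. \<forall>q\<in>D - {0}. \<forall>n. z \<notin> A q n"
    using D(1) A_null by (subst AE_ball_countable) (auto simp: AE_all_countable intro!: AE_not_in)
  moreover have f_fin: "AE z in lborel. f k z \<noteq> \<infinity>" for k
  proof -
    interpret finite_measure "?\<nu> k" by (rule finite_jordan_rotated[OF \<mu>])
    have "(\<integral>\<^sup>+z. f k z \<partial>lborel) \<noteq> \<infinity>" using f_int[of UNIV k] by (simp add: emeasure_eq_measure)
    then show ?thesis by (intro nn_integral_PInf_AE) auto
  qed
  then have "AE z in lborel. \<forall>k\<in>{..<4}. f k z \<noteq> \<infinity>" by (intro AE_finite_allI) auto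
  moreover have "AE z in lborel. z \<notin> S" "AE z in lborel. z \<notin> N" using S N by (auto intro: AE_not_in)
  ultimately have g0: "AE z in lborel. z \<in> B \<longrightarrow> g z = 0"
  proof eventually_elim
    case (elim z)
    show ?case
    proof (intro impI, rule ccontr)
      assume z: "z \<in> B" "g z \<noteq> 0"
      \<comment> \<open>The fraction 1/5 forces \<open>norm q > 4 / 5 * norm (g z)\<close>, so that
        the distance from \<open>g z\<close> to \<open>q\<close> is below
        \<open>norm q / 4\<close>.\<close>
      obtain q where q: "q \<in> D" "q \<in> ball (g z) (norm (g z) / 5)"
        using D(2)[of "ball (g z) (norm (g z) / 5)"] z(2) by auto
      have q2: "norm (g z - q) < norm (g z) / 5" using q(2) by (simp add: dist_norm)
      have q1: "norm (g z) \<le> norm (g z - q) + norm q" using norm_triangle_ineq[of "g z - q" q] by simp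
      have q3: "norm (g z - q) \<le> norm q / 4" using q1 q2 by linarith
      have q4: "q \<noteq> 0" using q1 q2 by auto
      \<comment> \<open>A bound on the sum serves \<open>norm z\<close> and all \<open>p k z\<close>
        at once.\<close>
      have "\<exists>n. norm z + (\<Sum>k<4. p k z) < real n" by (rule reals_Archimedean2)
      then obtain n where n: "norm z + (\<Sum>k<4. p k z) < real n" ..
      have ps: "0 \<le> (\<Sum>k<4. p k z)" "\<And>k. k < 4 \<Longrightarrow> p k z \<le> (\<Sum>k<4. p k z)"
        by (auto simp: p_def intro!: sum_nonneg member_le_sum)
      have "f k z \<le> ennreal (real n)" if "k < 4" for k
      proof -
        have "f k z = ennreal (p k z)" using elim that unfolding p_def by (simp add: ennreal_enn2real_if)
        then show ?thesis using n ps(2)[OF that] norm_ge_zero[of z] by (simp add: ennreal_leI del: norm_ge_zero)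
      qed
      then have "z \<in> A q n" unfolding A_def using z elim q3 n ps(1) by auto
      then show False using elim q(1) q4 by auto
    qed
  qed
  have meas: "integrable lborel (\<lambda>z. complex_of_real (indicator B z * p k z))"
    "complex_of_real (measure (?\<nu> k) (B - S)) = (LBINT z. complex_of_real (indicator B z * p k z))" for k
  proof -
    interpret finite_measure "?\<nu> k" by (rule finite_jordan_rotated[OF \<mu>])
    have nn: "(\<integral>\<^sup>+z. ennreal (indicator B z * p k z) \<partial>lborel) = emeasure (?\<nu> k) (B - S)"
      unfolding f_int[OF B(1), symmetric]
    proof (rule nn_integral_cong_AE)
      show "AE z in lborel. ennreal (indicator B z * p k z) = f k z * indicator B z"
        using f_fin[of k] by eventually_elim (auto simp: p_def ennreal_enn2real_if split: split_indicator)
    qed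
    have ge: "0 \<le> indicator B z * p k z" for z by (simp add: p_def)
    have i: "integrable lborel (\<lambda>z. indicator B z * p k z)"
      using nn ge by (intro integrableI_nonneg) (auto simp: emeasure_eq_measure)
    then show "integrable lborel (\<lambda>z. complex_of_real (indicator B z * p k z))" by (rule integrable_of_real)
    have "measure (?\<nu> k) (B - S) = (LBINT z. indicator B z * p k z)"
      using nn ge by (subst integral_eq_nn_integral) (auto simp: measure_def)
    then show "complex_of_real (measure (?\<nu> k) (B - S)) = (LBINT z. complex_of_real (indicator B z * p k z))"
      by (simp only: integral_complex_of_real)
  qed
  have "\<mu>\<^sub>a B = \<mu>\<^sub>a (B \<inter> S) + \<mu>\<^sub>a (B - S)"
    using complex_measure_Un[OF \<mu>a, of "B \<inter> S" "B - S"] by (simp add: Int_Diff_Un Int_Diff_disjoint)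
  also have "\<mu>\<^sub>a (B \<inter> S) = 0" using S B(1) by (intro ac null_set_Int1) auto
  also have "\<mu>\<^sub>a (B - S) = \<mu> (B - S)" by (intro \<mu>_off[symmetric]) auto
  also have "\<dots> = (\<Sum>k<4. ?a k * measure (?\<nu> k) (B - S))" by (intro complex_measure_eq_sum \<mu>) auto
  also have "\<dots> = (\<Sum>k<4. ?a k * (LBINT z. complex_of_real (indicator B z * p k z)))"
    unfolding meas(2) ..
  also have "\<dots> = (LBINT z. \<Sum>k<4. ?a k * complex_of_real (indicator B z * p k z))"
    by (intro integral_lincomb[symmetric] meas(1))
  also have "\<dots> = 0"
  proof (rule integral_eq_zero_AE)
    show "AE z in lborel. (\<Sum>k<4. ?a k * complex_of_real (indicator B z * p k z)) = 0"
      using g0 by eventually_elim (auto simp: g_def split: split_indicator)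
  qed
  finally show ?thesis by simp
qed

theorem corollary4p4:
  fixes \<mu> \<mu>\<^sub>a \<mu>\<^sub>s :: "complex set \<Rightarrow> complex"
  assumes "complex_measure borel \<mu>"
    and "lebesgue_decomposition lborel \<mu> \<mu>\<^sub>a \<mu>\<^sub>s"
  shows "{z. cauchy_pv_exists \<mu> z \<and> cauchy_pv \<mu> z = 0} \<in> null_sets (variation_measure borel \<mu>\<^sub>a)"
proof -
  let ?E = "{z. cauchy_pv_exists \<mu> z \<and> cauchy_pv \<mu> z = 0}"
  have E: "?E \<in> sets borel" by (rule cauchy_pv_zero_borel[OF assms(1)])
  have "?E \<in> sets (variation_measure borel \<mu>\<^sub>a)"
    unfolding variation_measure_def using E sets.sigma_sets_eq[of borel] by simp
  moreover have "emeasure (variation_measure borel \<mu>\<^sub>a) ?E = 0"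
  proof -
    \<comment> \<open>Every member of a partition of the zero set is a Borel subset of it, hence has
      \<open>\<mu>\<^sub>a\<close> equal to 0.\<close>
    have "(\<Sum>n. ennreal (norm (\<mu>\<^sub>a (P n)))) \<le> 0"
      if P: "P \<in> {P :: nat \<Rightarrow> complex set. range P \<subseteq> sets borel \<and> disjoint_family P \<and> (\<Union>n. P n) = ?E}" for P
    proof -
      have "range P \<subseteq> sets borel" and U: "(\<Union>n. P n) = ?E" using P by (simp_all only: mem_Collect_eq)
      then have "\<mu>\<^sub>a (P n) = 0" for n
      proof (intro ac_part_zero_on_zeros[OF assms])
        show "P n \<subseteq> ?E" unfolding U[symmetric] by blast
      qed blast
      then show ?thesis by simp
    qed
    then have "(SUP P \<in> {P :: nat \<Rightarrow> complex set. range P \<subseteq> sets borel \<and> disjoint_family P \<and> (\<Union>n. P n) = ?E}.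
        \<Sum>n. ennreal (norm (\<mu>\<^sub>a (P n)))) = 0"
      by (intro antisym SUP_least zero_le)
    \<comment> \<open>\<open>emeasure\<close> of a \<open>measure_of\<close> is either the given set
      function or 0 by default; both are 0 here.\<close>
    then show ?thesis unfolding variation_measure_def by (simp add: emeasure_measure_of_conv)
  qed
  ultimately show ?thesis by (auto simp: null_sets_def)
qed

end
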